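(* Suppose that $T\in\mathcal{L}(H)$ has the polar decomposition $T=U|T|$. Let $\widetilde{U}=U^*U^2$ and, for $\alpha>0$ and $\beta>0$, let $T_{\alpha,\beta}=|T|^{\alpha}U|T|^{\beta}$. Then the following statements are equivalent: (i) $T^2=U^2|T^2|$ is the polar decomposition of $T^2$; (ii) $T$ is binormal; (iii) for all $\alpha>0$ and all $\beta>0$, $T_{\alpha,\beta}=\widetilde{U}\,|T_{\alpha,\beta}|$ is the polar decomposition of $T_{\alpha,\beta}$; (iv) for all $\alpha>0$ and all $\beta>0$, $T_{\alpha,\beta}=\widetilde{U}\,|T_{\alpha,\beta}|$; (v) there exist $\alpha>0$ and $\beta>0$ such that $T_{\alpha,\beta}=\widetilde{U}\,|T_{\alpha,\beta}|$. Moreover, if these equivalent conditions hold, then for any $\alpha>0$ and $\beta>0$, $$|T_{\alpha,\beta}|=U^*|T|^{\alpha}U\cdot|T|^{\beta}=|T|^{\beta}\cdot U^*|T|^{\alpha}U,\qquad |T_{\alpha,\beta}^*|=|T|^{\alpha}\cdot|T^*|^{\beta}=|T^*|^{\beta}\cdot|T|^{\alpha}.$$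
   Context: $\mathfrak{A}$ is a $C^*$-algebra, $H$ is a (right) Hilbert $\mathfrak{A}$-module, and $\mathcal{L}(H)$ is the $C^*$-algebra of adjointable operators on $H$. For $T\in\mathcal{L}(H)$, $|T|=(T^*T)^{1/2}$, $|T^*|=(TT^* )^{1/2}$, and $\mathcal{R}(T)$ is the range of $T$; real powers of positive operators are defined by continuous functional calculus. A closed submodule $M\subseteq H$ is orthogonally complemented if $H=M\dotplus M^\perp$; then $P_M$ denotes the projection from $H$ onto $M$. An element $W\in\mathcal{L}(H)$ is a partial isometry if $W^*W$ is a projection. "$T=U|T|$ is the polar decomposition of $T$" means: $U\in\mathcal{L}(H)$ is a partial isometry, $T=U|T|$, $\overline{\mathcal{R}(T^* )}$ is orthogonally complemented, and $U^*U=P_{\overline{\mathcal{R}(T^* )}}$. (Such a $U$ is unique when it exists, and it exists if and only if both $\overline{\mathcal{R}(T^* )}$ and $\overline{\mathcal{R}(T)}$ are orthogonally complemented.) An element $T\in\mathcal{L}(H)$ is called binormal if $T^*T$ and $TT^*$ commute. *)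

theory Defs
  imports "HOL-Analysis.Analysis"
begin

text \<open>Complex Banach spaces and (not necessarily unital) C*-algebras.\<close>

class complex_banach = banach +
  fixes scaleC :: "complex \<Rightarrow> 'a \<Rightarrow> 'a"  (infixr \<open>*\<^sub>C\<close> 75)
  assumes scaleC_add_right: "c *\<^sub>C (x + y) = c *\<^sub>C x + c *\<^sub>C y"
    and scaleC_add_left: "(c + d) *\<^sub>C x = c *\<^sub>C x + d *\<^sub>C x"
    and scaleC_scaleC: "c *\<^sub>C d *\<^sub>C x = (c * d) *\<^sub>C x"
    and scaleR_scaleC: "r *\<^sub>R x = complex_of_real r *\<^sub>C x"
    and norm_scaleC: "norm (c *\<^sub>C x) = cmod c * norm x"

class cstar_algebra = complex_banach + real_normed_algebra +
  fixes star :: "'a \<Rightarrow> 'a"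
  assumes mult_scaleC_left: "(c *\<^sub>C x) * y = c *\<^sub>C (x * y)"
    and mult_scaleC_right: "x * (c *\<^sub>C y) = c *\<^sub>C (x * y)"
    and star_add: "star (x + y) = star x + star y"
    and star_scaleC: "star (c *\<^sub>C x) = cnj c *\<^sub>C star x"
    and star_mult: "star (x * y) = star y * star x"
    and star_star: "star (star x) = x"
    and cstar_identity: "norm (star x * x) = (norm x)\<^sup>2"

definition positive_element :: "'a::cstar_algebra \<Rightarrow> bool" where
  "positive_element a \<longleftrightarrow> (\<exists>b. a = star b * b)"

text \<open>Right Hilbert modules over a C*-algebra. The module is a whole type, whose norm is the one
  induced by the inner product; completeness is part of the class. The inner product is linear in
  the second argument.\<close>

locale hilbert_module =
  fixes act :: "'h::complex_banach \<Rightarrow> 'a::cstar_algebra \<Rightarrow> 'h"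
    and ip :: "'h \<Rightarrow> 'h \<Rightarrow> 'a"
  assumes act_add_left: "act (x + y) a = act x a + act y a"
    and act_add_right: "act x (a + b) = act x a + act x b"
    and act_mult: "act x (a * b) = act (act x a) b"
    and act_scaleC_left: "act (c *\<^sub>C x) a = c *\<^sub>C act x a"
    and act_scaleC_right: "act x (c *\<^sub>C a) = c *\<^sub>C act x a"
    and ip_add_right: "ip x (y + z) = ip x y + ip x z"
    and ip_scaleC_right: "ip x (c *\<^sub>C y) = c *\<^sub>C ip x y"
    and ip_act_right: "ip x (act y a) = ip x y * a"
    and ip_star: "star (ip x y) = ip y x"
    and ip_positive: "positive_element (ip x x)"
    and ip_definite: "ip x x = 0 \<Longrightarrow> x = 0"
    and norm_eq_ip: "norm x = sqrt (norm (ip x x))"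

text \<open>The elements of \<open>\<L>(H)\<close> are the functions satisfying \<open>adjointable ip\<close>; linearity and
  boundedness are consequences. The product is composition and the unit is \<open>id\<close>.\<close>

definition adjointable :: "('h \<Rightarrow> 'h \<Rightarrow> 'a) \<Rightarrow> ('h \<Rightarrow> 'h) \<Rightarrow> bool" where
  "adjointable ip T \<longleftrightarrow> (\<exists>S. \<forall>x y. ip (T x) y = ip x (S y))"

definition adj :: "('h \<Rightarrow> 'h \<Rightarrow> 'a) \<Rightarrow> ('h \<Rightarrow> 'h) \<Rightarrow> 'h \<Rightarrow> 'h" where
  "adj ip T = (THE S. \<forall>x y. ip (T x) y = ip x (S y))"

text \<open>The spectrum is taken in \<open>\<L>(H)\<close>: the inverse has to be adjointable.\<close>

definition spectrum :: "('h::complex_banach \<Rightarrow> 'h \<Rightarrow> 'a) \<Rightarrow> ('h \<Rightarrow> 'h) \<Rightarrow> complex set" where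
  "spectrum ip T = {z. \<not> (\<exists>S. adjointable ip S \<and>
      S \<circ> (\<lambda>x. T x - z *\<^sub>C x) = id \<and> (\<lambda>x. T x - z *\<^sub>C x) \<circ> S = id)}"

text \<open>\<open>\<Phi>\<close> is a unital *-homomorphism from the continuous functions on the spectrum of \<open>T\<close> to
  \<open>\<L>(H)\<close> which sends the inclusion function to \<open>T\<close>. Continuous functions on the spectrum are
  represented by total functions, so \<open>\<Phi>\<close> is required to depend on their restrictions only. For
  normal \<open>T\<close> such a \<open>\<Phi>\<close> exists and its values at these functions are unique.\<close>

definition is_functional_calculus ::
  "('h::complex_banach \<Rightarrow> 'h \<Rightarrow> 'a) \<Rightarrow> ('h \<Rightarrow> 'h) \<Rightarrow>
    ((complex \<Rightarrow> complex) \<Rightarrow> 'h \<Rightarrow> 'h) \<Rightarrow> bool" where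
  "is_functional_calculus ip T \<Phi> \<longleftrightarrow>
    \<Phi> (\<lambda>z. 1) = id \<and> \<Phi> (\<lambda>z. z) = T \<and>
    (\<forall>f. continuous_on (spectrum ip T) f \<longrightarrow>
      adjointable ip (\<Phi> f) \<and>
      \<Phi> (\<lambda>z. cnj (f z)) = adj ip (\<Phi> f) \<and>
      (\<forall>c. \<Phi> (\<lambda>z. c * f z) = (\<lambda>x. c *\<^sub>C \<Phi> f x)) \<and>
      (\<forall>g. continuous_on (spectrum ip T) g \<longrightarrow>
        \<Phi> (\<lambda>z. f z + g z) = (\<lambda>x. \<Phi> f x + \<Phi> g x) \<and>
        \<Phi> (\<lambda>z. f z * g z) = \<Phi> f \<circ> \<Phi> g \<and>
        ((\<forall>z\<in>spectrum ip T. f z = g z) \<longrightarrow> \<Phi> f = \<Phi> g)))"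

definition cfc :: "('h::complex_banach \<Rightarrow> 'h \<Rightarrow> 'a) \<Rightarrow> ('h \<Rightarrow> 'h) \<Rightarrow>
    (complex \<Rightarrow> complex) \<Rightarrow> 'h \<Rightarrow> 'h" where
  "cfc ip T = (SOME \<Phi>. is_functional_calculus ip T \<Phi>)"

text \<open>\<open>op_powr ip T \<alpha>\<close> is \<open>T\<^sup>\<alpha>\<close>, meant for positive \<open>T\<close> and \<open>\<alpha> > 0\<close>: the spectrum then lies in
  the nonnegative reals, where \<open>z \<mapsto> Re z powr \<alpha>\<close> is continuous.\<close>

definition op_powr :: "('h::complex_banach \<Rightarrow> 'h \<Rightarrow> 'a) \<Rightarrow> ('h \<Rightarrow> 'h) \<Rightarrow> real \<Rightarrow> 'h \<Rightarrow> 'h" where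
  "op_powr ip T \<alpha> = cfc ip T (\<lambda>z. complex_of_real (Re z powr \<alpha>))"

definition op_abs :: "('h::complex_banach \<Rightarrow> 'h \<Rightarrow> 'a) \<Rightarrow> ('h \<Rightarrow> 'h) \<Rightarrow> 'h \<Rightarrow> 'h" where
  "op_abs ip T = op_powr ip (adj ip T \<circ> T) (1/2)"

definition closed_submodule :: "('h::complex_banach \<Rightarrow> 'a \<Rightarrow> 'h) \<Rightarrow> 'h set \<Rightarrow> bool" where
  "closed_submodule act M \<longleftrightarrow> closed M \<and> 0 \<in> M \<and> (\<forall>x\<in>M. \<forall>y\<in>M. x + y \<in> M) \<and>
    (\<forall>c. \<forall>x\<in>M. c *\<^sub>C x \<in> M) \<and> (\<forall>a. \<forall>x\<in>M. act x a \<in> M)"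

definition orth :: "('h \<Rightarrow> 'h \<Rightarrow> 'a::zero) \<Rightarrow> 'h set \<Rightarrow> 'h set" where
  "orth ip M = {x. \<forall>y\<in>M. ip x y = 0}"

definition orth_complemented ::
  "('h::complex_banach \<Rightarrow> 'a \<Rightarrow> 'h) \<Rightarrow> ('h \<Rightarrow> 'h \<Rightarrow> 'a::zero) \<Rightarrow> 'h set \<Rightarrow> bool" where
  "orth_complemented act ip M \<longleftrightarrow> closed_submodule act M \<and>
    M \<inter> orth ip M = {0} \<and> (\<forall>x. \<exists>y\<in>M. \<exists>z\<in>orth ip M. x = y + z)"

definition proj_onto :: "('h::complex_banach \<Rightarrow> 'h \<Rightarrow> 'a::zero) \<Rightarrow> 'h set \<Rightarrow> 'h \<Rightarrow> 'h" where
  "proj_onto ip M x = (THE y. y \<in> M \<and> x - y \<in> orth ip M)"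

definition projection :: "('h \<Rightarrow> 'h \<Rightarrow> 'a) \<Rightarrow> ('h \<Rightarrow> 'h) \<Rightarrow> bool" where
  "projection ip P \<longleftrightarrow> adjointable ip P \<and> adj ip P = P \<and> P \<circ> P = P"

definition partial_isometry :: "('h \<Rightarrow> 'h \<Rightarrow> 'a) \<Rightarrow> ('h \<Rightarrow> 'h) \<Rightarrow> bool" where
  "partial_isometry ip W \<longleftrightarrow> adjointable ip W \<and> projection ip (adj ip W \<circ> W)"

text \<open>\<open>polar_decomposition act ip T U\<close>: ``\<open>T = U|T|\<close> is the polar decomposition of \<open>T\<close>''.\<close>

definition polar_decomposition ::
  "('h::complex_banach \<Rightarrow> 'a \<Rightarrow> 'h) \<Rightarrow> ('h \<Rightarrow> 'h \<Rightarrow> 'a::zero) \<Rightarrow> ('h \<Rightarrow> 'h) \<Rightarrow> ('h \<Rightarrow> 'h) \<Rightarrow> bool" where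
  "polar_decomposition act ip T U \<longleftrightarrow>
    partial_isometry ip U \<and> T = U \<circ> op_abs ip T \<and>
    orth_complemented act ip (closure (range (adj ip T))) \<and>
    adj ip U \<circ> U = proj_onto ip (closure (range (adj ip T)))"

definition binormal :: "('h \<Rightarrow> 'h \<Rightarrow> 'a) \<Rightarrow> ('h \<Rightarrow> 'h) \<Rightarrow> bool" where
  "binormal ip T \<longleftrightarrow> (adj ip T \<circ> T) \<circ> (T \<circ> adj ip T) = (T \<circ> adj ip T) \<circ> (adj ip T \<circ> T)"

text \<open>\<open>T\<^sub>\<alpha>\<^sub>,\<^sub>\<beta> = |T|\<^sup>\<alpha> U |T|\<^sup>\<beta>\<close>\<close>

definition aluthge :: "('h::complex_banach \<Rightarrow> 'h \<Rightarrow> 'a) \<Rightarrow> ('h \<Rightarrow> 'h) \<Rightarrow> ('h \<Rightarrow> 'h) \<Rightarrow>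
    real \<Rightarrow> real \<Rightarrow> 'h \<Rightarrow> 'h" where
  "aluthge ip T U \<alpha> \<beta> = op_powr ip (op_abs ip T) \<alpha> \<circ> U \<circ> op_powr ip (op_abs ip T) \<beta>"

end

theory Submission
  imports Defs "HOL-Computational_Algebra.Fundamental_Theorem_Algebra"
begin

text \<open>
  Write \<open>P = |T|\<close> and \<open>B = |T\<^sup>*|\<close>, and let \<open>Q = U\<^sup>* U\<close> and \<open>E = U U\<^sup>*\<close> be the initial and final
  projections of \<open>U\<close>. The operator \<open>U P U\<^sup>*\<close> is positive with square \<open>T T\<^sup>*\<close>, so it is \<open>B\<close>; hence \<open>U\<close>
  intertwines \<open>P\<^sup>\<alpha>\<close> with \<open>B\<^sup>\<alpha>\<close> (\<open>U_P\<close>, \<open>Us_B\<close>), and \<open>T\<close> is binormal iff some, equivalently every, pair of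
  positive powers \<open>P\<^sup>\<alpha>\<close> and \<open>B\<^sup>\<beta>\<close> commutes.

  If they commute, then \<open>E\<close>, which projects onto the closure of the range of \<open>B\<close>, commutes with \<open>P\<close>,
  and likewise \<open>Q\<close> with \<open>B\<close> and \<open>Q\<close> with \<open>E\<close>. With these relations \<open>U\<^sup>* P\<^sup>\<alpha> U P\<^sup>\<beta>\<close> is positive and
  squares to \<open>T\<^sub>\<alpha>\<^sub>,\<^sub>\<beta>\<^sup>* T\<^sub>\<alpha>\<^sub>,\<^sub>\<beta>\<close>, so it is the modulus (\<open>abs_S\<close>), and multiplying it by \<open>U\<^sup>* U\<^sup>2\<close> gives
  \<open>T\<^sub>\<alpha>\<^sub>,\<^sub>\<beta>\<close>. In a Hilbert module a kernel does not determine the closure of the range of the adjoint, so the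
  range condition in a polar decomposition is a genuine density statement; it is proved by transporting
  the closures of the ranges of \<open>P\<^sup>\<alpha>\<close> and \<open>B\<^sup>\<beta>\<close> through \<open>U\<^sup>*\<close> (\<open>range_F\<close>).

  Conversely, let \<open>N = |T\<^sub>\<alpha>\<^sub>,\<^sub>\<beta>|\<close> and \<open>T\<^sub>\<alpha>\<^sub>,\<^sub>\<beta> = U\<^sup>* U\<^sup>2 N\<close>. Comparing inner squares, \<open>U\<^sup>* U\<^sup>2\<close> must be isometric on
  the range of \<open>N\<close>, so neither \<open>U\<close> nor \<open>Q\<close> in \<open>U\<^sup>* U\<^sup>2 = Q U\<close> loses anything there: \<open>T\<^sub>\<alpha>\<^sub>,\<^sub>\<beta> = U N\<close> and \<open>U\<^sup>* P\<^sup>\<alpha> U P\<^sup>\<beta> = N\<close> is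
  self-adjoint. Conjugating by \<open>U\<close> turns this into \<open>P\<^sup>\<alpha> B\<^sup>\<beta> = B\<^sup>\<beta> P\<^sup>\<alpha>\<close> (\<open>binormal_if_S_eq_Ut_abs\<close>).
  The square is covered by the case \<open>\<alpha> = \<beta> = 1\<close>, because \<open>|T\<^sup>2| = |T\<^sub>1\<^sub>,\<^sub>1|\<close> and \<open>U\<^sup>* T\<^sup>2 = T\<^sub>1\<^sub>,\<^sub>1\<close>.

  Most of the text constructs what this argument takes for granted: the continuous functional calculus of
  a self-adjoint \<open>T\<close>, and the positivity of \<open>S\<^sup>* S\<close>. The calculus extends \<open>p \<mapsto> p(T)\<close> by uniform limits,
  which needs \<open>\<parallel>p(T)\<parallel> \<le> K sup |p|\<close> over the spectrum. That bound combines a spectral radius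
  bound, obtained by averaging resolvents over roots of unity, with the inequality
  \<open>\<parallel>S x\<parallel>\<^sup>2 \<le> K \<parallel>x\<parallel> \<parallel>S\<^sup>2 x\<parallel>\<close> for self-adjoint \<open>S\<close>. Here \<open>K\<close> is the constant of a Cauchy--Schwarz
  inequality. Polarization gives \<open>K = 4\<close> in every Hilbert module, whereas \<open>K = 1\<close> holds in the algebra,
  viewed as a module over itself. In the latter case nonnegative spectra add up, the argument of Kelley
  and Vaught applies, and it yields that \<open>b\<^sup>* b + c\<^sup>* c = 0\<close> forces \<open>b = 0\<close>. This single fact about the
  algebra brings positivity of \<open>S\<^sup>* S\<close> to all Hilbert modules.
\<close>

section \<open>Complex Banach spaces and C*-algebras\<close>

lemma scaleC_one [simp]: "1 *\<^sub>C (x::'a::complex_banach) = x"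
  using scaleR_scaleC[of 1 x] by simp

lemma bounded_linear_scaleC: "bounded_linear (\<lambda>x::'a::complex_banach. c *\<^sub>C x)"
proof (rule bounded_linear_intro)
  show "c *\<^sub>C (x + y) = c *\<^sub>C x + c *\<^sub>C y" for x y :: 'a by (rule scaleC_add_right)
  show "c *\<^sub>C (r *\<^sub>R x) = r *\<^sub>R (c *\<^sub>C x)" for r and x :: 'a
    by (simp add: scaleR_scaleC scaleC_scaleC mult.commute)
  show "norm (c *\<^sub>C x) \<le> norm x * cmod c" for x :: 'a by (simp add: norm_scaleC)
qed

lemma bounded_linear_scaleC_left: "bounded_linear (\<lambda>c. c *\<^sub>C (x::'a::complex_banach))"
proof (rule bounded_linear_intro)
  show "(c + d) *\<^sub>C x = c *\<^sub>C x + d *\<^sub>C x" for c d by (rule scaleC_add_left)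
  show "(r *\<^sub>R c) *\<^sub>C x = r *\<^sub>R (c *\<^sub>C x)" for r c
    by (simp add: scaleR_scaleC scaleC_scaleC scaleR_conv_of_real)
  show "norm (c *\<^sub>C x) \<le> norm c * norm x" for c by (simp add: norm_scaleC)
qed

lemma scaleC_zero_right [simp]: "c *\<^sub>C (0::'a::complex_banach) = 0"
  using linear_0[OF bounded_linear.linear[OF bounded_linear_scaleC[where c=c]]] .

lemma scaleC_zero_left [simp]: "0 *\<^sub>C (x::'a::complex_banach) = 0"
  using linear_0[OF bounded_linear.linear[OF bounded_linear_scaleC_left[where x=x]]] .

lemma scaleC_minus_left [simp]: "(- c) *\<^sub>C x = - (c *\<^sub>C (x::'a::complex_banach))"
  using linear_neg[OF bounded_linear.linear[OF bounded_linear_scaleC_left[where x=x]]] .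

lemma scaleC_diff_right: "c *\<^sub>C (x - y) = c *\<^sub>C x - c *\<^sub>C (y::'a::complex_banach)"
  using linear_diff[OF bounded_linear.linear[OF bounded_linear_scaleC[where c=c]]] .

lemma scaleC_diff_left: "(c - d) *\<^sub>C x = c *\<^sub>C x - d *\<^sub>C (x::'a::complex_banach)"
  using linear_diff[OF bounded_linear.linear[OF bounded_linear_scaleC_left[where x=x]]] .

lemma scaleC_eq_0_iff [simp]: "c *\<^sub>C x = 0 \<longleftrightarrow> c = 0 \<or> (x::'a::complex_banach) = 0"
  using norm_scaleC[of c x] by (metis mult_eq_0_iff norm_eq_zero)

lemmas scaleC_simps = scaleC_add_right scaleC_add_left scaleC_diff_right scaleC_diff_left
  scaleC_scaleC

lemma star_zero [simp]: "star (0::'a::cstar_algebra) = 0"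
  using star_add[of "0::'a" 0] by simp

text \<open>By the C*-identity and submultiplicativity, \<open>\<parallel>y\<parallel>\<^sup>2 = \<parallel>y\<^sup>* y\<parallel> \<le> \<parallel>y\<^sup>*\<parallel> \<parallel>y\<parallel>\<close>; this is used for \<open>x\<close> and for \<open>x\<^sup>*\<close>.\<close>

lemma norm_star [simp]: "norm (star x) = norm (x::'a::cstar_algebra)"
proof -
  have le: "norm y \<le> norm (star y)" for y :: 'a
  proof -
    have "norm y * norm y \<le> norm (star y) * norm y"
      using norm_mult_ineq[of "star y" y] by (simp add: cstar_identity power2_eq_square)
    then show ?thesis by (cases "y = 0") auto
  qed
  show ?thesis using le[of x] le[of "star x"] by (simp add: star_star)
qed

lemma star_mult_self_eq_0: "star x * x = 0 \<Longrightarrow> x = (0::'a::cstar_algebra)"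
  using cstar_identity[of x] by simp

section \<open>Adjointable operators are bounded and complex linear\<close>

definition bounded_clinear :: "('h::complex_banach \<Rightarrow> 'h) \<Rightarrow> bool" where
  "bounded_clinear T \<longleftrightarrow> bounded_linear T \<and> (\<forall>c x. T (c *\<^sub>C x) = c *\<^sub>C T x)"

lemma bounded_clinear_id: "bounded_clinear (\<lambda>x. x)"
  by (simp add: bounded_clinear_def bounded_linear_ident)

lemma bounded_clinear_compose:
  "bounded_clinear S \<Longrightarrow> bounded_clinear T \<Longrightarrow> bounded_clinear (\<lambda>x. S (T x))"
  by (auto simp: bounded_clinear_def intro: bounded_linear_compose)

lemma bounded_clinear_add:
  "bounded_clinear S \<Longrightarrow> bounded_clinear T \<Longrightarrow> bounded_clinear (\<lambda>x. S x + T x)"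
  by (auto simp: bounded_clinear_def scaleC_add_right intro: bounded_linear_add)

lemma bounded_clinear_scaleC:
  "bounded_clinear T \<Longrightarrow> bounded_clinear (\<lambda>x. c *\<^sub>C T x)"
  by (auto simp: bounded_clinear_def scaleC_scaleC mult.commute
      intro: bounded_linear_compose[OF bounded_linear_scaleC])

lemma bounded_clinear_funpow:
  assumes "bounded_clinear T" shows "bounded_clinear (T ^^ n)"
  by (induction n) (use assms bounded_clinear_id bounded_clinear_compose in \<open>auto simp: id_def comp_def\<close>)

context
  fixes T :: "'h::complex_banach \<Rightarrow> 'h" assumes T: "bounded_clinear T"
begin

lemma bclin_add: "T (x + y) = T x + T y"
  and bclin_diff: "T (x - y) = T x - T y"
  and bclin_zero: "T 0 = 0"
  and bclin_scaleC: "T (c *\<^sub>C x) = c *\<^sub>C T x"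
  using T linear_add linear_diff linear_0 bounded_linear.linear
  unfolding bounded_clinear_def by blast+

lemma bclin_bound: obtains M where "M > 0" "\<And>x. norm (T x) \<le> M * norm x"
  using T bounded_linear.pos_bounded unfolding bounded_clinear_def
  by (metis mult.commute)

lemma bclin_tendsto: "(f \<longlongrightarrow> l) F \<Longrightarrow> ((\<lambda>n. T (f n)) \<longlongrightarrow> T l) F"
  using T bounded_linear.tendsto unfolding bounded_clinear_def by blast

end

text \<open>The Baire category theorem, in the form that gives the uniform boundedness principle.\<close>

lemma closed_cover_contains_ball:
  fixes E :: "nat \<Rightarrow> 'h::banach set"
  assumes cl: "\<And>n. closed (E n)" and cov: "(\<Union>n. E n) = UNIV"
  obtains n z r where "r > 0" "ball z r \<subseteq> E n"
proof -
  have mc: "Met_TC.mcomplete TYPE('h)"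
    using complete_UNIV by simp
  have "\<exists>n. interior (E n) \<noteq> {}"
  proof (rule ccontr)
    assume "\<not> ?thesis"
    then have e: "interior (E n) = {}" for n by auto
    have "Met_TC.mtopology interior_of (\<Union>(range E)) = {}"
    proof (rule Met_TC.metric_Baire_category_alt[OF mc])
      fix S assume "S \<in> range E"
      then show "closedin Met_TC.mtopology S \<and> Met_TC.mtopology interior_of S = {}"
        using cl e by auto
    qed simp
    then show False using cov by simp
  qed
  then obtain n z where "z \<in> interior (E n)" by auto
  then show ?thesis using that by (meson mem_interior)
qed

text \<open>Unlike \<open>adj\<close>, which is a description and has to be shown defined each time, this relation can be
  composed directly; adjoints are computed by building a pair and applying \<open>adj_eqI\<close>.\<close>

definition adjoint_pair :: "('h \<Rightarrow> 'h \<Rightarrow> 'a) \<Rightarrow> ('h \<Rightarrow> 'h) \<Rightarrow> ('h \<Rightarrow> 'h) \<Rightarrow> bool" where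
  "adjoint_pair ip T S \<longleftrightarrow> (\<forall>x y. ip (T x) y = ip x (S y))"

context hilbert_module
begin

lemma ip_add_left: "ip (x + y) z = ip x z + ip y z"
  by (metis ip_add_right ip_star star_add)

lemma ip_scaleC_left: "ip (c *\<^sub>C x) y = cnj c *\<^sub>C ip x y"
  by (metis ip_scaleC_right ip_star star_scaleC)

lemma ip_scaleR_right: "ip x (r *\<^sub>R y) = r *\<^sub>R ip x y"
  by (simp add: scaleR_scaleC ip_scaleC_right)

lemma ip_scaleR_left: "ip (r *\<^sub>R x) y = r *\<^sub>R ip x y"
  by (simp add: scaleR_scaleC ip_scaleC_left)

lemma ip_zero_right [simp]: "ip x 0 = 0"
  using ip_add_right[of x 0 0] by simp

lemma ip_zero_left [simp]: "ip 0 x = 0"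
  using ip_add_left[of 0 0 x] by simp

lemma ip_minus_right [simp]: "ip x (- y) = - ip x y"
  using ip_add_right[of x y "- y"] by (simp add: eq_neg_iff_add_eq_0 add.commute)

lemma ip_minus_left [simp]: "ip (- x) y = - ip x y"
  using ip_add_left[of x "- x" y] by (simp add: eq_neg_iff_add_eq_0 add.commute)

lemma ip_diff_right: "ip x (y - z) = ip x y - ip x z"
  using ip_add_right[of x y "- z"] by simp

lemma ip_diff_left: "ip (x - y) z = ip x z - ip y z"
  using ip_add_left[of x "- y" z] by simp

lemmas ip_simps = ip_add_left ip_add_right ip_diff_left ip_diff_right
  ip_scaleC_left ip_scaleC_right ip_scaleR_left ip_scaleR_right

lemma norm_ip_self: "norm (ip x x) = (norm x)\<^sup>2"
  using norm_eq_ip[of x] by simp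

lemma ip_self_eq_0_iff [simp]: "ip x x = 0 \<longleftrightarrow> x = 0"
  using ip_definite by auto

lemma ip_eqI_right: "(\<And>z. ip z x = ip z y) \<Longrightarrow> x = y"
  by (metis ip_definite ip_diff_right right_minus_eq)

lemma ip_eqI_left: "(\<And>z. ip x z = ip y z) \<Longrightarrow> x = y"
  by (metis ip_definite ip_diff_left right_minus_eq)

lemma adjoint_pair_sym: "adjoint_pair ip T S \<Longrightarrow> adjoint_pair ip S T"
  unfolding adjoint_pair_def by (metis ip_star)

lemma adj_eqI: "adjoint_pair ip T S \<Longrightarrow> adj ip T = S"
  unfolding adj_def adjoint_pair_def
  by (rule the_equality) (blast, metis ext ip_eqI_right)

lemma adjointable_iff: "adjointable ip T \<longleftrightarrow> adjoint_pair ip T (adj ip T)"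
  using adj_eqI unfolding adjointable_def adjoint_pair_def by metis

lemma adjoint_pairD: "adjoint_pair ip T S \<Longrightarrow> adjointable ip T"
  unfolding adjointable_def adjoint_pair_def by blast

lemma ip_adj: "adjointable ip T \<Longrightarrow> ip (T x) y = ip x (adj ip T y)"
  using adjointable_iff unfolding adjoint_pair_def by blast

lemma ip_adj': "adjointable ip T \<Longrightarrow> ip (adj ip T x) y = ip x (T y)"
  using adjointable_iff adjoint_pair_sym unfolding adjoint_pair_def by blast

lemma adjointable_adj: "adjointable ip T \<Longrightarrow> adjointable ip (adj ip T)"
  using adjointable_iff adjoint_pair_sym adjoint_pairD by blast

lemma adj_adj: "adjointable ip T \<Longrightarrow> adj ip (adj ip T) = T"
  using adjointable_iff adjoint_pair_sym adj_eqI by blast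

lemma adjoint_pair_id: "adjoint_pair ip (\<lambda>x. x) (\<lambda>x. x)"
  by (simp add: adjoint_pair_def)

lemma adjoint_pair_zero: "adjoint_pair ip (\<lambda>x. 0) (\<lambda>x. 0)"
  by (simp add: adjoint_pair_def)

lemma adjoint_pair_comp:
  "adjoint_pair ip T S \<Longrightarrow> adjoint_pair ip T' S' \<Longrightarrow> adjoint_pair ip (\<lambda>x. T (T' x)) (\<lambda>x. S' (S x))"
  by (simp add: adjoint_pair_def)

lemma adjoint_pair_add:
  "adjoint_pair ip T S \<Longrightarrow> adjoint_pair ip T' S' \<Longrightarrow> adjoint_pair ip (\<lambda>x. T x + T' x) (\<lambda>x. S x + S' x)"
  by (simp add: adjoint_pair_def ip_simps)

lemma adjoint_pair_diff:
  "adjoint_pair ip T S \<Longrightarrow> adjoint_pair ip T' S' \<Longrightarrow> adjoint_pair ip (\<lambda>x. T x - T' x) (\<lambda>x. S x - S' x)"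
  by (simp add: adjoint_pair_def ip_simps)

lemma adjoint_pair_scaleC:
  "adjoint_pair ip T S \<Longrightarrow> adjoint_pair ip (\<lambda>x. c *\<^sub>C T x) (\<lambda>x. cnj c *\<^sub>C S x)"
  by (simp add: adjoint_pair_def ip_simps)

lemma adjointable_id: "adjointable ip (\<lambda>x. x)"
  using adjoint_pair_id adjoint_pairD by blast

lemma adjointable_comp: "adjointable ip S \<Longrightarrow> adjointable ip T \<Longrightarrow> adjointable ip (S \<circ> T)"
  unfolding comp_def using adjointable_iff adjoint_pair_comp adjoint_pairD by blast

lemma adjointable_diff:
  "adjointable ip S \<Longrightarrow> adjointable ip T \<Longrightarrow> adjointable ip (\<lambda>x. S x - T x)"
  using adjointable_iff adjoint_pair_diff adjoint_pairD by blast

lemma adjointable_scaleC: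
  "adjointable ip T \<Longrightarrow> adjointable ip (\<lambda>x. c *\<^sub>C T x)"
  using adjointable_iff adjoint_pair_scaleC adjoint_pairD by blast

lemma adj_comp:
  "adjointable ip S \<Longrightarrow> adjointable ip T \<Longrightarrow> adj ip (S \<circ> T) = adj ip T \<circ> adj ip S"
  by (rule adj_eqI) (auto simp: adjoint_pair_def ip_adj)

text \<open>The sharp inequality rests on the order of the algebra; the constant 4 comes from polarization: \<open>4 \<langle>x, y\<rangle>\<close> is a signed sum of four inner squares \<open>\<langle>z, z\<rangle>\<close> with
  \<open>\<parallel>z\<parallel> \<le> 2\<close> if \<open>x\<close> and \<open>y\<close> are in the unit ball.\<close>

lemma weak_cauchy_schwarz: "norm (ip x y) \<le> 4 * norm x * norm y"
proof -
  have unit: "norm (ip x y) \<le> 4" if "norm x \<le> 1" "norm y \<le> 1" for x y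
  proof -
    have le: "norm (ip z z) \<le> 4" if "norm z \<le> 2" for z
      using power_mono[OF that, of 2] by (simp add: norm_ip_self)
    have n: "norm (x + y) \<le> 2" "norm (x - y) \<le> 2"
        "norm (x + \<i> *\<^sub>C y) \<le> 2" "norm (x - \<i> *\<^sub>C y) \<le> 2"
      using that norm_triangle_ineq[of x y] norm_triangle_ineq4[of x y]
        norm_triangle_ineq[of x "\<i> *\<^sub>C y"] norm_triangle_ineq4[of x "\<i> *\<^sub>C y"]
      by (auto simp: norm_scaleC)
    have two: "(2::complex) *\<^sub>C z = z + z" for z :: 'a
      using scaleC_add_left[of 1 1 z] by simp
    have four: "(4::complex) *\<^sub>C z = z + z + z + z" for z :: 'a
      using scaleC_add_left[of 2 2 z] by (simp add: two)
    have pol: "4 *\<^sub>C ip x y = (ip (x + y) (x + y) - ip (x - y) (x - y))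
        - \<i> *\<^sub>C (ip (x + \<i> *\<^sub>C y) (x + \<i> *\<^sub>C y) - ip (x - \<i> *\<^sub>C y) (x - \<i> *\<^sub>C y))"
      by (simp add: ip_simps scaleC_simps four)
    have "norm (4 *\<^sub>C ip x y) \<le> norm (ip (x + y) (x + y)) + norm (ip (x - y) (x - y))
        + (norm (ip (x + \<i> *\<^sub>C y) (x + \<i> *\<^sub>C y)) + norm (ip (x - \<i> *\<^sub>C y) (x - \<i> *\<^sub>C y)))"
    proof -
      have *: "norm ((a - b) - \<i> *\<^sub>C (c - d)) \<le> norm a + norm b + (norm c + norm d)"
        for a b c d :: 'a
        using norm_triangle_ineq4[of "a - b" "\<i> *\<^sub>C (c - d)"] norm_triangle_ineq4[of a b]
          norm_triangle_ineq4[of c d] by (simp add: norm_scaleC)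
      show ?thesis unfolding pol by (rule *)
    qed
    also have "\<dots> \<le> 16" using n[THEN le] by linarith
    finally show ?thesis by (simp add: norm_scaleC)
  qed
  show ?thesis
  proof (cases "x = 0 \<or> y = 0")
    case False
    define x' where "x' = (1 / norm x) *\<^sub>R x"
    define y' where "y' = (1 / norm y) *\<^sub>R y"
    have "norm x' \<le> 1" "norm y' \<le> 1"
      using False by (auto simp: x'_def y'_def)
    then have "norm (ip x' y') \<le> 4" by (rule unit)
    moreover have "norm (ip x' y') = norm (ip x y) / (norm x * norm y)"
      by (simp add: x'_def y'_def ip_simps)
    ultimately show ?thesis using False by (simp add: field_simps)
  qed auto
qed

lemma tendsto_ip_right: "(f \<longlongrightarrow> l) F \<Longrightarrow> ((\<lambda>n. ip x (f n)) \<longlongrightarrow> ip x l) F"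
proof -
  assume f: "(f \<longlongrightarrow> l) F"
  have "norm (ip x y) \<le> norm y * (4 * norm x)" for y
    using weak_cauchy_schwarz[of x y] by (simp add: mult_ac)
  then have "bounded_linear (ip x)"
    by (intro bounded_linear_intro[where K="4 * norm x"]) (auto simp: ip_simps)
  then show ?thesis using f by (rule bounded_linear.tendsto)
qed

lemma tendsto_ip_left: "(f \<longlongrightarrow> l) F \<Longrightarrow> ((\<lambda>n. ip (f n) x) \<longlongrightarrow> ip l x) F"
proof -
  assume f: "(f \<longlongrightarrow> l) F"
  have "norm (ip y x) \<le> norm y * (4 * norm x)" for y
    using weak_cauchy_schwarz[of y x] by (simp add: mult_ac)
  then have "bounded_linear (\<lambda>y. ip y x)"
    by (intro bounded_linear_intro[where K="4 * norm x"]) (auto simp: ip_simps)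
  then show ?thesis using f by (rule bounded_linear.tendsto)
qed

lemma adjointable_linear:
  assumes "adjointable ip T"
  shows "T (x + y) = T x + T y" "T (c *\<^sub>C x) = c *\<^sub>C T x"
  using assms by (auto intro!: ip_eqI_left simp: ip_adj ip_simps)

text \<open>Uniform boundedness: on the unit ball the maps \<open>y \<mapsto> \<langle>T x, y\<rangle> = \<langle>x, T\<^sup>* y\<rangle>\<close> are bounded pointwise in
  \<open>y\<close>, hence uniformly near some point \<open>z\<close>, hence near 0. Choosing \<open>y\<close> proportional to \<open>T x\<close> bounds \<open>\<parallel>T x\<parallel>\<close>.\<close>

lemma adjointable_bounded:
  assumes "adjointable ip T"
  obtains M where "\<And>x. norm (T x) \<le> M * norm x"
proof -
  define E where "E n = {y. \<forall>x. norm x \<le> 1 \<longrightarrow> norm (ip (T x) y) \<le> real n}" for n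
  have cl: "closed (E n)" for n
  proof -
    have "E n = (\<Inter>x\<in>{x. norm x \<le> 1}. {y. norm (ip (T x) y) \<le> real n})"
      by (auto simp: E_def)
    moreover have "continuous_on UNIV (\<lambda>y. ip (T x) y)" for x
      unfolding continuous_on_def using tendsto_ip_right[OF tendsto_ident_at] by blast
    ultimately show ?thesis
      by (auto intro!: closed_INT closed_Collect_le continuous_intros)
  qed
  have "y \<in> (\<Union>n. E n)" for y
  proof -
    obtain n :: nat where n: "4 * norm (adj ip T y) \<le> real n" using real_arch_simple by blast
    have "norm (ip (T x) y) \<le> real n" if "norm x \<le> 1" for x
    proof -
      have "norm (ip (T x) y) \<le> 4 * norm x * norm (adj ip T y)"
        using weak_cauchy_schwarz by (simp add: ip_adj[OF assms])
      also have "\<dots> \<le> 4 * norm (adj ip T y)"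
        using mult_right_mono[OF that, of "norm (adj ip T y)"] by simp
      finally show ?thesis using n by simp
    qed
    then show ?thesis by (auto simp: E_def)
  qed
  then have "(\<Union>n. E n) = UNIV" by blast
  then obtain n z r where r: "r > 0" "ball z r \<subseteq> E n"
    using closed_cover_contains_ball[of E] cl by metis
  have unit: "norm (T x) \<le> 4 * real n / r" if x: "norm x \<le> 1" for x
  proof (cases "T x = 0")
    case False
    define y where "y = (r / (2 * norm (T x))) *\<^sub>R T x"
    have ny: "norm y < r"
    proof -
      have "norm y = r / 2" using r False by (simp add: y_def)
      then show ?thesis using r by simp
    qed
    then have "z + y \<in> E n" "z \<in> E n" using r by (auto simp: dist_norm)
    then have "norm (ip (T x) (z + y)) \<le> n" "norm (ip (T x) z) \<le> n" using x by (auto simp: E_def)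
    moreover have "ip (T x) y = ip (T x) (z + y) - ip (T x) z" by (simp add: ip_simps)
    ultimately have "norm (ip (T x) y) \<le> 2 * n"
      using norm_triangle_ineq4[of "ip (T x) (z + y)" "ip (T x) z"] by simp
    moreover have "norm (ip (T x) y) = r / 2 * norm (T x)"
      using False r by (simp add: y_def ip_simps norm_ip_self power2_eq_square)
    ultimately show ?thesis using r by (simp add: field_simps)
  qed (use r in auto)
  have "norm (T x) \<le> 4 * real n / r * norm x" for x
  proof (cases "x = 0")
    case True
    then show ?thesis using adjointable_linear(1)[OF assms, of 0 0] by simp
  next
    case False
    have "norm (T ((1 / norm x) *\<^sub>R x)) \<le> 4 * real n / r"
      using False by (intro unit) simp
    then show ?thesis using False
      by (simp add: scaleR_scaleC adjointable_linear(2)[OF assms] flip: norm_scaleC)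
        (simp add: norm_scaleC divide_le_eq norm_divide)
  qed
  then show ?thesis using that by blast
qed

lemma adjointable_imp_bounded_clinear:
  assumes "adjointable ip T" shows "bounded_clinear T"
proof -
  obtain M where M: "\<And>x. norm (T x) \<le> M * norm x" using adjointable_bounded[OF assms] by blast
  have "bounded_linear T"
    by (rule bounded_linear_intro[where K=M])
      (use M in \<open>auto simp: adjointable_linear[OF assms] scaleR_scaleC mult.commute\<close>)
  then show ?thesis by (simp add: bounded_clinear_def adjointable_linear[OF assms])
qed

end

section \<open>The spectral radius bound\<close>

context
  fixes S :: "'h::complex_banach \<Rightarrow> 'h" and r M b :: real
  assumes S: "bounded_clinear S"
    and b: "\<And>x. norm (S x) \<le> b * norm x"
    and surj: "\<And>s. cmod s \<le> r \<Longrightarrow> surj (\<lambda>x. x - s *\<^sub>C S x)"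
    and M: "\<And>s x. cmod s \<le> r \<Longrightarrow> norm x \<le> M * norm (x - s *\<^sub>C S x)"
    and pos: "0 < r" "0 \<le> M" "0 \<le> b"
begin

text \<open>With \<open>n = 2\<^sup>k\<close>, \<open>X k s\<close> is \<open>(s S)\<^sup>n\<close>, and \<open>F k s\<close> will be the inverse of \<open>1 - (s S)\<^sup>n\<close>. The recursion for \<open>F\<close>
  is the identity \<open>2 / (1 - w\<^sup>2) = 1 / (1 - w) + 1 / (1 + w)\<close>, where the sign change of \<open>w = (s S)\<^sup>n\<close> comes from rotating
  \<open>s\<close> by an \<open>n\<close>-th root of \<open>-1\<close>. So \<open>F k s\<close> is the average of the resolvents over the \<open>n\<close>-th roots of unity.\<close>

private definition X :: "nat \<Rightarrow> complex \<Rightarrow> 'h \<Rightarrow> 'h" where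
  "X k s x = s ^ 2 ^ k *\<^sub>C (S ^^ 2 ^ k) x"

private primrec F :: "nat \<Rightarrow> complex \<Rightarrow> 'h \<Rightarrow> 'h" where
  "F 0 s x = inv (\<lambda>x. x - s *\<^sub>C S x) x"
| "F (Suc k) s x = (1/2) *\<^sub>R (F k s x + F k (cis (pi / 2 ^ k) * s) x)"

private lemma X_linear: "bounded_clinear (X k s)"
  unfolding X_def by (intro bounded_clinear_scaleC bounded_clinear_funpow S)

private lemma X_Suc: "X (Suc k) s x = X k s (X k s x)"
proof -
  have "(S ^^ 2 ^ Suc k) x = (S ^^ 2 ^ k) ((S ^^ 2 ^ k) x)"
    by (simp add: mult_2 funpow_add)
  then show ?thesis
    unfolding X_def by (simp add: bclin_scaleC[OF bounded_clinear_funpow[OF S]] scaleC_scaleC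
        mult_2 power_add)
qed

private lemma X_rotate: "X k (cis (pi / 2 ^ k) * s) x = - X k s x"
proof -
  have "cis (pi / 2 ^ k) ^ 2 ^ k = cis (real (2 ^ k) * (pi / 2 ^ k))"
    by (rule Complex.DeMoivre)
  also have "\<dots> = -1" by simp
  finally have "cis (pi / 2 ^ k) ^ 2 ^ k = -1" .
  then show ?thesis by (simp add: X_def power_mult_distrib)
qed

private lemma inv_props:
  assumes "cmod s \<le> r"
  shows "inv (\<lambda>x. x - s *\<^sub>C S x) (x - s *\<^sub>C S x) = x"
    and "inv (\<lambda>x. x - s *\<^sub>C S x) x - s *\<^sub>C S (inv (\<lambda>x. x - s *\<^sub>C S x) x) = x"
proof -
  have "inj (\<lambda>x. x - s *\<^sub>C S x)"
  proof (rule injI)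
    fix x y assume "x - s *\<^sub>C S x = y - s *\<^sub>C S y"
    then have "(x - y) - s *\<^sub>C S (x - y) = 0"
      by (simp add: bclin_diff[OF S] scaleC_diff_right algebra_simps)
    then have "norm (x - y) \<le> 0" using M[OF assms, of "x - y"] by simp
    then show "x = y" by simp
  qed
  then show "inv (\<lambda>x. x - s *\<^sub>C S x) (x - s *\<^sub>C S x) = x" by (rule inv_f_f)
  show "inv (\<lambda>x. x - s *\<^sub>C S x) x - s *\<^sub>C S (inv (\<lambda>x. x - s *\<^sub>C S x) x) = x"
    using surj_f_inv_f[OF surj[OF assms], of x] .
qed

private lemma F_inverse:
  "cmod s \<le> r \<Longrightarrow> F k s (x - X k s x) = x \<and> F k s x - X k s (F k s x) = x"
proof (induction k arbitrary: s x)
  case 0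
  then show ?case using inv_props by (simp add: X_def)
next
  case (Suc k)
  define t where "t = cis (pi / 2 ^ k) * s"
  have t: "cmod t \<le> r" using Suc.prems by (simp add: t_def norm_mult)
  have Xt: "X k t y = - X k s y" for y unfolding t_def by (rule X_rotate)
  note XL = bclin_add[OF X_linear] bclin_diff[OF X_linear]
  have half: "(1/2) *\<^sub>R (y + y) = y" for y :: 'h by (simp flip: scaleR_2)
  have "F k s (x - X k s (X k s x)) = x + X k s x"
    using Suc.IH[OF Suc.prems, of "x + X k s x"] by (simp add: XL)
  moreover have "F k t (x - X k s (X k s x)) = x - X k s x"
    using Suc.IH[OF t, of "x - X k s x"] by (simp add: XL Xt)
  ultimately have 1: "F (Suc k) s (x - X (Suc k) s x) = x"
    using half[of x] by (simp add: X_Suc flip: t_def)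
  define u where "u = F k s x"
  define v where "v = F k t x"
  have u: "u - X k s u = x" unfolding u_def using Suc.IH[OF Suc.prems] by blast
  have v: "v + X k s v = x" unfolding v_def using Suc.IH[OF t, of x] by (simp add: Xt)
  have Xu: "X k s u - X k s (X k s u) = X k s x"
    using arg_cong[OF u, of "X k s"] by (simp add: XL(2))
  have Xv: "X k s v + X k s (X k s v) = X k s x"
    using arg_cong[OF v, of "X k s"] by (simp add: XL(1))
  have Xu': "X k s (X k s u) = X k s u - X k s x" by (simp add: Xu[symmetric])
  have Xv': "X k s (X k s v) = X k s x - X k s v" by (simp add: Xv[symmetric])
  have XR: "X k s ((1/2) *\<^sub>R y) = (1/2) *\<^sub>R X k s y" for y
    by (simp only: scaleR_scaleC bclin_scaleC[OF X_linear])
  have "u + v - X k s (X k s (u + v)) = (u - X k s u) + (v + X k s v)"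
    by (simp add: XL Xu' Xv')
  also have "\<dots> = x + x" by (simp add: u v)
  finally have "F (Suc k) s x - X (Suc k) s (F (Suc k) s x) = x"
    using half[of x]
    by (simp add: X_Suc XR flip: t_def u_def v_def scaleR_diff_right)
  with 1 show ?case by blast
qed

text \<open>The resolvent identity gives the Lipschitz bound for \<open>k = 0\<close>. Averages over rotations inherit it, so it
  holds with a constant that does not depend on \<open>k\<close>. This uniformity is the point of the averaging.\<close>

private lemma F_lipschitz:
  "cmod s \<le> r \<Longrightarrow> cmod t \<le> r \<Longrightarrow> norm (F k s x - F k t x) \<le> M * (cmod (s - t) * b * M) * norm x"
proof (induction k arbitrary: s t)
  case 0
  define u where "u = F 0 s x"
  define v where "v = F 0 t x"
  have u: "u - s *\<^sub>C S u = x" and v: "v - t *\<^sub>C S v = x"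
    using inv_props(2) 0 by (auto simp: u_def v_def)
  have "norm v \<le> M * norm x" using M[OF 0(2), of v] v by simp
  then have Sv: "norm (S v) \<le> b * (M * norm x)"
    using b[of v] mult_left_mono[OF _ pos(3)] by fastforce
  have "(u - v) - s *\<^sub>C S (u - v) = (u - s *\<^sub>C S u) - (v - t *\<^sub>C S v) + (s - t) *\<^sub>C S v"
    by (simp add: bclin_diff[OF S] scaleC_simps)
  then have "norm ((u - v) - s *\<^sub>C S (u - v)) = cmod (s - t) * norm (S v)"
    by (simp add: u v norm_scaleC)
  then have "norm (u - v) \<le> M * (cmod (s - t) * norm (S v))"
    using M[OF 0(1), of "u - v"] by simp
  also have "\<dots> \<le> M * (cmod (s - t) * (b * (M * norm x)))"
    using Sv pos by (intro mult_left_mono) auto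
  finally show ?case by (simp add: u_def v_def mult_ac)
next
  case (Suc k)
  define z where "z = cis (pi / 2 ^ k)"
  define e where "e = M * (cmod (s - t) * b * M) * norm x"
  have z: "cmod (z * s) \<le> r" "cmod (z * t) \<le> r" "cmod (z * s - z * t) = cmod (s - t)"
    using Suc.prems by (auto simp: z_def norm_mult simp flip: right_diff_distrib)
  have "norm (F k s x - F k t x) \<le> e" unfolding e_def by (rule Suc.IH[OF Suc.prems])
  moreover have "norm (F k (z * s) x - F k (z * t) x) \<le> e"
    unfolding e_def using Suc.IH[OF z(1,2)] z(3) by simp
  moreover have "F (Suc k) s x - F (Suc k) t x
      = (1/2) *\<^sub>R ((F k s x - F k t x) + (F k (z * s) x - F k (z * t) x))"
    by (simp add: z_def algebra_simps)
  ultimately show ?case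
    using norm_triangle_ineq[of "F k s x - F k t x" "F k (z * s) x - F k (z * t) x"]
    by (simp add: e_def)
qed

text \<open>If \<open>(s S)\<^sup>n\<close> is small then \<open>F k s\<close> is close to the identity, so \<open>F k t\<close> is close to the identity for
  nearby \<open>t\<close>, uniformly in \<open>k\<close>, and its inverse \<open>1 - (t S)\<^sup>n\<close> is too. This gives the bound 1/2 for \<open>(t S)\<^sup>n\<close>;
  two squarings turn it into 1/16 and restore the initial bound 1/7.\<close>

private lemma spectral_radius_step:
  assumes s: "cmod s \<le> r" and t: "cmod t \<le> r"
    and close: "M * (cmod (s - t) * b * M) \<le> 1/6"
    and small: "\<exists>m. \<forall>k\<ge>m. \<forall>x. norm (X k s x) \<le> 1/7 * norm x"
  shows "\<exists>m. \<forall>k\<ge>m. \<forall>x. norm (X k t x) \<le> 1/7 * norm x"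
proof -
  obtain m where m: "\<And>k x. k \<ge> m \<Longrightarrow> norm (X k s x) \<le> 1/7 * norm x"
    using small by blast
  have half: "norm (X k t x) \<le> 1/2 * norm x" if k: "k \<ge> m" for k x
  proof -
    have Fs: "norm (F k s y - y) \<le> 1/6 * norm y" for y
    proof -
      have eq: "F k s y - y = X k s (F k s y)"
        using F_inverse[OF s, of k y] by (simp add: algebra_simps)
      have "norm (F k s y - y) \<le> 1/7 * norm (F k s y)" unfolding eq by (rule m[OF k])
      moreover have "norm (F k s y) \<le> norm y + norm (F k s y - y)"
        using norm_triangle_ineq[of y "F k s y - y"] by simp
      ultimately show ?thesis by linarith
    qed
    define y where "y = x - X k t x"
    have "F k t y = x" unfolding y_def using F_inverse[OF t] by blast
    moreover have "norm (F k s y - F k t y) \<le> 1/6 * norm y"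
      using F_lipschitz[OF s t, of k y] mult_right_mono[OF close, of "norm y"] by simp
    ultimately have "norm (x - y) \<le> 1/3 * norm y"
      using Fs[of y] norm_triangle_ineq4[of "F k s y - y" "F k s y - x"] by simp
    moreover have "norm y \<le> norm x + norm (x - y)"
      using norm_triangle_ineq4[of x "x - y"] by simp
    ultimately show ?thesis by (simp add: y_def)
  qed
  have "norm (X k t x) \<le> 1/7 * norm x" if k: "k \<ge> m + 2" for k x
  proof -
    define j where "j = k - 2"
    have j: "k = Suc (Suc j)" "j \<ge> m" using k by (auto simp: j_def)
    have "norm (X k t x) \<le> 1/16 * norm x"
      unfolding j(1) X_Suc
      using half[OF j(2), of x] half[OF j(2), of "X j t x"] half[OF j(2), of "X j t (X j t x)"]
        half[OF j(2), of "X j t (X j t (X j t x))"] by linarith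
    then show ?thesis using norm_ge_zero[of x] by linarith
  qed
  then show ?thesis by blast
qed

text \<open>Smallness of the powers is carried from \<open>s = 0\<close> to \<open>s = r\<close> in finitely many steps of length \<open>r / N\<close>.\<close>

lemma spectral_radius_bound_aux: "\<exists>k. \<forall>x. r ^ 2 ^ k * norm ((S ^^ 2 ^ k) x) \<le> norm x"
proof -
  obtain N :: nat where N: "N > 0" "M * (r * b * M) * 6 < N"
  proof -
    obtain n :: nat where "M * (r * b * M) * 6 < n" using reals_Archimedean2 by blast
    then show ?thesis using that[of "Suc n"] by simp
  qed
  define s where "s j = complex_of_real (r * real j / real N)" for j
  have ns: "cmod (s j) \<le> r" if "j \<le> N" for j
  proof -
    have "r * real j / real N \<le> r" using that N pos by (simp add: field_simps)
    then show ?thesis using pos unfolding s_def norm_of_real by simp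
  qed
  have "\<exists>m. \<forall>k\<ge>m. \<forall>x. norm (X k (s j) x) \<le> 1/7 * norm x" if "j \<le> N" for j
    using that
  proof (induction j)
    case 0
    have "X k (s 0) x = 0" for k x by (simp add: X_def s_def)
    then show ?case by simp
  next
    case (Suc j)
    have "s j - s (Suc j) = complex_of_real (- (r / N))"
    proof -
      have "r * real j / N - r * real (Suc j) / N = - (r / N)"
        by (simp add: diff_divide_distrib[symmetric] algebra_simps)
      then show ?thesis unfolding s_def of_real_diff[symmetric] by simp
    qed
    then have "cmod (s j - s (Suc j)) = r / N" using pos by (simp add: norm_divide)
    moreover have "M * (r / N * b * M) \<le> 1/6" using N by (simp add: field_simps)
    ultimately show ?case
      using spectral_radius_step[OF ns ns, of j "Suc j"] Suc by simp
  qed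
  from this[of N] obtain k where k: "\<And>x. norm (X k (s N) x) \<le> 1/7 * norm x" by auto
  have "r ^ 2 ^ k * norm ((S ^^ 2 ^ k) x) \<le> norm x" for x
  proof -
    have "s N = complex_of_real r" using N by (simp add: s_def)
    then have "norm (X k (s N) x) = r ^ 2 ^ k * norm ((S ^^ 2 ^ k) x)"
      using pos by (simp add: X_def norm_scaleC norm_power)
    then show ?thesis using k[of x] norm_ge_zero[of x] by linarith
  qed
  then show ?thesis by blast
qed

end

text \<open>The upper half of the spectral radius formula, by Rickart's elementary method. The resolvents in the
  disc are bounded uniformly by compactness.\<close>

lemma spectral_radius_bound:
  fixes S :: "'h::complex_banach \<Rightarrow> 'h"
  assumes S: "bounded_clinear S" and r: "0 < r"
    and surj: "\<And>s. cmod s \<le> r \<Longrightarrow> surj (\<lambda>x. x - s *\<^sub>C S x)"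
    and bdd: "\<And>s. cmod s \<le> r \<Longrightarrow> \<exists>m>0. \<forall>x. norm x \<le> m * norm (x - s *\<^sub>C S x)"
  obtains k where "\<And>x. r ^ 2 ^ k * norm ((S ^^ 2 ^ k) x) \<le> norm x"
proof -
  obtain b where b: "b > 0" "\<And>x. norm (S x) \<le> b * norm x" using bclin_bound[OF S] by blast
  obtain m where m: "\<And>s. cmod s \<le> r \<Longrightarrow> m s > 0"
      "\<And>s x. cmod s \<le> r \<Longrightarrow> norm x \<le> m s * norm (x - s *\<^sub>C S x)"
    using bdd by metis
  define D where "D s = ball s (1 / (2 * b * m s))" for s
  have "compact (cball (0::complex) r)" by simp
  moreover have "open (D s)" for s by (simp add: D_def)
  moreover have "cball 0 r \<subseteq> (\<Union>s\<in>cball 0 r. D s)"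
    using m(1) b(1) by (force simp: D_def)
  ultimately obtain C where C: "C \<subseteq> cball 0 r" "finite C" "cball 0 r \<subseteq> (\<Union>s\<in>C. D s)"
    by (metis compactE_image)
  \<comment> \<open>The sum stands for a maximum, which would need \<open>C\<close> to be nonempty.\<close>
  define M where "M = (\<Sum>s\<in>C. 2 * m s)"
  have mM: "2 * m s \<le> M" if "s \<in> C" for s
    unfolding M_def using C m(1) that by (intro member_le_sum) (auto simp: less_imp_le subset_iff)
  have M: "norm x \<le> M * norm (x - t *\<^sub>C S x)" if t: "cmod t \<le> r" for t x
  proof -
    obtain s where s: "s \<in> C" "t \<in> D s" using C t by (auto simp: subset_iff)
    then have sr: "cmod s \<le> r" and ms: "m s > 0" using C m by (auto simp: subset_iff)
    have "cmod (t - s) * (2 * b * m s) < 1"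
      using s(2) b(1) ms by (simp add: D_def dist_norm norm_minus_commute field_simps)
    then have "m s * (cmod (t - s) * (b * norm x)) \<le> 1/2 * norm x"
      using mult_right_mono[of "cmod (t - s) * (2 * b * m s)" 1 "norm x"] by (simp add: mult_ac)
    moreover have "m s * norm ((t - s) *\<^sub>C S x) \<le> m s * (cmod (t - s) * (b * norm x))"
      using b(2)[of x] ms by (simp add: norm_scaleC mult_left_mono)
    moreover have "x - s *\<^sub>C S x = (x - t *\<^sub>C S x) + (t - s) *\<^sub>C S x"
      by (simp add: scaleC_simps)
    then have "m s * norm (x - s *\<^sub>C S x)
        \<le> m s * norm (x - t *\<^sub>C S x) + m s * norm ((t - s) *\<^sub>C S x)"
      using ms norm_triangle_ineq[of "x - t *\<^sub>C S x" "(t - s) *\<^sub>C S x"]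
      by (metis distrib_left less_imp_le mult_left_mono)
    ultimately have "norm x \<le> 2 * m s * norm (x - t *\<^sub>C S x)"
      using m(2)[OF sr, of x] by linarith
    also have "\<dots> \<le> M * norm (x - t *\<^sub>C S x)"
      using mM[OF s(1)] by (intro mult_right_mono) auto
    finally show ?thesis .
  qed
  have "M \<ge> 0" unfolding M_def using C m(1) by (intro sum_nonneg) (auto simp: less_imp_le subset_iff)
  then show ?thesis
    using spectral_radius_bound_aux[OF S b(2) surj M r] b(1) that by fastforce
qed

section \<open>Perturbation of invertible operators\<close>

text \<open>Solving \<open>A x + B x = y\<close> is finding a fixed point of \<open>x \<mapsto> A\<^sup>-\<^sup>1 (y - B x)\<close>, a contraction because \<open>m b < 1\<close>.\<close>

lemma bij_perturbation:
  fixes A B :: "'h::complex_banach \<Rightarrow> 'h"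
  assumes A: "bounded_clinear A" "bij A" and m: "\<And>x. norm x \<le> m * norm (A x)" "0 \<le> m"
    and B: "bounded_clinear B" and b: "\<And>x. norm (B x) \<le> b * norm x" "0 \<le> b" and mb: "m * b < 1"
  shows "bij (\<lambda>x. A x + B x)"
proof -
  have inj: "inj (\<lambda>x. A x + B x)"
  proof (rule injI)
    fix x y assume "A x + B x = A y + B y"
    then have "A (x - y) = - B (x - y)"
      by (simp add: bclin_diff[OF A(1)] bclin_diff[OF B] algebra_simps)
    then have "norm (x - y) \<le> m * (b * norm (x - y))"
      using m(1)[of "x - y"] mult_left_mono[OF b(1)[of "x - y"] m(2)] by simp
    then have "(1 - m * b) * norm (x - y) \<le> 0" by (simp add: algebra_simps)
    then show "x = y" using mb by (simp add: mult_le_0_iff)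
  qed
  have "\<exists>x. A x + B x = y" for y
  proof -
    define f where "f x = inv A (y - B x)" for x
    have Af: "A (f x) = y - B x" for x
      unfolding f_def using A(2) by (simp add: bij_is_surj surj_f_inv_f)
    have "dist (f x) (f z) \<le> m * b * dist x z" for x z
    proof -
      have "norm (f x - f z) \<le> m * norm (A (f x - f z))" by (rule m)
      also have "A (f x - f z) = - B (x - z)"
        by (simp add: bclin_diff[OF A(1)] bclin_diff[OF B] Af)
      also have "m * norm (- B (x - z)) \<le> m * (b * norm (x - z))"
        using mult_left_mono[OF b(1) m(2)] by simp
      finally show ?thesis by (simp add: dist_norm mult_ac)
    qed
    then obtain x where "f x = x"
      using banach_fix_type[of "m * b" f] mb m(2) b(2) by auto
    then have "A x + B x = y" using Af[of x] by simp
    then show ?thesis ..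
  qed
  then have "surj (\<lambda>x. A x + B x)" by (metis surjI surj_def)
  with inj show ?thesis by (simp add: bij_def)
qed

section \<open>The spectrum of a self-adjoint operator\<close>

definition op_invertible :: "('h \<Rightarrow> 'h \<Rightarrow> 'a) \<Rightarrow> ('h \<Rightarrow> 'h) \<Rightarrow> bool" where
  "op_invertible ip A \<longleftrightarrow> (\<exists>S. adjointable ip S \<and> S \<circ> A = id \<and> A \<circ> S = id)"

abbreviation selfadjoint :: "('h \<Rightarrow> 'h \<Rightarrow> 'a) \<Rightarrow> ('h \<Rightarrow> 'h) \<Rightarrow> bool" where
  "selfadjoint ip T \<equiv> adjoint_pair ip T T"

lemma not_in_spectrum_iff: "z \<notin> spectrum ip T \<longleftrightarrow> op_invertible ip (\<lambda>x. T x - z *\<^sub>C x)"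
  unfolding spectrum_def op_invertible_def by blast

context hilbert_module
begin

lemma op_invertible_comp:
  assumes "op_invertible ip A" "op_invertible ip B" shows "op_invertible ip (\<lambda>x. A (B x))"
proof -
  obtain S R where "adjointable ip S" "S \<circ> A = id" "A \<circ> S = id"
    "adjointable ip R" "R \<circ> B = id" "B \<circ> R = id"
    using assms unfolding op_invertible_def by blast
  then have "adjointable ip (R \<circ> S)" "(R \<circ> S) \<circ> (\<lambda>x. A (B x)) = id" "(\<lambda>x. A (B x)) \<circ> (R \<circ> S) = id"
    by (auto intro: adjointable_comp simp: fun_eq_iff)
  then show ?thesis unfolding op_invertible_def by blast
qed

lemma op_invertible_scaleC: "c \<noteq> 0 \<Longrightarrow> op_invertible ip (\<lambda>x. c *\<^sub>C x)"
  unfolding op_invertible_def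
  by (rule exI[of _ "\<lambda>x. inverse c *\<^sub>C x"])
    (auto intro: adjointable_scaleC adjointable_id simp: fun_eq_iff scaleC_scaleC)

lemma op_invertible_uminus: "op_invertible ip A \<Longrightarrow> op_invertible ip (\<lambda>x. - A x)"
  using op_invertible_comp[OF op_invertible_scaleC[of "-1"]] by simp

lemma op_invertible_bij: "op_invertible ip A \<Longrightarrow> bij A"
  unfolding op_invertible_def using o_bij by blast

lemma op_invertible_bound:
  assumes "op_invertible ip A" obtains m where "m > 0" "\<And>x. norm x \<le> m * norm (A x)"
proof -
  obtain S where S: "adjointable ip S" "\<And>x. S (A x) = x"
    using assms unfolding op_invertible_def by (auto simp: fun_eq_iff)
  obtain m where m: "m > 0" "\<And>x. norm (S x) \<le> m * norm x"
    using bclin_bound[OF adjointable_imp_bounded_clinear[OF S(1)]] by blast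
  have "norm x \<le> m * norm (A x)" for x using m(2)[of "A x"] S(2) by simp
  then show ?thesis using m(1) that by blast
qed

text \<open>The inverse of a bijective operator with bijective adjoint has an adjoint, namely the inverse of the
  adjoint.\<close>

lemma op_invertible_if_bij:
  assumes "adjoint_pair ip A B" "bij A" "bij B" shows "op_invertible ip A"
proof -
  have "adjoint_pair ip (inv A) (inv B)"
    unfolding adjoint_pair_def
  proof (intro allI)
    fix x y
    have "ip (inv A x) y = ip (inv A x) (B (inv B y))"
      using assms(3) by (simp add: bij_is_surj surj_f_inv_f)
    also have "\<dots> = ip (A (inv A x)) (inv B y)" using assms(1) by (simp add: adjoint_pair_def)
    finally show "ip (inv A x) y = ip x (inv B y)"
      using assms(2) by (simp add: bij_is_surj surj_f_inv_f)
  qed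
  then show ?thesis unfolding op_invertible_def using assms(2)
    by (auto intro!: exI[of _ "inv A"] adjoint_pairD simp: bij_is_inj fun_eq_iff bij_is_surj surj_f_inv_f)
qed

lemma adjoint_pair_shift:
  assumes "selfadjoint ip T"
  shows "adjoint_pair ip (\<lambda>x. T x - z *\<^sub>C x) (\<lambda>x. T x - cnj z *\<^sub>C x)"
  by (intro adjoint_pair_diff adjoint_pair_scaleC assms adjoint_pair_id)

lemma cnj_in_spectrum_iff:
  assumes T: "selfadjoint ip T" shows "cnj z \<in> spectrum ip T \<longleftrightarrow> z \<in> spectrum ip T"
proof -
  have "cnj z \<notin> spectrum ip T" if z: "z \<notin> spectrum ip T" for z
  proof -
    let ?A = "\<lambda>x. T x - z *\<^sub>C x" and ?B = "\<lambda>x. T x - cnj z *\<^sub>C x"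
    obtain S where S: "adjointable ip S" "S \<circ> ?A = id" "?A \<circ> S = id"
      using z unfolding not_in_spectrum_iff op_invertible_def by blast
    have A: "adjointable ip ?A" "adj ip ?A = ?B"
      using adjoint_pair_shift[OF T] adj_eqI adjoint_pairD by blast+
    have i: "adj ip id = id" using adj_eqI[OF adjoint_pair_id] by (simp add: id_def)
    have "?B \<circ> adj ip S = id" "adj ip S \<circ> ?B = id"
      using adj_comp[OF S(1) A(1)] adj_comp[OF A(1) S(1)] S A(2) i by auto
    then show ?thesis
      unfolding not_in_spectrum_iff op_invertible_def using adjointable_adj[OF S(1)] by blast
  qed
  from this[of z] this[of "cnj z"] show ?thesis by auto
qed

lemma resolvent_open:
  assumes T: "selfadjoint ip T" and z: "z \<notin> spectrum ip T"
    and m: "\<And>x. norm x \<le> m * norm (T x - z *\<^sub>C x)" "\<And>x. norm x \<le> m * norm (T x - cnj z *\<^sub>C x)" "0 \<le> m"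
    and w: "m * cmod (w - z) < 1"
  shows "w \<notin> spectrum ip T"
proof -
  have bc: "bounded_clinear (\<lambda>x. T x - v *\<^sub>C x)" "bounded_clinear (\<lambda>x::'h. v *\<^sub>C x)" for v
    using adjoint_pair_shift[OF T] adjoint_pairD adjointable_imp_bounded_clinear
      bounded_clinear_scaleC[OF bounded_clinear_id] by blast+
  have bij: "bij (\<lambda>x. T x - w *\<^sub>C x)" if "u \<notin> spectrum ip T" "cmod (w - u) = cmod (w' - z)"
    "\<And>x. norm x \<le> m * norm (T x - u *\<^sub>C x)" "m * cmod (w' - z) < 1" for u w w'
  proof -
    have "bij (\<lambda>x. T x - u *\<^sub>C x)"
      using that(1) op_invertible_bij unfolding not_in_spectrum_iff by blast
    then have "bij (\<lambda>x. (T x - u *\<^sub>C x) + (u - w) *\<^sub>C x)"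
      by (rule bij_perturbation[OF bc(1) _ that(3) m(3) bc(2), where b="cmod (w' - z)"])
        (use that(2,4) in \<open>auto simp: norm_scaleC norm_minus_commute\<close>)
    moreover have "(\<lambda>x. (T x - u *\<^sub>C x) + (u - w) *\<^sub>C x) = (\<lambda>x. T x - w *\<^sub>C x)"
      by (simp add: fun_eq_iff scaleC_simps)
    ultimately show ?thesis by simp
  qed
  have "cmod (cnj w - cnj z) = cmod (w - z)" by (metis complex_cnj_diff complex_mod_cnj)
  then have "bij (\<lambda>x. T x - w *\<^sub>C x)" "bij (\<lambda>x. T x - cnj w *\<^sub>C x)"
    using bij[of z w w] bij[of "cnj z" "cnj w" w] z m w cnj_in_spectrum_iff[OF T] by auto
  then show ?thesis
    unfolding not_in_spectrum_iff using op_invertible_if_bij[OF adjoint_pair_shift[OF T]] by blast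
qed

lemma closed_spectrum:
  assumes T: "selfadjoint ip T" shows "closed (spectrum ip T)"
proof -
  have "\<exists>e>0. ball z e \<subseteq> - spectrum ip T" if z: "z \<notin> spectrum ip T" for z
  proof -
    obtain m1 where m1: "m1 > 0" "\<And>x. norm x \<le> m1 * norm (T x - z *\<^sub>C x)"
      using z op_invertible_bound unfolding not_in_spectrum_iff by blast
    obtain m2 where m2: "m2 > 0" "\<And>x. norm x \<le> m2 * norm (T x - cnj z *\<^sub>C x)"
      using z cnj_in_spectrum_iff[OF T] op_invertible_bound not_in_spectrum_iff by blast
    define m where "m = m1 + m2"
    have m: "m > 0" "\<And>x. norm x \<le> m * norm (T x - z *\<^sub>C x)" "\<And>x. norm x \<le> m * norm (T x - cnj z *\<^sub>C x)"
      using m1 m2 by (auto simp: m_def distrib_right intro: add_increasing add_increasing2)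
    have "w \<notin> spectrum ip T" if "w \<in> ball z (1 / m)" for w
      using that m(1)
      by (intro resolvent_open[OF T z m(2,3)])
        (auto simp: dist_norm norm_minus_commute field_simps)
    then show ?thesis using m(1) by (intro exI[of _ "1/m"]) auto
  qed
  then show ?thesis by (simp add: closed_def open_contains_ball)
qed

lemma spectrum_bound:
  assumes T: "selfadjoint ip T" and b: "\<And>x. norm (T x) \<le> b * norm x" "0 \<le> b"
    and z: "z \<in> spectrum ip T"
  shows "cmod z \<le> b"
proof (rule ccontr)
  assume "\<not> ?thesis"
  then have zb: "b < cmod z" by simp
  then have z0: "z \<noteq> 0" using b(2) by auto
  have bT: "bounded_clinear T" using adjointable_imp_bounded_clinear adjoint_pairD T by blast
  have "bij (\<lambda>x. T x - w *\<^sub>C x)" if "cmod w = cmod z" for w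
  proof -
    have w0: "w \<noteq> 0" using that z0 by auto
    have "bij (\<lambda>x::'h. (- w) *\<^sub>C x)"
      using op_invertible_bij[OF op_invertible_scaleC[of "- w"]] w0 by auto
    then have "bij (\<lambda>x. (- w) *\<^sub>C x + T x)"
      by (rule bij_perturbation[OF bounded_clinear_scaleC[OF bounded_clinear_id] _ _ _ bT b,
            where m="1 / cmod z"])
        (use that zb z0 in \<open>auto simp: norm_scaleC norm_mult simp flip: scaleC_minus_left\<close>)
    then show ?thesis by (simp add: add.commute)
  qed
  then have "op_invertible ip (\<lambda>x. T x - z *\<^sub>C x)"
    using op_invertible_if_bij[OF adjoint_pair_shift[OF T]] by simp
  then show False using z not_in_spectrum_iff by blast
qed

text \<open>If the real part of \<open>\<langle>x, y\<rangle>\<close> vanishes, then \<open>x + y\<close> and \<open>x - y\<close> have the same norm, and \<open>2 x\<close> is their sum. The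
  triangle inequality thus replaces monotonicity of the norm on positive elements.\<close>

lemma norm_le_norm_add_orthogonal:
  assumes "ip x y + ip y x = 0" shows "norm x \<le> norm (x + y)"
proof -
  have "norm (ip (x + y) (x + y)) = norm (ip (x - y) (x - y))"
  proof -
    have "ip (x + y) (x + y) = ip x x + (ip x y + ip y x) + ip y y"
      "ip (x - y) (x - y) = ip x x - (ip x y + ip y x) + ip y y"
      by (simp_all add: ip_simps)
    then show ?thesis using assms by simp
  qed
  then have "norm (x + y) = norm (x - y)" by (simp add: norm_eq_ip)
  moreover have "x + x = (x + y) + (x - y)" by simp
  then have "norm (x + x) \<le> norm (x + y) + norm (x - y)" by (metis norm_triangle_ineq)
  moreover have "norm (x + x) = 2 * norm x" by (simp flip: scaleR_2)
  ultimately show ?thesis by simp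
qed

text \<open>The vectors \<open>(T - Re z) x\<close> and \<open>-\<i> (Im z) x\<close> are orthogonal in the sense of \<open>norm_le_norm_add_orthogonal\<close>.\<close>

lemma resolvent_bound:
  assumes T: "selfadjoint ip T"
  shows "\<bar>Im z\<bar> * norm x \<le> norm (T x - z *\<^sub>C x)"
proof -
  define u where "u = T x - complex_of_real (Re z) *\<^sub>C x"
  define v where "v = - ((\<i> * complex_of_real (Im z)) *\<^sub>C x)"
  have "z = complex_of_real (Re z) + \<i> * complex_of_real (Im z)"
    by (simp add: complex_eq_iff)
  then have "z *\<^sub>C x = complex_of_real (Re z) *\<^sub>C x + (\<i> * complex_of_real (Im z)) *\<^sub>C x"
    by (metis scaleC_add_left)
  then have eq: "T x - z *\<^sub>C x = v + u" by (simp add: u_def v_def)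
  have "ip (T x) x = ip x (T x)" using T by (simp add: adjoint_pair_def)
  then have "ip v u + ip u v = 0"
    by (simp add: u_def v_def ip_simps scaleC_simps mult.commute)
  then have "norm v \<le> norm (T x - z *\<^sub>C x)"
    unfolding eq by (rule norm_le_norm_add_orthogonal)
  then show ?thesis by (simp add: v_def norm_scaleC norm_mult)
qed

text \<open>In a Hilbert module an operator that is bounded below need not be onto, even if its adjoint is injective.
  Instead, far up the imaginary axis \<open>c = \<i> N\<close> is in the resolvent set, and the resolvent bound \<open>1 / N\<close> there puts
  the whole disc of radius \<open>N\<close> around \<open>c\<close> into the resolvent set. These discs exhaust the upper half plane.\<close>

lemma spectrum_real:
  assumes T: "selfadjoint ip T" and z: "z \<in> spectrum ip T"
  shows "Im z = 0"
proof (rule ccontr)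
  assume ne: "Im z \<noteq> 0"
  define w where "w = (if Im z > 0 then z else cnj z)"
  have w: "Im w > 0" "w \<in> spectrum ip T"
    using ne z cnj_in_spectrum_iff[OF T] by (auto simp: w_def)
  obtain b where b: "b > 0" "\<And>x. norm (T x) \<le> b * norm x"
    using bclin_bound[OF adjointable_imp_bounded_clinear[OF adjoint_pairD[OF T]]] by blast
  \<comment> \<open>The point \<open>w\<close> is within distance \<open>N\<close> of \<open>\<i> N\<close> iff \<open>|w|\<^sup>2 < 2 N Im w\<close>.\<close>
  define N where "N = b + (cmod w)\<^sup>2 / Im w"
  have N: "N > b" "N > 0" using w b by (auto simp: N_def add_pos_nonneg intro!: divide_pos_pos)
  define c where "c = \<i> * complex_of_real N"
  have c: "c \<notin> spectrum ip T"
    using spectrum_bound[OF T b(2), of c] b N by (auto simp: c_def norm_mult)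
  have m: "norm x \<le> 1 / N * norm (T x - c *\<^sub>C x)"
    "norm x \<le> 1 / N * norm (T x - cnj c *\<^sub>C x)" for x
    using resolvent_bound[OF T, of c x] resolvent_bound[OF T, of "cnj c" x] N
    by (auto simp: c_def field_simps)
  have d: "1 / N * cmod (w - c) < 1"
  proof -
    have "(cmod (w - c))\<^sup>2 = (cmod w)\<^sup>2 - 2 * N * Im w + N\<^sup>2"
      unfolding cmod_power2 by (simp add: c_def power2_eq_square algebra_simps)
    moreover have "N * Im w = b * Im w + (cmod w)\<^sup>2"
      using w by (simp add: N_def field_simps)
    moreover have "0 < b * Im w" using b w by simp
    moreover have "0 \<le> (cmod w)\<^sup>2" by simp
    ultimately have "(cmod (w - c))\<^sup>2 < N\<^sup>2" by linarith
    then have "cmod (w - c) < N" using N power2_less_imp_less[of "cmod (w - c)" N] by simp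
    then show ?thesis using N by (simp add: field_simps)
  qed
  have "0 \<le> 1 / N" using N by simp
  then have "w \<notin> spectrum ip T" using d by (rule resolvent_open[OF T c m])
  then show False using w by blast
qed

lemma compact_spectrum:
  assumes T: "selfadjoint ip T" shows "compact (spectrum ip T)"
proof -
  obtain b where b: "b > 0" "\<And>x. norm (T x) \<le> b * norm x"
    using bclin_bound[OF adjointable_imp_bounded_clinear[OF adjoint_pairD[OF T]]] by blast
  have "bounded (spectrum ip T)"
    unfolding bounded_iff using spectrum_bound[OF T b(2)] b(1) by (intro exI[of _ b]) auto
  then show ?thesis using closed_spectrum[OF T] compact_eq_bounded_closed by blast
qed

end

section \<open>Polynomials in an operator\<close>

text \<open>Horner's scheme, as in the definition of \<open>poly\<close>.\<close>

definition op_poly :: "complex poly \<Rightarrow> ('h::complex_banach \<Rightarrow> 'h) \<Rightarrow> 'h \<Rightarrow> 'h" where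
  "op_poly p T = fold_coeffs (\<lambda>a f x. a *\<^sub>C x + T (f x)) p (\<lambda>x. 0)"

lemma op_poly_0 [simp]: "op_poly 0 T x = 0"
  by (simp add: op_poly_def)

context
  fixes T :: "'h::complex_banach \<Rightarrow> 'h" assumes T: "bounded_clinear T"
begin

lemma op_poly_pCons: "op_poly (pCons a p) T x = a *\<^sub>C x + T (op_poly p T x)"
  by (cases "p = 0 \<and> a = 0") (auto simp: op_poly_def bclin_zero[OF T])

lemma op_poly_const: "op_poly [:c:] T x = c *\<^sub>C x"
  by (simp add: op_poly_pCons bclin_zero[OF T])

lemma op_poly_root_factor: "op_poly [:- z, 1:] T x = T x - z *\<^sub>C x"
  by (simp add: op_poly_pCons bclin_zero[OF T])

lemma op_poly_add: "op_poly (p + q) T x = op_poly p T x + op_poly q T x"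
  by (induction p q rule: poly_induct2)
    (auto simp: op_poly_pCons scaleC_add_left bclin_add[OF T])

lemma op_poly_smult: "op_poly (smult c p) T x = c *\<^sub>C op_poly p T x"
  by (induction p) (auto simp: op_poly_pCons scaleC_simps bclin_scaleC[OF T])

lemma op_poly_diff: "op_poly (p - q) T x = op_poly p T x - op_poly q T x"
proof -
  have "op_poly (p + smult (-1) q) T x = op_poly p T x - op_poly q T x"
    unfolding op_poly_add op_poly_smult by simp
  then show ?thesis by simp
qed

lemma bounded_clinear_op_poly: "bounded_clinear (op_poly p T)"
proof (induction p)
  case 0
  have "op_poly 0 T = (\<lambda>x. 0)" by (simp add: fun_eq_iff)
  then show ?case by (simp add: bounded_clinear_def bounded_linear_zero)
next
  case (pCons a p)
  have "op_poly (pCons a p) T = (\<lambda>x. a *\<^sub>C x + T (op_poly p T x))"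
    by (simp add: op_poly_pCons fun_eq_iff)
  then show ?case
    using bounded_clinear_add[OF bounded_clinear_scaleC[OF bounded_clinear_id]
        bounded_clinear_compose[OF T pCons(2)]] by simp
qed

lemma op_poly_mult: "op_poly (p * q) T x = op_poly p T (op_poly q T x)"
  by (induction p) (auto simp: op_poly_pCons op_poly_add op_poly_smult)

lemma op_poly_commute: "T (op_poly p T x) = op_poly p T (T x)"
  using op_poly_mult[of "[:0, 1:]" p x] op_poly_mult[of p "[:0, 1:]" x]
  by (simp add: op_poly_pCons bclin_zero[OF T] mult.commute)

end

lemma op_poly_intertwine:
  assumes "bounded_clinear T" "bounded_clinear S" "bounded_clinear X" and "\<And>x. X (T x) = S (X x)"
  shows "X (op_poly p T x) = op_poly p S (X x)"
  by (induction p arbitrary: x) (auto simp: assms(4) op_poly_pCons[OF assms(1)] op_poly_pCons[OF assms(2)]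
      bclin_add[OF assms(3)] bclin_zero[OF assms(3)] bclin_scaleC[OF assms(3)])

lemma poly_map_cnj: "poly (map_poly cnj p) (cnj z) = cnj (poly p z)"
  by (induction p) (auto simp: map_poly_pCons)

context hilbert_module
begin

lemma ip_selfadjoint: "selfadjoint ip T \<Longrightarrow> ip (T x) y = ip x (T y)"
  by (simp add: adjoint_pair_def)

lemma selfadjoint_bclin: "selfadjoint ip T \<Longrightarrow> bounded_clinear T"
  using adjointable_imp_bounded_clinear adjoint_pairD by blast

lemma adjoint_pair_op_poly:
  assumes T: "selfadjoint ip T" shows "adjoint_pair ip (op_poly p T) (op_poly (map_poly cnj p) T)"
proof (induction p)
  case 0
  have "op_poly 0 T = (\<lambda>x. 0)" by (simp add: fun_eq_iff)
  then show ?case by (simp add: adjoint_pair_zero)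
next
  case (pCons a p)
  note bT = selfadjoint_bclin[OF T]
  have "op_poly (pCons a p) T = (\<lambda>x. a *\<^sub>C x + T (op_poly p T x))"
    by (simp add: op_poly_pCons[OF bT] fun_eq_iff)
  moreover have "op_poly (map_poly cnj (pCons a p)) T
      = (\<lambda>x. cnj a *\<^sub>C x + op_poly (map_poly cnj p) T (T x))"
    by (simp add: map_poly_pCons op_poly_pCons[OF bT] op_poly_commute[OF bT] fun_eq_iff)
  ultimately show ?case
    using adjoint_pair_add[OF adjoint_pair_scaleC[OF adjoint_pair_id] adjoint_pair_comp[OF T pCons(2)]]
    by simp
qed

text \<open>By the fundamental theorem of algebra \<open>p(T)\<close> is a product of factors \<open>T - z\<close>, where \<open>z\<close> is a root of \<open>p\<close> and
  therefore not in the spectrum.\<close>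

lemma op_poly_invertible:
  assumes T: "selfadjoint ip T" and p: "p \<noteq> 0" "\<And>z. z \<in> spectrum ip T \<Longrightarrow> poly p z \<noteq> 0"
  shows "op_invertible ip (op_poly p T)"
  using p
proof (induction "degree p" arbitrary: p rule: less_induct)
  case less
  note bT = selfadjoint_bclin[OF T]
  show ?case
  proof (cases "degree p = 0")
    case True
    then obtain c where c: "p = [:c:]" by (metis degree_eq_zeroE)
    then have "op_poly p T = (\<lambda>x. c *\<^sub>C x)" "c \<noteq> 0"
      using less.prems(1) by (auto simp: op_poly_const[OF bT] fun_eq_iff)
    then show ?thesis using op_invertible_scaleC by simp
  next
    case False
    then obtain z where z: "poly p z = 0"
      using fundamental_theorem_of_algebra[of p] constant_degree[of p] by auto
    then obtain q where q: "p = [:- z, 1:] * q" by (metis poly_eq_0_iff_dvd dvdE)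
    have q0: "q \<noteq> 0" using q less.prems(1) by auto
    have "degree q < degree p" using q0 unfolding q by (subst degree_mult_eq) auto
    moreover have "poly q w \<noteq> 0" if "w \<in> spectrum ip T" for w
      using less.prems(2)[OF that] by (auto simp: q)
    ultimately have "op_invertible ip (op_poly q T)" using less.hyps q0 by blast
    moreover have "op_invertible ip (\<lambda>x. T x - z *\<^sub>C x)"
      using z less.prems(2) not_in_spectrum_iff by blast
    moreover have "op_poly p T = (\<lambda>x. T (op_poly q T x) - z *\<^sub>C op_poly q T x)"
      unfolding q by (rule ext) (simp only: op_poly_mult[OF bT] op_poly_root_factor[OF bT])
    ultimately show ?thesis using op_invertible_comp by fastforce
  qed
qed

end

text \<open>The constant is a parameter because two values matter: 4 for a general Hilbert module, and 1, which makes
  the functional calculus contractive, for a C*-algebra over itself.\<close>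

locale hilbert_module_cs = hilbert_module act ip
  for act :: "'h::complex_banach \<Rightarrow> 'a::cstar_algebra \<Rightarrow> 'h" and ip :: "'h \<Rightarrow> 'h \<Rightarrow> 'a" +
  fixes K :: real
  assumes K_ge_1: "1 \<le> K"
    and cauchy_schwarz: "norm (ip x y) \<le> K * norm x * norm y"
begin

text \<open>Iterates \<open>\<parallel>S x\<parallel>\<^sup>2 = \<parallel>\<langle>x, S\<^sup>2 x\<rangle>\<parallel> \<le> K \<parallel>x\<parallel> \<parallel>S\<^sup>2 x\<parallel>\<close>. The factor \<open>K \<parallel>x\<parallel>\<close> on the left
  keeps the exponent \<open>2\<^sup>k - 1\<close> out of the formula.\<close>

lemma selfadjoint_power_bound:
  assumes S: "selfadjoint ip S" and x: "x \<noteq> 0"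
  shows "K * norm x * norm (S x) ^ 2 ^ k \<le> (K * norm x) ^ 2 ^ k * norm ((S ^^ 2 ^ k) x)"
proof (induction k)
  case (Suc k)
  define n :: nat where "n = 2 ^ k"
  define a where "a = K * norm x"
  have a: "a > 0" using x K_ge_1 by (simp add: a_def)
  have SA: "selfadjoint ip (S ^^ m)" for m
  proof (induction m)
    case 0
    then show ?case using adjoint_pair_id by (simp add: id_def)
  next
    case (Suc m)
    then show ?case using adjoint_pair_comp[OF S Suc] by (simp add: comp_def funpow_swap1)
  qed
  have "(norm ((S ^^ n) x))\<^sup>2 = norm (ip x ((S ^^ n) ((S ^^ n) x)))"
    using ip_selfadjoint[OF SA[of n], of x "(S ^^ n) x"] by (simp flip: norm_ip_self)
  also have "\<dots> \<le> a * norm ((S ^^ (n + n)) x)"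
    using cauchy_schwarz by (simp add: a_def funpow_add)
  finally have sq: "(norm ((S ^^ n) x))\<^sup>2 \<le> a * norm ((S ^^ (n + n)) x)" .
  have "(a * norm (S x) ^ n)\<^sup>2 \<le> (a ^ n * norm ((S ^^ n) x))\<^sup>2"
    using Suc a by (intro power_mono) (auto simp: n_def a_def)
  also have "\<dots> \<le> (a ^ n)\<^sup>2 * (a * norm ((S ^^ (n + n)) x))"
    using sq a by (simp add: power_mult_distrib mult_left_mono)
  finally have "a * (a * norm (S x) ^ (n + n)) \<le> a * (a ^ (n + n) * norm ((S ^^ (n + n)) x))"
    by (simp add: power2_eq_square power_add mult_ac)
  then have "a * norm (S x) ^ (n + n) \<le> a ^ (n + n) * norm ((S ^^ (n + n)) x)" using a by simp
  then show ?case by (simp add: a_def n_def mult_2)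
qed simp

text \<open>For self-adjoint operators the spectral radius controls the norm up to the factor \<open>K\<close>: in
  \<open>selfadjoint_power_bound\<close> the constant enters with the power \<open>2\<^sup>k\<close>, and extracting that root leaves one factor.\<close>

lemma selfadjoint_norm_bound:
  assumes S: "selfadjoint ip S" and \<rho>: "0 < \<rho>"
    and out: "\<And>z. \<rho> \<le> cmod z \<Longrightarrow> z \<notin> spectrum ip S"
  shows "norm (S x) \<le> K * \<rho> * norm x"
proof (cases "x = 0")
  case True
  then show ?thesis using bclin_zero[OF selfadjoint_bclin[OF S]] by simp
next
  case x: False
  have inv: "op_invertible ip (\<lambda>x. x - s *\<^sub>C S x)" if s: "cmod s \<le> 1 / \<rho>" for s
  proof (cases "s = 0")
    case True
    then show ?thesis using op_invertible_scaleC[of 1] by simp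
  next
    case False
    have "\<rho> \<le> cmod (1 / s)" using s False \<rho> by (simp add: norm_divide field_simps)
    then have "op_invertible ip (\<lambda>x. S x - (1 / s) *\<^sub>C x)" using out not_in_spectrum_iff by blast
    then have "op_invertible ip (\<lambda>x. (- s) *\<^sub>C (S x - (1 / s) *\<^sub>C x))"
      using op_invertible_comp[OF op_invertible_scaleC[of "- s"]] False by simp
    moreover have "(\<lambda>x. (- s) *\<^sub>C (S x - (1 / s) *\<^sub>C x)) = (\<lambda>x. x - s *\<^sub>C S x)"
      using False by (simp add: fun_eq_iff scaleC_simps)
    ultimately show ?thesis by simp
  qed
  have r: "0 < 1 / \<rho>" using \<rho> by simp
  have "surj (\<lambda>x. x - s *\<^sub>C S x)" if "cmod s \<le> 1 / \<rho>" for s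
    using op_invertible_bij[OF inv[OF that]] bij_is_surj by blast
  moreover have "\<exists>m>0. \<forall>x. norm x \<le> m * norm (x - s *\<^sub>C S x)" if "cmod s \<le> 1 / \<rho>" for s
    by (rule op_invertible_bound[OF inv[OF that]]) blast
  ultimately obtain k where k: "\<And>x. (1 / \<rho>) ^ 2 ^ k * norm ((S ^^ 2 ^ k) x) \<le> norm x"
    using spectral_radius_bound[OF selfadjoint_bclin[OF S] r] by blast
  define n :: nat where "n = 2 ^ k"
  have n: "n > 0" by (simp add: n_def)
  have Sn: "norm ((S ^^ n) x) \<le> \<rho> ^ n * norm x"
    using k[of x] \<rho> by (simp add: n_def field_simps)
  have "K * norm x * norm (S x) ^ n \<le> (K * norm x) ^ n * norm ((S ^^ n) x)"
    unfolding n_def by (rule selfadjoint_power_bound[OF S x])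
  also have "\<dots> \<le> (K * norm x) ^ n * (\<rho> ^ n * norm x)"
    using Sn K_ge_1 by (intro mult_left_mono) auto
  also have "\<dots> \<le> (K * norm x) ^ n * (\<rho> ^ n * (K * norm x))"
    using K_ge_1 \<rho> mult_right_mono[OF K_ge_1, of "norm x"] by (intro mult_left_mono) auto
  also have "\<dots> = K * norm x * (K * \<rho> * norm x) ^ n"
    by (simp add: power_mult_distrib mult_ac)
  finally have "norm (S x) ^ n \<le> (K * \<rho> * norm x) ^ n" using x K_ge_1 by simp
  then show ?thesis using n K_ge_1 \<rho> power_mono_iff[of "norm (S x)" "K * \<rho> * norm x" n] by simp
qed

lemma selfadjoint_norm_bound_le:
  assumes S: "selfadjoint ip S" and c: "0 \<le> c" "\<And>z. z \<in> spectrum ip S \<Longrightarrow> cmod z \<le> c"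
  shows "norm (S x) \<le> K * c * norm x"
proof (rule field_le_epsilon)
  fix e :: real assume e: "e > 0"
  define d where "d = e / (K * norm x + 1)"
  have p: "K * norm x + 1 > 0" using K_ge_1 by (simp add: add_nonneg_pos)
  have d: "d > 0" using e p by (simp add: d_def)
  have "norm (S x) \<le> K * (c + d) * norm x"
    using c d by (intro selfadjoint_norm_bound[OF S]) force+
  moreover have "K * norm x * d \<le> (K * norm x + 1) * d" using d by (intro mult_right_mono) auto
  moreover have "(K * norm x + 1) * d = e" using p by (simp add: d_def)
  ultimately show "norm (S x) \<le> K * c * norm x + e" by (simp add: algebra_simps)
qed

text \<open>An empty spectrum makes the norm bound arbitrarily small, so \<open>T = 0\<close>; but \<open>T\<close> is injective.\<close>

lemma empty_spectrum_trivial: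
  assumes T: "selfadjoint ip T" and e: "spectrum ip T = {}" shows "(x::'h) = 0"
proof -
  have "norm (T x) \<le> K * 0 * norm x" using e by (intro selfadjoint_norm_bound_le[OF T]) auto
  then have "T x = 0" by simp
  moreover have "op_invertible ip (\<lambda>x. T x - 0 *\<^sub>C x)" using e not_in_spectrum_iff by blast
  then have "inj T" using op_invertible_bij bij_is_inj by fastforce
  ultimately show ?thesis using bclin_zero[OF selfadjoint_bclin[OF T]] by (metis injD)
qed

text \<open>Apply \<open>op_poly_invertible\<close> to \<open>p - z\<close>. This polynomial can be 0 only if the spectrum is empty, and then the
  space is trivial.\<close>

lemma spectrum_op_poly:
  assumes T: "selfadjoint ip T" and z: "z \<in> spectrum ip (op_poly p T)"
  shows "z \<in> poly p ` spectrum ip T"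
proof (rule ccontr)
  assume ne: "z \<notin> poly p ` spectrum ip T"
  note bT = selfadjoint_bclin[OF T]
  have "op_invertible ip (\<lambda>x. op_poly p T x - z *\<^sub>C x)"
  proof (cases "p = [:z:]")
    case True
    then have "spectrum ip T = {}" using ne by auto
    then have triv: "x = 0" for x :: 'h by (rule empty_spectrum_trivial[OF T])
    then have "x = y" for x y :: 'h by metis
    then show ?thesis unfolding op_invertible_def fun_eq_iff using adjointable_id by blast
  next
    case False
    have "op_poly (p - [:z:]) T = (\<lambda>x. op_poly p T x - z *\<^sub>C x)"
      by (simp add: op_poly_diff[OF bT] op_poly_const[OF bT] fun_eq_iff)
    moreover have "op_invertible ip (op_poly (p - [:z:]) T)"
      using ne False by (intro op_poly_invertible[OF T]) auto
    ultimately show ?thesis by simp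
  qed
  then show False using z not_in_spectrum_iff by blast
qed

lemma cnj_spectrum:
  assumes "selfadjoint ip T" "z \<in> spectrum ip T" shows "cnj z = z"
  using spectrum_real[OF assms] by (simp add: complex_eq_iff)

text \<open>The bound for self-adjoint operators applies to \<open>p(T)\<^sup>* p(T)\<close>, which is the polynomial \<open>p\<^sup>\<dagger> p\<close> with conjugated
  coefficients in \<open>p\<^sup>\<dagger>\<close>; on the real spectrum its values are \<open>|p|\<^sup>2\<close>.\<close>

lemma op_poly_bound:
  assumes T: "selfadjoint ip T" and c: "0 \<le> c" "\<And>z. z \<in> spectrum ip T \<Longrightarrow> cmod (poly p z) \<le> c"
  shows "norm (op_poly p T x) \<le> K * c * norm x"
proof -
  define q where "q = map_poly cnj p * p"
  note bT = selfadjoint_bclin[OF T]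
  define S where "S = op_poly q T"
  have S: "S y = op_poly (map_poly cnj p) T (op_poly p T y)" for y
    by (simp add: S_def q_def op_poly_mult[OF bT])
  have adj: "adjoint_pair ip (op_poly p T) (op_poly (map_poly cnj p) T)"
    by (rule adjoint_pair_op_poly[OF T])
  have Ssa: "selfadjoint ip S"
    using adjoint_pair_comp[OF adjoint_pair_sym[OF adj] adj] unfolding S .
  have "cmod w \<le> c\<^sup>2" if w: "w \<in> spectrum ip S" for w
  proof -
    obtain z where z: "z \<in> spectrum ip T" "w = poly q z"
      using spectrum_op_poly[OF T w[unfolded S_def]] by blast
    have "poly (map_poly cnj p) z = cnj (poly p z)"
      using poly_map_cnj[of p z] cnj_spectrum[OF T z(1)] by simp
    then have "cmod w = (cmod (poly p z))\<^sup>2"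
      by (simp add: z(2) q_def norm_mult power2_eq_square)
    then show ?thesis using c(2)[OF z(1)] by (simp add: power_mono)
  qed
  then have Sb: "norm (S x) \<le> K * c\<^sup>2 * norm x" by (intro selfadjoint_norm_bound_le[OF Ssa]) auto
  have "(norm (op_poly p T x))\<^sup>2 = norm (ip x (S x))"
    using adj by (simp add: S adjoint_pair_def flip: norm_ip_self)
  also have "\<dots> \<le> K * norm x * norm (S x)" by (rule cauchy_schwarz)
  also have "\<dots> \<le> K * norm x * (K * c\<^sup>2 * norm x)"
    using Sb K_ge_1 by (intro mult_left_mono) auto
  finally have "(norm (op_poly p T x))\<^sup>2 \<le> (K * c * norm x)\<^sup>2"
    by (simp add: power2_eq_square mult_ac)
  then show ?thesis using K_ge_1 c(1) power2_le_imp_le by (metis mult_nonneg_nonneg norm_ge_zero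
      order_trans zero_le_one)
qed

end

section \<open>Existence of the continuous functional calculus\<close>

text \<open>Weierstrass approximation of the real and imaginary parts.\<close>

lemma complex_poly_approx:
  assumes S: "compact S" "\<And>z. z \<in> S \<Longrightarrow> Im z = 0" and f: "continuous_on S f" and e: "e > 0"
  shows "\<exists>p. \<forall>z\<in>S. cmod (poly p z - f z) \<le> e"
proof -
  define R where "R = Re ` S"
  have R: "compact R" unfolding R_def using S(1) by (intro compact_continuous_image continuous_intros)
  have RS: "complex_of_real r \<in> S" if r: "r \<in> R" for r
  proof -
    obtain z where z: "z \<in> S" "r = Re z" using r by (auto simp: R_def)
    then have "complex_of_real r = z" using S(2) by (simp add: complex_eq_iff)
    then show ?thesis using z by simp
  qed
  have cf: "continuous_on R (\<lambda>r. f (complex_of_real r))"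
    using RS by (intro continuous_on_compose2[OF f]) (auto intro: continuous_intros)
  have "continuous_on R (\<lambda>r. Re (f (complex_of_real r)))" using cf by (intro continuous_intros)
  then obtain g where g: "real_polynomial_function g"
    "\<And>r. r \<in> R \<Longrightarrow> \<bar>Re (f (complex_of_real r)) - g r\<bar> < e / 2"
    using Stone_Weierstrass_real_polynomial_function[OF R, of _ "e / 2"] e by (metis half_gt_zero)
  have "continuous_on R (\<lambda>r. Im (f (complex_of_real r)))" using cf by (intro continuous_intros)
  then obtain h where h: "real_polynomial_function h"
    "\<And>r. r \<in> R \<Longrightarrow> \<bar>Im (f (complex_of_real r)) - h r\<bar> < e / 2"
    using Stone_Weierstrass_real_polynomial_function[OF R, of _ "e / 2"] e by (metis half_gt_zero)
  obtain a m where a: "g = (\<lambda>x. \<Sum>i\<le>(m::nat). a i * x ^ i)"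
    using g(1) real_polynomial_function_iff_sum by blast
  obtain b n where b: "h = (\<lambda>x. \<Sum>i\<le>(n::nat). b i * x ^ i)"
    using h(1) real_polynomial_function_iff_sum by blast
  define p where "p = (\<Sum>i\<le>m. monom (complex_of_real (a i)) i)
    + smult \<i> (\<Sum>i\<le>n. monom (complex_of_real (b i)) i)"
  have "cmod (poly p z - f z) \<le> e" if z: "z \<in> S" for z
  proof -
    define r where "r = Re z"
    have r: "r \<in> R" "z = complex_of_real r"
      using z S(2) by (auto simp: R_def r_def complex_eq_iff)
    have pz: "poly p (complex_of_real r) = complex_of_real (g r) + \<i> * complex_of_real (h r)"
      by (simp add: p_def a b poly_sum poly_monom)
    have "cmod (poly p z - f z) \<le> \<bar>Re (poly p z - f z)\<bar> + \<bar>Im (poly p z - f z)\<bar>"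
      by (rule cmod_le)
    then show ?thesis using g(2)[OF r(1)] h(2)[OF r(1)] by (simp add: pz r(2) abs_minus_commute)
  qed
  then show ?thesis by blast
qed

context hilbert_module_cs
begin

context
  fixes T assumes T: "selfadjoint ip T"
begin

text \<open>Sequences of polynomials converging to \<open>f\<close> uniformly on the spectrum. The values \<open>calc f\<close> of the calculus are
  the pointwise limits along one such sequence; \<open>calc_lim\<close> shows that any other would do, and every algebraic
  property of the calculus is read off a suitable sequence.\<close>

private definition approx :: "(complex \<Rightarrow> complex) \<Rightarrow> (nat \<Rightarrow> complex poly) \<Rightarrow> bool" where
  "approx f q \<longleftrightarrow> (\<exists>e. e \<longlonglongrightarrow> 0 \<and> (\<forall>n. 0 \<le> e n) \<and> (\<forall>n. \<forall>z\<in>spectrum ip T. cmod (poly (q n) z - f z) \<le> e n))"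

private definition calc :: "(complex \<Rightarrow> complex) \<Rightarrow> 'h \<Rightarrow> 'h" where
  "calc f x = lim (\<lambda>n. op_poly ((SOME q. approx f q) n) T x)"

private lemma approx_exists:
  assumes f: "continuous_on (spectrum ip T) f" shows "\<exists>q. approx f q"
proof -
  have "\<exists>q. \<forall>z\<in>spectrum ip T. cmod (poly q z - f z) \<le> inverse (real (Suc n))" for n
    by (rule complex_poly_approx[OF compact_spectrum[OF T] spectrum_real[OF T] f]) auto
  then obtain q where q: "\<forall>n. \<forall>z\<in>spectrum ip T. cmod (poly (q n) z - f z) \<le> inverse (real (Suc n))" by metis
  show ?thesis unfolding approx_def
    by (rule exI[of _ q], rule exI[of _ "\<lambda>n. inverse (real (Suc n))"])
      (use q LIMSEQ_inverse_real_of_nat in auto)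
qed

private lemma approx_diff_tendsto_0:
  assumes "approx f q" "approx f q'"
  shows "(\<lambda>n. op_poly (q n) T x - op_poly (q' n) T x) \<longlonglongrightarrow> 0"
proof -
  obtain e e' where e: "e \<longlonglongrightarrow> 0" "\<And>n. 0 \<le> e n" "\<And>n z. z \<in> spectrum ip T \<Longrightarrow> cmod (poly (q n) z - f z) \<le> e n"
    and e': "e' \<longlonglongrightarrow> 0" "\<And>n. 0 \<le> e' n" "\<And>n z. z \<in> spectrum ip T \<Longrightarrow> cmod (poly (q' n) z - f z) \<le> e' n"
    using assms unfolding approx_def by blast
  have "norm (op_poly (q n - q' n) T x) \<le> K * (e n + e' n) * norm x" for n
  proof (rule op_poly_bound[OF T])
    fix z assume "z \<in> spectrum ip T"
    then show "cmod (poly (q n - q' n) z) \<le> e n + e' n"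
      using e(3)[of z n] e'(3)[of z n] norm_triangle_ineq4[of "poly (q n) z - f z" "poly (q' n) z - f z"]
      by simp
  qed (use e(2) e'(2) in \<open>simp add: add_nonneg_nonneg\<close>)
  then have "\<forall>\<^sub>F n in sequentially.
      norm (op_poly (q n) T x - op_poly (q' n) T x) \<le> K * (e n + e' n) * norm x"
    by (simp add: op_poly_diff[OF selfadjoint_bclin[OF T]])
  moreover have "(\<lambda>n. K * (e n + e' n) * norm x) \<longlonglongrightarrow> K * (0 + 0) * norm x"
    by (intro tendsto_mult tendsto_add tendsto_const e(1) e'(1))
  then have "(\<lambda>n. K * (e n + e' n) * norm x) \<longlonglongrightarrow> 0" by simp
  ultimately show ?thesis by (rule Lim_null_comparison)
qed

private lemma approx_convergent:
  assumes "approx f q" shows "convergent (\<lambda>n. op_poly (q n) T x)"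
proof -
  obtain e where e: "e \<longlonglongrightarrow> 0" "\<And>n. 0 \<le> e n" "\<And>n z. z \<in> spectrum ip T \<Longrightarrow> cmod (poly (q n) z - f z) \<le> e n"
    using assms unfolding approx_def by blast
  have d: "norm (op_poly (q m) T x - op_poly (q n) T x) \<le> K * (e m + e n) * norm x" for m n
    unfolding op_poly_diff[OF selfadjoint_bclin[OF T], symmetric]
  proof (rule op_poly_bound[OF T])
    fix z assume "z \<in> spectrum ip T"
    then show "cmod (poly (q m - q n) z) \<le> e m + e n"
      using e(3)[of z m] e(3)[of z n] norm_triangle_ineq4[of "poly (q m) z - f z" "poly (q n) z - f z"]
      by simp
  qed (use e(2) in \<open>simp add: add_nonneg_nonneg\<close>)
  have z: "(\<lambda>n. K * e n * norm x) \<longlonglongrightarrow> 0"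
    using tendsto_mult[OF tendsto_mult[OF tendsto_const e(1)] tendsto_const, of K "norm x"] by simp
  have "Cauchy (\<lambda>n. op_poly (q n) T x)"
  proof (rule metric_CauchyI)
    fix \<epsilon> :: real assume "\<epsilon> > 0"
    then obtain N where N: "\<And>n. n \<ge> N \<Longrightarrow> \<bar>K * e n * norm x\<bar> < \<epsilon> / 2"
      using LIMSEQ_D[OF z, of "\<epsilon> / 2"] by auto
    have "dist (op_poly (q m) T x) (op_poly (q n) T x) < \<epsilon>" if "m \<ge> N" "n \<ge> N" for m n
      using N[OF that(1)] N[OF that(2)] d[of m n] by (simp add: dist_norm algebra_simps)
    then show "\<exists>M. \<forall>m\<ge>M. \<forall>n\<ge>M. dist (op_poly (q m) T x) (op_poly (q n) T x) < \<epsilon>" by blast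
  qed
  then show ?thesis by (simp add: Cauchy_convergent_iff)
qed

private lemma calc_lim:
  assumes "approx f q" shows "(\<lambda>n. op_poly (q n) T x) \<longlonglongrightarrow> calc f x"
proof -
  define q' where "q' = (SOME q. approx f q)"
  have q': "approx f q'" unfolding q'_def using someI_ex[of "approx f"] assms by blast
  have "(\<lambda>n. op_poly (q' n) T x) \<longlonglongrightarrow> calc f x"
    using approx_convergent[OF q'] unfolding calc_def q'_def by (simp add: convergent_LIMSEQ_iff)
  from tendsto_add[OF approx_diff_tendsto_0[OF assms q', of x] this] show ?thesis by simp
qed

private lemma calc_eqI:
  assumes "approx f q" "\<And>x. (\<lambda>n. op_poly (q n) T x) \<longlonglongrightarrow> A x" shows "calc f = A"
  using calc_lim[OF assms(1)] assms(2) LIMSEQ_unique by blast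

private lemma approx_poly: "approx (poly p) (\<lambda>n. p)"
  unfolding approx_def by (intro exI[of _ "\<lambda>n. 0"]) auto

private lemma approx_add:
  assumes "approx f q" "approx g q'" shows "approx (\<lambda>z. f z + g z) (\<lambda>n. q n + q' n)"
proof -
  obtain e e' where e: "e \<longlonglongrightarrow> 0" "\<And>n. 0 \<le> e n" "\<And>n z. z \<in> spectrum ip T \<Longrightarrow> cmod (poly (q n) z - f z) \<le> e n"
    and e': "e' \<longlonglongrightarrow> 0" "\<And>n. 0 \<le> e' n" "\<And>n z. z \<in> spectrum ip T \<Longrightarrow> cmod (poly (q' n) z - g z) \<le> e' n"
    using assms unfolding approx_def by blast
  have "cmod (poly (q n + q' n) z - (f z + g z)) \<le> e n + e' n" if "z \<in> spectrum ip T" for n z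
    using e(3)[OF that, of n] e'(3)[OF that, of n]
      norm_triangle_ineq[of "poly (q n) z - f z" "poly (q' n) z - g z"] by (simp add: algebra_simps)
  moreover have "(\<lambda>n. e n + e' n) \<longlonglongrightarrow> 0" using tendsto_add[OF e(1) e'(1)] by simp
  ultimately show ?thesis
    unfolding approx_def using e(2) e'(2)
    by (intro exI[of _ "\<lambda>n. e n + e' n"]) (auto intro: add_nonneg_nonneg)
qed

private lemma approx_bound:
  assumes f: "continuous_on (spectrum ip T) f" and q: "approx f q"
  obtains B where "B \<ge> 0" "\<And>n z. z \<in> spectrum ip T \<Longrightarrow> cmod (poly (q n) z) \<le> B" "\<And>z. z \<in> spectrum ip T \<Longrightarrow> cmod (f z) \<le> B"
proof -
  obtain e where e: "e \<longlonglongrightarrow> 0" "\<And>n z. z \<in> spectrum ip T \<Longrightarrow> cmod (poly (q n) z - f z) \<le> e n"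
    using q unfolding approx_def by blast
  obtain E where E: "E > 0" "\<And>n. \<bar>e n\<bar> \<le> E"
    using convergent_imp_Bseq[of e] e(1) unfolding Bseq_def convergent_def by auto
  have "bounded (f ` spectrum ip T)"
    using compact_imp_bounded compact_continuous_image[OF f compact_spectrum[OF T]] by blast
  then obtain C where C: "C > 0" "\<And>z. z \<in> spectrum ip T \<Longrightarrow> cmod (f z) \<le> C"
    unfolding bounded_pos by auto
  have "cmod (poly (q n) z) \<le> E + C" if "z \<in> spectrum ip T" for n z
    using norm_triangle_ineq[of "poly (q n) z - f z" "f z"] e(2)[OF that, of n] E(2)[of n] C(2)[OF that]
    by simp
  then show ?thesis using E(1) C that[of "E + C"] by force
qed

private lemma approx_mult:
  assumes f: "continuous_on (spectrum ip T) f" and g: "continuous_on (spectrum ip T) g" and "approx f q" "approx g q'"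
  shows "approx (\<lambda>z. f z * g z) (\<lambda>n. q n * q' n)"
proof -
  obtain e e' where e: "e \<longlonglongrightarrow> 0" "\<And>n. 0 \<le> e n" "\<And>n z. z \<in> spectrum ip T \<Longrightarrow> cmod (poly (q n) z - f z) \<le> e n"
    and e': "e' \<longlonglongrightarrow> 0" "\<And>n. 0 \<le> e' n" "\<And>n z. z \<in> spectrum ip T \<Longrightarrow> cmod (poly (q' n) z - g z) \<le> e' n"
    using assms unfolding approx_def by blast
  obtain B where B: "B \<ge> 0" "\<And>z. z \<in> spectrum ip T \<Longrightarrow> cmod (f z) \<le> B"
    by (rule approx_bound[OF f assms(3)]) (rule that; assumption)
  obtain B' where B': "B' \<ge> 0" "\<And>n z. z \<in> spectrum ip T \<Longrightarrow> cmod (poly (q' n) z) \<le> B'"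
    by (rule approx_bound[OF g assms(4)]) (rule that; assumption)
  have "cmod (poly (q n * q' n) z - f z * g z) \<le> e n * B' + B * e' n" if z: "z \<in> spectrum ip T" for n z
  proof -
    have "poly (q n * q' n) z - f z * g z
        = (poly (q n) z - f z) * poly (q' n) z + f z * (poly (q' n) z - g z)"
      by (simp add: algebra_simps)
    also have "cmod \<dots> \<le> cmod (poly (q n) z - f z) * cmod (poly (q' n) z)
        + cmod (f z) * cmod (poly (q' n) z - g z)"
      by (metis norm_mult norm_triangle_ineq)
    also have "\<dots> \<le> e n * B' + B * e' n"
      using e(2,3) e'(2,3) B B' z by (intro add_mono mult_mono) auto
    finally show ?thesis .
  qed
  moreover have "(\<lambda>n. e n * B' + B * e' n) \<longlonglongrightarrow> 0 * B' + B * 0"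
    by (intro tendsto_mult tendsto_add tendsto_const e(1) e'(1))
  ultimately show ?thesis
    unfolding approx_def using e(2) e'(2) B(1) B'(1)
    by (intro exI[of _ "\<lambda>n. e n * B' + B * e' n"]) (auto intro: add_nonneg_nonneg)
qed

private lemma approx_cnj:
  assumes "approx f q" shows "approx (\<lambda>z. cnj (f z)) (\<lambda>n. map_poly cnj (q n))"
proof -
  obtain e where e: "e \<longlonglongrightarrow> 0" "\<And>n. 0 \<le> e n" "\<And>n z. z \<in> spectrum ip T \<Longrightarrow> cmod (poly (q n) z - f z) \<le> e n"
    using assms unfolding approx_def by blast
  have "cmod (poly (map_poly cnj (q n)) z - cnj (f z)) \<le> e n" if z: "z \<in> spectrum ip T" for n z
  proof -
    have "poly (map_poly cnj (q n)) z - cnj (f z) = cnj (poly (q n) z - f z)"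
      using poly_map_cnj[of "q n" z] cnj_spectrum[OF T z] by simp
    then show ?thesis using e(3)[OF z, of n] by (metis complex_mod_cnj)
  qed
  then show ?thesis unfolding approx_def using e(1,2) by blast
qed

text \<open>The two limits are taken together: \<open>q\<^sub>n(T)\<close> applied to the null sequence \<open>q'\<^sub>n(T) x - g(T) x\<close> tends to 0
  because the operators \<open>q\<^sub>n(T)\<close> are uniformly bounded.\<close>

private lemma calc_mult:
  assumes f: "continuous_on (spectrum ip T) f" and g: "continuous_on (spectrum ip T) g"
  shows "calc (\<lambda>z. f z * g z) = calc f \<circ> calc g"
proof -
  note bT = selfadjoint_bclin[OF T]
  obtain q q' where q: "approx f q" and q': "approx g q'"
    using approx_exists f g by blast
  obtain B where B: "B \<ge> 0" "\<And>n z. z \<in> spectrum ip T \<Longrightarrow> cmod (poly (q n) z) \<le> B"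
    by (rule approx_bound[OF f q]) (rule that; assumption)
  show ?thesis
  proof (rule calc_eqI[OF approx_mult[OF f g q q']])
    fix x
    define y where "y = (\<lambda>n. op_poly (q' n) T x - calc g x)"
    have y: "y \<longlonglongrightarrow> 0" unfolding y_def by (rule LIM_zero[OF calc_lim[OF q']])
    have "norm (op_poly (q n) T (y n)) \<le> K * B * norm (y n)" for n
      by (rule op_poly_bound[OF T B])
    moreover have "(\<lambda>n. K * B * norm (y n)) \<longlonglongrightarrow> 0"
      using tendsto_mult[OF tendsto_const tendsto_norm[OF y], of "K * B"] by simp
    ultimately have "(\<lambda>n. op_poly (q n) T (y n)) \<longlonglongrightarrow> 0"
      by (rule Lim_null_comparison[OF always_eventually, rule_format])
    from tendsto_add[OF this calc_lim[OF q, of "calc g x"]]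
    show "(\<lambda>n. op_poly (q n * q' n) T x) \<longlonglongrightarrow> (calc f \<circ> calc g) x"
      by (simp add: op_poly_mult[OF bT] y_def bclin_diff[OF bounded_clinear_op_poly[OF bT]])
  qed
qed

lemma functional_calculus_exists: "\<exists>\<Phi>. is_functional_calculus ip T \<Phi>"
proof (rule exI[of _ calc])
  note bT = selfadjoint_bclin[OF T]
  have p1: "poly [:1:] = (\<lambda>z::complex. 1)" and pX: "poly [:0, 1:] = (\<lambda>z::complex. z)"
    by (simp_all add: fun_eq_iff)
  have one: "calc (\<lambda>z. 1) = id"
    unfolding p1[symmetric] using calc_eqI[OF approx_poly[of "[:1:]"], of id] by (simp add: op_poly_const[OF bT])
  have ident: "calc (\<lambda>z. z) = T"
    unfolding pX[symmetric] using calc_eqI[OF approx_poly[of "[:0, 1:]"], of T]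
    by (simp add: op_poly_pCons[OF bT] bclin_zero[OF bT])
  have adj: "adjoint_pair ip (calc f) (calc (\<lambda>z. cnj (f z)))" if f: "continuous_on (spectrum ip T) f" for f
    unfolding adjoint_pair_def
  proof (intro allI)
    fix x y
    obtain q where q: "approx f q" using approx_exists[OF f] by blast
    have "(\<lambda>n. ip (op_poly (q n) T x) y) \<longlonglongrightarrow> ip (calc f x) y"
      by (rule tendsto_ip_left[OF calc_lim[OF q]])
    moreover have "(\<lambda>n. ip x (op_poly (map_poly cnj (q n)) T y)) \<longlonglongrightarrow> ip x (calc (\<lambda>z. cnj (f z)) y)"
      by (rule tendsto_ip_right[OF calc_lim[OF approx_cnj[OF q]]])
    moreover have "ip (op_poly (q n) T x) y = ip x (op_poly (map_poly cnj (q n)) T y)" for n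
      using adjoint_pair_op_poly[OF T] by (simp add: adjoint_pair_def)
    ultimately show "ip (calc f x) y = ip x (calc (\<lambda>z. cnj (f z)) y)"
      by (simp add: LIMSEQ_unique)
  qed
  have scale: "calc (\<lambda>z. c * f z) = (\<lambda>x. c *\<^sub>C calc f x)" if f: "continuous_on (spectrum ip T) f" for c f
  proof -
    have "calc (\<lambda>z. poly [:c:] z * f z) = calc (poly [:c:]) \<circ> calc f"
      by (rule calc_mult[OF _ f]) (intro continuous_intros)
    moreover have "calc (poly [:c:]) = (\<lambda>x. c *\<^sub>C x)"
      by (rule calc_eqI[OF approx_poly]) (simp add: op_poly_const[OF bT])
    ultimately show ?thesis by (simp add: comp_def)
  qed
  have add: "calc (\<lambda>z. f z + g z) = (\<lambda>x. calc f x + calc g x)"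
    if f: "continuous_on (spectrum ip T) f" and g: "continuous_on (spectrum ip T) g" for f g
  proof -
    obtain q q' where q: "approx f q" and q': "approx g q'" using approx_exists f g by blast
    show ?thesis
      by (rule calc_eqI[OF approx_add[OF q q']])
        (simp add: op_poly_add[OF bT] tendsto_add[OF calc_lim[OF q] calc_lim[OF q']])
  qed
  have cong: "calc f = calc g"
    if f: "continuous_on (spectrum ip T) f" and eq: "\<forall>z\<in>spectrum ip T. f z = g z" for f g
  proof -
    obtain q where q: "approx f q" using approx_exists f by blast
    then have "approx g q" using eq by (simp add: approx_def)
    then show ?thesis by (intro calc_eqI[OF q] calc_lim)
  qed
  show "is_functional_calculus ip T calc"
    unfolding is_functional_calculus_def
  proof (intro conjI allI impI)
    fix f :: "complex \<Rightarrow> complex" assume f: "continuous_on (spectrum ip T) f"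
    show "adjointable ip (calc f)" using adj[OF f] by (rule adjoint_pairD)
    show "calc (\<lambda>z. cnj (f z)) = adj ip (calc f)" using adj_eqI[OF adj[OF f]] by simp
    show "calc (\<lambda>z. c * f z) = (\<lambda>x. c *\<^sub>C calc f x)" for c by (rule scale[OF f])
    fix g :: "complex \<Rightarrow> complex" assume g: "continuous_on (spectrum ip T) g"
    show "calc (\<lambda>z. f z + g z) = (\<lambda>x. calc f x + calc g x)" by (rule add[OF f g])
    show "calc (\<lambda>z. f z * g z) = calc f \<circ> calc g" by (rule calc_mult[OF f g])
    show "calc f = calc g" if "\<forall>z\<in>spectrum ip T. f z = g z" by (rule cong[OF f that])
  qed (rule one ident)+
qed

end

end

section \<open>Consequences of the functional calculus\<close>

context hilbert_module_cs
begin

text \<open>Since \<open>P\<^sup>2 + Q\<^sup>2 = (P - \<i> Q) (P + \<i> Q)\<close>, and each factor dominates \<open>P\<close> by \<open>norm_le_norm_add_orthogonal\<close>, this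
  instance of monotonicity comes from the triangle inequality alone.\<close>

lemma norm_square_le_sum_squares:
  assumes P: "selfadjoint ip P" and Q: "selfadjoint ip Q" and comm: "\<And>x. P (Q x) = Q (P x)"
  shows "norm (P (P x)) \<le> norm (P (P x) + Q (Q x))"
proof -
  have le: "norm (P y) \<le> norm (P y + c *\<^sub>C Q y)" if c: "cnj c = - c" for c y
  proof (rule norm_le_norm_add_orthogonal)
    have "ip (P y) (Q y) = ip (Q y) (P y)"
      by (metis P Q comm ip_selfadjoint)
    then show "ip (P y) (c *\<^sub>C Q y) + ip (c *\<^sub>C Q y) (P y) = 0"
      using c by (simp add: ip_simps)
  qed
  note bP = selfadjoint_bclin[OF P] and bQ = selfadjoint_bclin[OF Q]
  have "norm (P (P x)) \<le> norm (P (P x) + \<i> *\<^sub>C Q (P x))" by (rule le) simp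
  also have "P (P x) + \<i> *\<^sub>C Q (P x) = P (P x + \<i> *\<^sub>C Q x)"
    by (simp add: bclin_add[OF bP] bclin_scaleC[OF bP] comm)
  also have "norm \<dots> \<le> norm (P (P x + \<i> *\<^sub>C Q x) + (- \<i>) *\<^sub>C Q (P x + \<i> *\<^sub>C Q x))"
    by (rule le) simp
  also have "P (P x + \<i> *\<^sub>C Q x) + (- \<i>) *\<^sub>C Q (P x + \<i> *\<^sub>C Q x) = P (P x) + Q (Q x)"
    by (simp add: bclin_add[OF bP] bclin_scaleC[OF bP] bclin_add[OF bQ] bclin_scaleC[OF bQ]
        comm scaleC_simps)
  finally show ?thesis .
qed

context
  fixes T \<Phi> assumes T: "selfadjoint ip T" and \<Phi>: "is_functional_calculus ip T \<Phi>"
begin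

lemma fc_one: "\<Phi> (\<lambda>z. 1) = (\<lambda>x. x)"
  using conjunct1[OF \<Phi>[unfolded is_functional_calculus_def]] by (simp add: id_def)

lemma fc_ident: "\<Phi> (\<lambda>z. z) = T"
  by (rule conjunct1[OF conjunct2[OF \<Phi>[unfolded is_functional_calculus_def]]])

private lemma fc_all:
  fixes f :: "complex \<Rightarrow> complex"
  assumes f: "continuous_on (spectrum ip T) f"
  shows "adjointable ip (\<Phi> f) \<and> \<Phi> (\<lambda>z. cnj (f z)) = adj ip (\<Phi> f) \<and>
      (\<forall>c. \<Phi> (\<lambda>z. c * f z) = (\<lambda>x. c *\<^sub>C \<Phi> f x)) \<and>
      (\<forall>g. continuous_on (spectrum ip T) g \<longrightarrow>
        \<Phi> (\<lambda>z. f z + g z) = (\<lambda>x. \<Phi> f x + \<Phi> g x) \<and>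
        \<Phi> (\<lambda>z. f z * g z) = \<Phi> f \<circ> \<Phi> g \<and>
        ((\<forall>z\<in>spectrum ip T. f z = g z) \<longrightarrow> \<Phi> f = \<Phi> g))"
  by (rule \<Phi>[unfolded is_functional_calculus_def, THEN conjunct2, THEN conjunct2, THEN spec,
      THEN mp, OF f])

private lemmas fc_all2 = fc_all[THEN conjunct2, THEN conjunct2, THEN conjunct2, THEN spec, THEN mp]

lemma fc_adjoint_pair:
  assumes f: "continuous_on (spectrum ip T) f"
  shows "adjoint_pair ip (\<Phi> f) (\<Phi> (\<lambda>z. cnj (f z)))"
proof -
  have "adjointable ip (\<Phi> f)" by (rule fc_all[OF f, THEN conjunct1])
  moreover have "\<Phi> (\<lambda>z. cnj (f z)) = adj ip (\<Phi> f)"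
    by (rule fc_all[OF f, THEN conjunct2, THEN conjunct1])
  ultimately show ?thesis by (simp add: adjointable_iff)
qed

lemma fc_scaleC:
  assumes f: "continuous_on (spectrum ip T) f" shows "\<Phi> (\<lambda>z. c * f z) x = c *\<^sub>C \<Phi> f x"
  by (rule fun_cong[OF fc_all[OF f, THEN conjunct2, THEN conjunct2, THEN conjunct1, THEN spec]])

lemma fc_add:
  assumes "continuous_on (spectrum ip T) f" "continuous_on (spectrum ip T) g"
  shows "\<Phi> (\<lambda>z. f z + g z) x = \<Phi> f x + \<Phi> g x"
  by (rule fun_cong[OF fc_all2[OF assms, THEN conjunct1]])

lemma fc_mult:
  assumes "continuous_on (spectrum ip T) f" "continuous_on (spectrum ip T) g"
  shows "\<Phi> (\<lambda>z. f z * g z) x = \<Phi> f (\<Phi> g x)"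
  using fun_cong[OF fc_all2[OF assms, THEN conjunct2, THEN conjunct1]] by simp

lemma fc_cong:
  assumes f: "continuous_on (spectrum ip T) f" and eq: "\<And>z. z \<in> spectrum ip T \<Longrightarrow> f z = g z"
  shows "\<Phi> f = \<Phi> g"
proof -
  have "continuous_on (spectrum ip T) g"
    using f continuous_on_cong[OF refl eq, of "spectrum ip T"] by simp
  from fc_all2[OF f this, THEN conjunct2, THEN conjunct2] eq show ?thesis by simp
qed

lemma fc_const: "\<Phi> (\<lambda>z. c) x = c *\<^sub>C x"
  using fc_scaleC[of "\<lambda>z. 1" c x] by (simp add: fc_one)

lemma fc_uminus:
  "continuous_on (spectrum ip T) f \<Longrightarrow> \<Phi> (\<lambda>z. - f z) x = - \<Phi> f x"
  using fc_scaleC[of f "-1" x] by simp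

lemma fc_diff:
  assumes "continuous_on (spectrum ip T) f" "continuous_on (spectrum ip T) g"
  shows "\<Phi> (\<lambda>z. f z - g z) x = \<Phi> f x - \<Phi> g x"
  using fc_add[OF assms(1) continuous_on_minus[OF assms(2)], of x] fc_uminus[OF assms(2), of x]
  by simp

lemma fc_selfadjoint:
  assumes f: "continuous_on (spectrum ip T) f" and "\<And>z. z \<in> spectrum ip T \<Longrightarrow> cnj (f z) = f z"
  shows "selfadjoint ip (\<Phi> f)"
  using fc_adjoint_pair[OF f] fc_cong[OF f, of "\<lambda>z. cnj (f z)"] assms by simp

lemma fc_compose_poly:
  assumes f: "continuous_on (spectrum ip T) f"
  shows "\<Phi> (\<lambda>z. poly p (f z)) x = op_poly p (\<Phi> f) x"
proof (induction p arbitrary: x)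
  case 0
  then show ?case using fc_const[of 0 x] by simp
next
  case (pCons a p)
  have bf: "bounded_clinear (\<Phi> f)"
    using fc_adjoint_pair[OF f] adjoint_pairD adjointable_imp_bounded_clinear by blast
  have cp: "continuous_on (spectrum ip T) (\<lambda>z. poly p (f z))" by (intro continuous_intros f)
  have "\<Phi> (\<lambda>z. a + f z * poly p (f z)) x = \<Phi> (\<lambda>z. a) x + \<Phi> (\<lambda>z. f z * poly p (f z)) x"
    by (rule fc_add) (intro continuous_intros f cp)+
  then show ?case by (simp add: op_poly_pCons[OF bf] fc_const fc_mult[OF f cp] pCons)
qed

text \<open>Continuity of an arbitrary functional calculus, not only of the one constructed above: the calculus
  named by \<open>cfc\<close> is a choice. Complete \<open>h = |f|\<close> by \<open>g\<close> to \<open>h\<^sup>2 + g\<^sup>2 = c\<^sup>2\<close> and apply \<open>norm_square_le_sum_squares\<close> to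
  \<open>h(T)\<close> and \<open>g(T)\<close>.\<close>

lemma fc_bound:
  assumes f: "continuous_on (spectrum ip T) f" and c: "0 \<le> c" "\<And>z. z \<in> spectrum ip T \<Longrightarrow> cmod (f z) \<le> c"
  shows "norm (\<Phi> f x) \<le> sqrt K * c * norm x"
proof -
  define g where "g z = complex_of_real (sqrt (max 0 (c\<^sup>2 - (cmod (f z))\<^sup>2)))" for z
  define h where "h z = complex_of_real (cmod (f z))" for z
  have cont: "continuous_on (spectrum ip T) g" "continuous_on (spectrum ip T) h"
    unfolding g_def h_def by (intro continuous_intros f)+
  have sa: "selfadjoint ip (\<Phi> g)" "selfadjoint ip (\<Phi> h)"
    by (auto intro!: fc_selfadjoint cont simp: g_def h_def)
  have comm: "\<Phi> h (\<Phi> g y) = \<Phi> g (\<Phi> h y)" for y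
    by (simp add: mult.commute flip: fc_mult[OF cont] fc_mult[OF cont(2,1)])
  have hh: "\<Phi> h (\<Phi> h x) = \<Phi> (\<lambda>z. cnj (f z)) (\<Phi> f x)"
  proof -
    have "h z * h z = cnj (f z) * f z" for z
      unfolding h_def by (metis complex_norm_square mult.commute of_real_mult power2_eq_square)
    then show ?thesis
      by (simp add: continuous_intros f flip: fc_mult[OF cont(2,2)] fc_mult)
  qed
  have "\<Phi> (\<lambda>z. h z * h z + g z * g z) = \<Phi> (\<lambda>z. complex_of_real (c\<^sup>2) * 1)"
  proof (rule fc_cong)
    fix z assume z: "z \<in> spectrum ip T"
    have "(cmod (f z))\<^sup>2 \<le> c\<^sup>2" using c z by (simp add: power_mono)
    then show "h z * h z + g z * g z = complex_of_real (c\<^sup>2) * 1"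
      unfolding h_def g_def of_real_mult[symmetric] of_real_add[symmetric]
      by (simp add: power2_eq_square)
  qed (intro continuous_intros cont)
  then have "\<Phi> h (\<Phi> h x) + \<Phi> g (\<Phi> g x) = complex_of_real (c\<^sup>2) *\<^sub>C x"
    using fc_scaleC[of "\<lambda>z. 1" "complex_of_real (c\<^sup>2)" x]
    by (simp add: fc_one flip: fc_mult[OF cont(2,2)] fc_mult[OF cont(1,1)])
       (subst fc_add[symmetric], auto intro!: continuous_intros cont)
  then have le: "norm (\<Phi> h (\<Phi> h x)) \<le> c\<^sup>2 * norm x"
    using norm_square_le_sum_squares[OF sa(2,1) comm, of x] by (simp add: norm_scaleC norm_power)
  have "(norm (\<Phi> f x))\<^sup>2 = norm (ip x (\<Phi> h (\<Phi> h x)))"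
    using fc_adjoint_pair[OF f] by (simp add: hh adjoint_pair_def flip: norm_ip_self)
  also have "\<dots> \<le> K * norm x * norm (\<Phi> h (\<Phi> h x))" by (rule cauchy_schwarz)
  also have "\<dots> \<le> K * norm x * (c\<^sup>2 * norm x)" using le K_ge_1 by (intro mult_left_mono) auto
  also have "\<dots> = (sqrt K * c * norm x)\<^sup>2"
    using K_ge_1 by (simp add: power_mult_distrib) (simp add: power2_eq_square)
  finally show ?thesis
    using K_ge_1 c(1) by (intro power2_le_imp_le[of "norm (\<Phi> f x)"]) auto
qed

text \<open>If the negative part \<open>n(T)\<close> vanishes, then for \<open>z < 0\<close> the inverse of \<open>T - z\<close> is \<open>h(T)\<close> where \<open>h\<close> is the reciprocal of
  \<open>max t 0 - z\<close>; the difference of \<open>(t - z) h(t)\<close> from 1 is a multiple of the negative part.\<close>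

lemma fc_nonneg_if_negative_part_0:
  assumes n: "\<And>x. \<Phi> (\<lambda>z. complex_of_real (max (- Re z) 0)) x = 0" and z: "z \<in> spectrum ip T"
  shows "0 \<le> Re z"
proof (rule ccontr)
  assume "\<not> ?thesis"
  then have neg: "Re z < 0" by simp
  define n where "n w = complex_of_real (max (- Re w) 0)" for w
  define h where "h w = complex_of_real (1 / (max (Re w) 0 - Re z))" for w
  have cn: "continuous_on (spectrum ip T) n" unfolding n_def by (intro continuous_intros)
  have ch: "continuous_on (spectrum ip T) h"
    unfolding h_def using neg by (intro continuous_intros) (auto simp: max_def)
  have ci: "continuous_on (spectrum ip T) (\<lambda>w. w - z)" by (intro continuous_intros)
  have eq: "(w - z) * h w = 1 - h w * n w" if w: "w \<in> spectrum ip T" for w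
  proof -
    obtain a b where ab: "w = complex_of_real a" "z = complex_of_real b"
      using spectrum_real[OF T w] spectrum_real[OF T z] by (metis complex_is_Real_iff Reals_cases)
    then have "b < 0" using neg by simp
    then have "(a - b) * (1 / (max a 0 - b)) = 1 - 1 / (max a 0 - b) * max (- a) 0"
      by (cases "0 \<le> a") (simp_all add: max_def field_simps)
    from arg_cong[OF this, of complex_of_real] show ?thesis
      by (simp add: ab h_def n_def)
  qed
  have Tz: "\<Phi> (\<lambda>w. w - z) x = T x - z *\<^sub>C x" for x
    using fc_diff[of "\<lambda>w. w" "\<lambda>w. z * 1" x] fc_scaleC[of "\<lambda>z. 1" z x]
    by (simp add: fc_ident fc_one continuous_intros)
  have "\<Phi> (\<lambda>w. (w - z) * h w) = \<Phi> (\<lambda>w. 1 - h w * n w)"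
    by (rule fc_cong) (use eq in \<open>auto intro!: continuous_intros ch cn\<close>)
  moreover have "\<Phi> (\<lambda>w. 1 - h w * n w) x = x" for x
  proof -
    have "\<Phi> h 0 = 0" using fc_adjoint_pair[OF ch] adjoint_pairD adjointable_imp_bounded_clinear
        bclin_zero by blast
    moreover have "\<Phi> (\<lambda>w. 1 - h w * n w) x = x - \<Phi> h (\<Phi> n x)"
      by (subst fc_diff) (auto simp: fc_one fc_mult[OF ch cn] intro!: continuous_intros ch cn)
    ultimately show ?thesis using n[of x] by (simp add: n_def[abs_def])
  qed
  ultimately have one: "\<Phi> (\<lambda>w. (w - z) * h w) x = x" for x by simp
  have left: "T (\<Phi> h x) - z *\<^sub>C \<Phi> h x = x" for x
    using one[of x] by (simp add: fc_mult[OF ci ch] Tz)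
  have "(\<lambda>w. (w - z) * h w) = (\<lambda>w. h w * (w - z))" by (simp add: mult.commute)
  then have right: "\<Phi> h (T x - z *\<^sub>C x) = x" for x
    using one[of x] by (simp add: fc_mult[OF ch ci] Tz)
  have "op_invertible ip (\<lambda>x. T x - z *\<^sub>C x)"
    using left right
    unfolding op_invertible_def using adjoint_pairD[OF fc_adjoint_pair[OF ch]]
    by (intro exI[of _ "\<Phi> h"]) (auto simp: fun_eq_iff)
  then show False using z not_in_spectrum_iff by blast
qed

end

section \<open>Operators with nonnegative spectrum\<close>

definition nonneg_op :: "('h \<Rightarrow> 'h) \<Rightarrow> bool" where
  "nonneg_op T \<longleftrightarrow> selfadjoint ip T \<and> (\<forall>z\<in>spectrum ip T. 0 \<le> Re z)"

lemma nonneg_op_selfadjoint: "nonneg_op T \<Longrightarrow> selfadjoint ip T"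
  by (simp add: nonneg_op_def)

lemma nonneg_op_square:
  assumes S: "selfadjoint ip S" shows "nonneg_op (\<lambda>x. S (S x))"
proof -
  note bS = selfadjoint_bclin[OF S]
  have eq: "op_poly [:0, 0, 1:] S = (\<lambda>x. S (S x))"
    by (simp add: op_poly_pCons[OF bS] bclin_zero[OF bS] fun_eq_iff)
  have "0 \<le> Re z" if z: "z \<in> spectrum ip (\<lambda>x. S (S x))" for z
  proof -
    obtain w where w: "w \<in> spectrum ip S" "z = poly [:0, 0, 1:] w"
      using spectrum_op_poly[OF S, of z "[:0, 0, 1:]"] z unfolding eq by blast
    then show ?thesis using spectrum_real[OF S w(1)] by simp
  qed
  then show ?thesis using adjoint_pair_comp[OF S S] by (simp add: nonneg_op_def)
qed

text \<open>Cut \<open>S\<close> down to the negative part of \<open>T = S\<^sup>* S\<close>: with \<open>n\<close> the negative part function and \<open>r = sqrt n\<close>, the operator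
  \<open>R = S r(T)\<close> satisfies \<open>R\<^sup>* R = r(T) T r(T) = - n(T)\<^sup>2\<close>. So positivity of \<open>S\<^sup>* S\<close> follows once
  \<open>R\<^sup>* R = - M\<^sup>2\<close> forces \<open>M = 0\<close>. This assumption is verified twice, for different reasons: in \<open>kelley_vaught\<close>
  under a sharp Cauchy--Schwarz inequality, and then in general from the properness of the algebra.\<close>

lemma adjoint_square_nonneg_if_proper:
  assumes proper: "\<And>R M x. adjointable ip R \<Longrightarrow> selfadjoint ip M \<Longrightarrow>
      (\<And>x. adj ip R (R x) = - M (M x)) \<Longrightarrow> M x = 0"
    and S: "adjointable ip S"
  shows "nonneg_op (\<lambda>x. adj ip S (S x))"
proof -
  define T where "T = (\<lambda>x. adj ip S (S x))"
  have ap: "adjoint_pair ip S (adj ip S)" using S adjointable_iff by blast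
  have T: "selfadjoint ip T"
    unfolding T_def using adjoint_pair_comp[OF adjoint_pair_sym[OF ap] ap] .
  obtain \<Phi> where \<Phi>: "is_functional_calculus ip T \<Phi>" using functional_calculus_exists[OF T] by blast
  note fc = fc_one[OF T \<Phi>] fc_ident[OF T \<Phi>]
  define n where "n z = complex_of_real (max (- Re z) 0)" for z
  define r where "r z = complex_of_real (sqrt (max (- Re z) 0))" for z
  have cn: "continuous_on (spectrum ip T) n" unfolding n_def by (intro continuous_intros)
  have cr: "continuous_on (spectrum ip T) r" unfolding r_def by (intro continuous_intros)
  have ci: "continuous_on (spectrum ip T) (\<lambda>z. z)" by (intro continuous_intros)
  have M: "selfadjoint ip (\<Phi> n)" by (rule fc_selfadjoint[OF T \<Phi> cn]) (simp add: n_def)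
  have N: "selfadjoint ip (\<Phi> r)" by (rule fc_selfadjoint[OF T \<Phi> cr]) (simp add: r_def)
  have pR: "adjoint_pair ip (\<lambda>x. S (\<Phi> r x)) (\<lambda>x. \<Phi> r (adj ip S x))"
    by (rule adjoint_pair_comp[OF ap N])
  have eq: "r z * (z * r z) = (-1) * (n z * n z)" if z: "z \<in> spectrum ip T" for z
  proof -
    obtain a where a: "z = complex_of_real a"
      using spectrum_real[OF T z] by (metis complex_is_Real_iff Reals_cases)
    have "sqrt (max (- a) 0) * (a * sqrt (max (- a) 0)) = a * (sqrt (max (- a) 0))\<^sup>2"
      by (simp add: power2_eq_square)
    also have "\<dots> = (-1) * (max (- a) 0 * max (- a) 0)"
      by (cases "0 \<le> a") (simp_all add: max_def)
    finally show ?thesis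
      using arg_cong[of _ _ complex_of_real] by (simp add: a r_def n_def flip: of_real_mult of_real_minus)
  qed
  have "\<Phi> (\<lambda>z. r z * (z * r z)) = \<Phi> (\<lambda>z. (-1) * (n z * n z))"
    by (rule fc_cong[OF T \<Phi>]) (use eq in \<open>auto intro!: continuous_intros cr cn\<close>)
  moreover have "\<Phi> (\<lambda>z. r z * (z * r z)) x = \<Phi> r (T (\<Phi> r x))" for x
    using fc_mult[OF T \<Phi> cr, of "\<lambda>z. z * r z"] fc_mult[OF T \<Phi> ci cr] fc
    by (simp add: continuous_intros cr)
  moreover have "\<Phi> (\<lambda>z. (-1) * (n z * n z)) x = - \<Phi> n (\<Phi> n x)" for x
    using fc_scaleC[OF T \<Phi>, of "\<lambda>z. n z * n z" "-1" x] fc_mult[OF T \<Phi> cn cn]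
    by (simp add: continuous_intros cn)
  ultimately have "\<Phi> r (T (\<Phi> r x)) = - \<Phi> n (\<Phi> n x)" for x by metis
  then have "adj ip (\<lambda>x. S (\<Phi> r x)) (S (\<Phi> r x)) = - \<Phi> n (\<Phi> n x)" for x
    using adj_eqI[OF pR] by (simp add: T_def)
  then have "\<Phi> n x = 0" for x
    using proper[OF adjoint_pairD[OF pR] M] by blast
  then have "0 \<le> Re z" if "z \<in> spectrum ip T" for z
    using fc_nonneg_if_negative_part_0[OF T \<Phi> _ that] unfolding n_def by blast
  then show ?thesis using T by (simp add: nonneg_op_def T_def)
qed

text \<open>If \<open>S\<close> inverts \<open>A B - z\<close>, then \<open>(B S A - 1) / z\<close> inverts \<open>B A - z\<close>.\<close>

lemma spectrum_comp_commute:
  assumes A: "adjointable ip A" and B: "adjointable ip B" and z: "z \<noteq> 0"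
    and "z \<in> spectrum ip (\<lambda>x. B (A x))"
  shows "z \<in> spectrum ip (\<lambda>x. A (B x))"
proof (rule ccontr)
  assume "\<not> ?thesis"
  then obtain S where S: "adjointable ip S" "S \<circ> (\<lambda>x. A (B x) - z *\<^sub>C x) = id"
      "(\<lambda>x. A (B x) - z *\<^sub>C x) \<circ> S = id"
    unfolding not_in_spectrum_iff op_invertible_def by blast
  have S1: "S (A (B x) - z *\<^sub>C x) = x" and S2: "A (B (S x)) - z *\<^sub>C S x = x" for x
    using S(2,3) by (auto simp: fun_eq_iff)
  note bA = adjointable_imp_bounded_clinear[OF A] and bB = adjointable_imp_bounded_clinear[OF B]
    and bS = adjointable_imp_bounded_clinear[OF S(1)]
  define R where "R = (\<lambda>x. (1 / z) *\<^sub>C (B (S (A x)) - x))"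
  have "adjointable ip R"
    unfolding R_def using adjointable_comp[OF B adjointable_comp[OF S(1) A]]
    by (intro adjointable_scaleC adjointable_diff adjointable_id) (simp add: comp_def)
  moreover have "R (B (A x) - z *\<^sub>C x) = x" for x
  proof -
    have "S (A (B (A x) - z *\<^sub>C x)) = A x"
      using S1[of "A x"] by (simp add: bclin_diff[OF bA] bclin_scaleC[OF bA])
    then show ?thesis using z by (simp add: R_def scaleC_simps)
  qed
  moreover have "B (A (R x)) - z *\<^sub>C R x = x" for x
  proof -
    have "B (A (B (S (A x)))) - z *\<^sub>C B (S (A x)) = B (A x)"
      using S2[of "A x"] by (metis bclin_diff[OF bB] bclin_scaleC[OF bB])
    then have "(1 / z) *\<^sub>C (B (A (B (S (A x)))) - z *\<^sub>C B (S (A x))) = (1 / z) *\<^sub>C B (A x)" by simp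
    then have *: "(1 / z) *\<^sub>C B (A (B (S (A x)))) - B (S (A x)) = (1 / z) *\<^sub>C B (A x)"
      using z by (simp add: scaleC_diff_right scaleC_scaleC)
    have "(1 / z) *\<^sub>C B (A (B (S (A x)))) - (1 / z) *\<^sub>C B (A x) = B (S (A x))"
      by (simp flip: *)
    then show ?thesis using z
      by (simp add: R_def bclin_diff[OF bA] bclin_scaleC[OF bA] bclin_diff[OF bB] bclin_scaleC[OF bB]
          scaleC_simps)
  qed
  ultimately have "op_invertible ip (\<lambda>x. B (A x) - z *\<^sub>C x)"
    unfolding op_invertible_def by (intro exI[of _ R]) (auto simp: fun_eq_iff)
  then show False using assms(4) not_in_spectrum_iff by blast
qed

lemma spectrum_uminus:
  assumes "z \<in> spectrum ip T" shows "- z \<in> spectrum ip (\<lambda>x. - T x)"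
proof (rule ccontr)
  assume "\<not> ?thesis"
  then have "op_invertible ip (\<lambda>x. - T x - (- z) *\<^sub>C x)"
    using not_in_spectrum_iff[of "- z" ip "\<lambda>x. - T x"] by blast
  then have "op_invertible ip (\<lambda>x. - (- T x - (- z) *\<^sub>C x))"
    by (rule op_invertible_uminus)
  moreover have "(\<lambda>x. - (- T x - (- z) *\<^sub>C x)) = (\<lambda>x. T x - z *\<^sub>C x)"
    by (simp add: fun_eq_iff)
  ultimately show False using assms not_in_spectrum_iff by metis
qed

lemma zero_if_spectrum_0:
  assumes "selfadjoint ip T" "\<And>z. z \<in> spectrum ip T \<Longrightarrow> z = 0" shows "T x = 0"
  using selfadjoint_norm_bound_le[OF assms(1), of 0 x] assms(2) by auto

text \<open>With the sharp constant the calculus is contractive, and \<open>|t - z| \<le> t\<close> on a spectrum contained in \<open>[0, t]\<close>. The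
  converse \<open>nonneg_op_if_norm\<close> holds for every constant; together they make nonnegativity a norm condition.\<close>

lemma nonneg_op_norm:
  assumes K: "K = 1" and T: "nonneg_op T" and t: "0 \<le> t" "\<And>x. norm (T x) \<le> t * norm x"
  shows "norm (complex_of_real t *\<^sub>C x - T x) \<le> t * norm x"
proof -
  have sT: "selfadjoint ip T" using T nonneg_op_selfadjoint by blast
  obtain \<Phi> where \<Phi>: "is_functional_calculus ip T \<Phi>" using functional_calculus_exists[OF sT] by blast
  have "cmod (complex_of_real t - z) \<le> t" if z: "z \<in> spectrum ip T" for z
  proof -
    have "z = complex_of_real (Re z)" using spectrum_real[OF sT z] by (simp add: complex_eq_iff)
    moreover have "0 \<le> Re z" using T z by (auto simp: nonneg_op_def)
    moreover have "Re z \<le> t"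
      using spectrum_bound[OF sT t(2) t(1) z] complex_Re_le_cmod order_trans by blast
    ultimately show ?thesis by (metis abs_of_nonneg diff_ge_0_iff_ge diff_le_self norm_of_real
          of_real_diff le_add_same_cancel1 diff_le_eq)
  qed
  then have "norm (\<Phi> (\<lambda>z. complex_of_real t - z) x) \<le> sqrt K * t * norm x"
    by (intro fc_bound[OF sT \<Phi>] t(1)) (auto intro: continuous_intros)
  moreover have "\<Phi> (\<lambda>z. complex_of_real t * 1 - z) x = complex_of_real t *\<^sub>C x - T x"
    using fc_diff[OF sT \<Phi>, of "\<lambda>w. complex_of_real t * 1" "\<lambda>w. w" x]
      fc_scaleC[OF sT \<Phi>, of "\<lambda>z. 1" "complex_of_real t" x]
    by (simp add: fc_ident[OF sT \<Phi>] fc_one[OF sT \<Phi>] continuous_intros)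
  ultimately show ?thesis using K by simp
qed

lemma nonneg_op_if_norm:
  assumes sT: "selfadjoint ip T" and t: "0 \<le> t" "\<And>x. norm (complex_of_real t *\<^sub>C x - T x) \<le> t * norm x"
  shows "nonneg_op T"
proof -
  define S where "S = (\<lambda>x. complex_of_real t *\<^sub>C x - T x)"
  have S: "selfadjoint ip S"
    using adjoint_pair_diff[OF adjoint_pair_scaleC[OF adjoint_pair_id, of "complex_of_real t"] sT]
    by (simp add: S_def)
  have "0 \<le> Re z" if z: "z \<in> spectrum ip T" for z
  proof -
    have "complex_of_real t - z \<in> spectrum ip S"
    proof (rule ccontr)
      assume "\<not> ?thesis"
      then have "op_invertible ip (\<lambda>x. S x - (complex_of_real t - z) *\<^sub>C x)"
        using not_in_spectrum_iff by blast
      then have "op_invertible ip (\<lambda>x. - (S x - (complex_of_real t - z) *\<^sub>C x))"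
        by (rule op_invertible_uminus)
      moreover have "(\<lambda>x. - (S x - (complex_of_real t - z) *\<^sub>C x)) = (\<lambda>x. T x - z *\<^sub>C x)"
        by (simp add: fun_eq_iff S_def scaleC_simps)
      ultimately show False using z not_in_spectrum_iff by metis
    qed
    then have "cmod (complex_of_real t - z) \<le> t"
      using spectrum_bound[OF S _ t(1)] t(2) by (simp add: S_def)
    then show ?thesis using complex_Re_le_cmod[of "complex_of_real t - z"] by simp
  qed
  then show ?thesis using sT by (simp add: nonneg_op_def)
qed

text \<open>The norm conditions \<open>\<parallel>s - S\<parallel> \<le> s\<close> and \<open>\<parallel>t - T\<parallel> \<le> t\<close> add up by the triangle inequality. A constant other than 1
  would spoil this.\<close>

lemma nonneg_op_add:
  assumes K: "K = 1" and S: "nonneg_op S" and T: "nonneg_op T"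
  shows "nonneg_op (\<lambda>x. S x + T x)"
proof -
  note sS = nonneg_op_selfadjoint[OF S] and sT = nonneg_op_selfadjoint[OF T]
  obtain s where s: "s > 0" "\<And>x. norm (S x) \<le> s * norm x"
    using bclin_bound[OF selfadjoint_bclin[OF sS]] by blast
  obtain t where t: "t > 0" "\<And>x. norm (T x) \<le> t * norm x"
    using bclin_bound[OF selfadjoint_bclin[OF sT]] by blast
  have "norm (complex_of_real (s + t) *\<^sub>C x - (S x + T x)) \<le> (s + t) * norm x" for x
  proof -
    have "complex_of_real (s + t) *\<^sub>C x - (S x + T x)
        = (complex_of_real s *\<^sub>C x - S x) + (complex_of_real t *\<^sub>C x - T x)"
      by (simp add: scaleC_simps)
    also have "norm \<dots> \<le> s * norm x + t * norm x"
      using nonneg_op_norm[OF K S _ s(2), of x] nonneg_op_norm[OF K T _ t(2), of x] s(1) t(1)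
      by (intro norm_triangle_mono) auto
    finally show ?thesis by (simp add: distrib_right)
  qed
  then show ?thesis
    using s(1) t(1) by (intro nonneg_op_if_norm[where t="s + t"] adjoint_pair_add sS sT) auto
qed

text \<open>With \<open>A\<close> and \<open>B\<close> proportional to the real and imaginary parts of \<open>R\<close>, \<open>R R\<^sup>* = A\<^sup>2 + B\<^sup>2 - R\<^sup>* R = A\<^sup>2 + B\<^sup>2 + M\<^sup>2\<close> has nonnegative
  spectrum, and so has \<open>- R\<^sup>* R = M\<^sup>2\<close>. As \<open>R\<^sup>* R\<close> and \<open>R R\<^sup>*\<close> have the same nonzero spectrum, that of \<open>R\<^sup>* R\<close> is \<open>{0}\<close>.\<close>

lemma kelley_vaught:
  assumes K: "K = 1" and R: "adjointable ip R" and M: "selfadjoint ip M"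
    and RM: "\<And>x. adj ip R (R x) = - M (M x)"
  shows "M x = 0"
proof -
  define c where "c = complex_of_real (sqrt (1 / 2))"
  have cc: "c * c = 1 / 2"
    unfolding c_def of_real_mult[symmetric] real_sqrt_mult_self by simp
  have cnj_c: "cnj c = c" by (simp add: c_def)
  let ?R' = "adj ip R"
  have ap: "adjoint_pair ip R ?R'" using R adjointable_iff by blast
  note ap' = adjoint_pair_sym[OF ap]
  have R': "adjointable ip ?R'" using adjoint_pairD[OF ap'] .
  note bR = adjointable_imp_bounded_clinear[OF R] and bR' = adjointable_imp_bounded_clinear[OF R']
  define A where "A = (\<lambda>x. c *\<^sub>C (R x + ?R' x))"
  define B where "B = (\<lambda>x. (\<i> * c) *\<^sub>C (R x - ?R' x))"
  have A: "selfadjoint ip A"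
    using adjoint_pair_scaleC[OF adjoint_pair_add[OF ap ap'], of c]
    by (simp add: A_def cnj_c add.commute)
  have "adjoint_pair ip B (\<lambda>x. cnj (\<i> * c) *\<^sub>C (?R' x - R x))"
    unfolding B_def by (rule adjoint_pair_scaleC[OF adjoint_pair_diff[OF ap ap']])
  moreover have "cnj (\<i> * c) *\<^sub>C (?R' x - R x) = B x" for x
    by (simp add: B_def cnj_c scaleC_diff_right)
  ultimately have B: "selfadjoint ip B" by simp
  have half: "(1 / 2 :: complex) *\<^sub>C y + (1 / 2 :: complex) *\<^sub>C y = y" for y :: 'h
    by (simp flip: scaleC_add_left)
  have AB: "A (A x) + B (B x) = R (?R' x) + ?R' (R x)" for x
  proof -
    have "A (A x) = (c * c) *\<^sub>C (R (R x) + R (?R' x) + ?R' (R x) + ?R' (?R' x))"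
      by (simp add: A_def bclin_add[OF bR] bclin_add[OF bR'] bclin_scaleC[OF bR] bclin_scaleC[OF bR']
          scaleC_simps)
    moreover have "B (B x) = - ((c * c) *\<^sub>C (R (R x) - R (?R' x) - ?R' (R x) + ?R' (?R' x)))"
    proof -
      have "\<i> * c * (\<i> * c) = (\<i> * \<i>) * (c * c)" by (simp only: mult_ac)
      then have "\<i> * c * (\<i> * c) = - (c * c)" by simp
      then show ?thesis
        by (simp add: B_def bclin_diff[OF bR] bclin_diff[OF bR'] bclin_scaleC[OF bR]
            bclin_scaleC[OF bR'] scaleC_diff_right scaleC_add_right scaleC_scaleC del: mult_minus_left)
    qed
    moreover have "c * c = 1 / 2" by (rule cc)
    ultimately have "A (A x) + B (B x) = ((1/2) *\<^sub>C R (?R' x) + (1/2) *\<^sub>C R (?R' x))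
        + ((1/2) *\<^sub>C ?R' (R x) + (1/2) *\<^sub>C ?R' (R x))"
      by (simp add: scaleC_add_right scaleC_diff_right)
    then show ?thesis by (simp only: half)
  qed
  have "nonneg_op (\<lambda>x. (A (A x) + B (B x)) + M (M x))"
    by (intro nonneg_op_add[OF K] nonneg_op_square A B M)
  moreover have "(A (A x) + B (B x)) + M (M x) = R (?R' x)" for x
    unfolding AB RM by simp
  ultimately have pos: "nonneg_op (\<lambda>x. R (?R' x))" by simp
  have neg: "nonneg_op (\<lambda>x. - ?R' (R x))"
    using nonneg_op_square[OF M] by (simp add: RM)
  have "z = 0" if z: "z \<in> spectrum ip (\<lambda>x. ?R' (R x))" for z
  proof (rule ccontr)
    assume "z \<noteq> 0"
    then have "z \<in> spectrum ip (\<lambda>x. R (?R' x))" using spectrum_comp_commute[OF R R' _ z] by blast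
    then have "0 \<le> Re z" "Im z = 0"
      using pos spectrum_real unfolding nonneg_op_def by blast+
    moreover have "- z \<in> spectrum ip (\<lambda>x. - ?R' (R x))" by (rule spectrum_uminus[OF z])
    then have "0 \<le> Re (- z)" using neg unfolding nonneg_op_def by blast
    ultimately show False using \<open>z \<noteq> 0\<close> by (simp add: complex_eq_iff)
  qed
  then have "?R' (R x) = 0"
    using zero_if_spectrum_0[OF adjoint_pair_comp[OF ap' ap]] by blast
  then have "M (M x) = 0" using RM[of x] by simp
  then have "ip (M x) (M x) = 0" using ip_selfadjoint[OF M, of x "M x"] by simp
  then show ?thesis by simp
qed

end

section \<open>Sums of positive elements in a C*-algebra\<close>

lemma hilbert_module_cs_self:
  "hilbert_module_cs (\<lambda>x a. x * a) (\<lambda>x y. star x * (y::'a::cstar_algebra)) 1"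
proof
  fix x y z a b :: 'a and c :: complex
  show "positive_element (star x * x)" by (auto simp: positive_element_def)
  show "star x * x = 0 \<Longrightarrow> x = 0" by (rule star_mult_self_eq_0)
  show "norm x = sqrt (norm (star x * x))" by (simp add: cstar_identity)
  show "norm (star x * y) \<le> 1 * norm x * norm y" using norm_mult_ineq[of "star x" y] by simp
qed (auto simp: algebra_simps mult_scaleC_left mult_scaleC_right star_mult star_star)

text \<open>Properness of a C*-algebra. Multiplication by \<open>h = b\<^sup>* b\<close> is positive, and so is multiplication by
  \<open>- h = c\<^sup>* c\<close>; hence it is 0.\<close>

lemma sum_star_mult_self_eq_0:
  fixes b c :: "'a::cstar_algebra"
  assumes eq: "star b * b + star c * c = 0" shows "b = 0"
proof -
  interpret hilbert_module_cs "\<lambda>x a. x * a" "\<lambda>x y. star x * (y::'a)" 1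
    by (rule hilbert_module_cs_self)
  let ?ip = "\<lambda>x y. star x * (y::'a)"
  have ap: "adjoint_pair ?ip (\<lambda>x. a * x) (\<lambda>x. star a * x)" for a :: 'a
    by (simp add: adjoint_pair_def star_mult mult.assoc)
  have nonneg: "nonneg_op (\<lambda>x. star a * (a * x))" for a
  proof -
    have "nonneg_op (\<lambda>x. adj ?ip (\<lambda>x. a * x) (a * x))"
    proof (rule adjoint_square_nonneg_if_proper)
      fix R M and x :: 'a
      assume "adjointable ?ip R" "selfadjoint ?ip M" "\<And>x. adj ?ip R (R x) = - M (M x)"
      then show "M x = 0" by (rule kelley_vaught[OF refl])
    qed (rule adjoint_pairD[OF ap])
    then show ?thesis by (simp add: adj_eqI[OF ap])
  qed
  define h where "h = star b * b"
  have h: "star h = h" by (simp add: h_def star_mult star_star)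
  have c: "star c * c = - h" using eq by (simp add: h_def add_eq_0_iff)
  have 1: "nonneg_op (\<lambda>x. h * x)" using nonneg[of b] by (simp add: h_def mult.assoc)
  have 2: "nonneg_op (\<lambda>x. - (h * x))"
    using nonneg[of c] by (simp add: c flip: mult.assoc)
  have "z = 0" if z: "z \<in> spectrum ?ip (\<lambda>x. h * x)" for z
  proof -
    have "0 \<le> Re z" "Im z = 0" using 1 z spectrum_real unfolding nonneg_op_def by blast+
    moreover have "0 \<le> Re (- z)" using 2 spectrum_uminus[OF z] unfolding nonneg_op_def by blast
    ultimately show ?thesis by (simp add: complex_eq_iff)
  qed
  then have "h * h = 0" using zero_if_spectrum_0[of "\<lambda>x. h * x" h] 1 by (simp add: nonneg_op_def)
  then have "h = 0" using star_mult_self_eq_0[of h] h by simp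
  then show ?thesis using star_mult_self_eq_0[of b] by (simp add: h_def)
qed

context hilbert_module_cs
begin

lemma ip_sum_eq_0:
  assumes "ip x x + ip y y = 0" shows "x = 0"
proof -
  obtain b c where bc: "ip x x = star b * b" "ip y y = star c * c"
    using ip_positive unfolding positive_element_def by metis
  then have "b = 0" using assms sum_star_mult_self_eq_0 by metis
  then show ?thesis using bc by simp
qed

lemma nonneg_op_adjoint_square:
  assumes S: "adjointable ip S" shows "nonneg_op (\<lambda>x. adj ip S (S x))"
proof (rule adjoint_square_nonneg_if_proper[OF _ S])
  fix R M x assume R: "adjointable ip R" and M: "selfadjoint ip M"
    and eq: "\<And>x. adj ip R (R x) = - M (M x)"
  have "ip (R x) (R x) = ip x (adj ip R (R x))" by (rule ip_adj[OF R])
  also have "\<dots> = - ip (M x) (M x)" by (simp add: eq ip_selfadjoint[OF M])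
  finally show "M x = 0" using ip_sum_eq_0[of "M x" "R x"] by simp
qed

end

section \<open>Powers of operators with nonnegative spectrum\<close>

definition rpow :: "real \<Rightarrow> complex \<Rightarrow> complex" where
  "rpow \<alpha> = (\<lambda>z. complex_of_real (Re z powr \<alpha>))"

lemma continuous_on_rpow:
  assumes "\<And>z. z \<in> S \<Longrightarrow> 0 \<le> Re z" "0 < \<alpha>" shows "continuous_on S (rpow \<alpha>)"
  unfolding rpow_def using assms
  by (intro continuous_on_of_real continuous_on_powr' continuous_intros) auto

lemma eq_0_if_norm_le_eps:
  fixes v :: "'h::real_normed_vector"
  assumes "\<And>\<epsilon>. 0 < \<epsilon> \<Longrightarrow> norm v \<le> \<epsilon> * C" shows "v = 0"
proof -
  have "norm v \<le> 0"
  proof (rule field_le_epsilon)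
    fix e :: real assume e: "e > 0"
    have C: "\<bar>C\<bar> + 1 > 0" by linarith
    have "norm v \<le> e / (\<bar>C\<bar> + 1) * C" using e C by (intro assms) simp
    also have "\<dots> \<le> e / (\<bar>C\<bar> + 1) * (\<bar>C\<bar> + 1)" using e C by (intro mult_left_mono) auto
    also have "\<dots> = e" using C by simp
    finally show "norm v \<le> 0 + e" by simp
  qed
  then show ?thesis by simp
qed

lemma bclin_closure_range:
  assumes X: "bounded_clinear X" and y: "y \<in> closure (range F)"
  shows "X y \<in> closure (range (\<lambda>x. X (F x)))"
proof -
  obtain s where s: "\<And>n. s n \<in> range F" "s \<longlonglongrightarrow> y" using y closure_sequential by blast
  have "(\<lambda>n. X (s n)) \<longlonglongrightarrow> X y" by (rule bclin_tendsto[OF X s(2)])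
  moreover have "X (s n) \<in> range (\<lambda>x. X (F x))" for n using s(1)[of n] by auto
  ultimately show ?thesis
    unfolding closure_sequential by (intro exI[of _ "\<lambda>n. X (s n)"] conjI allI)
qed

lemma bclin_fixed_closure:
  assumes X: "bounded_clinear X" and fixed: "\<And>x. X (F x) = F x" and y: "y \<in> closure (range F)"
  shows "X y = y"
proof -
  obtain s where s: "\<And>n. s n \<in> range F" "s \<longlonglongrightarrow> y" using y closure_sequential by blast
  have "(\<lambda>n. X (s n)) \<longlonglongrightarrow> X y" by (rule bclin_tendsto[OF X s(2)])
  moreover have "X (s n) = s n" for n using s(1)[of n] fixed by auto
  ultimately show ?thesis using s(2) LIMSEQ_unique by simp
qed

context hilbert_module_cs
begin

lemma cfc_functional_calculus: "selfadjoint ip A \<Longrightarrow> is_functional_calculus ip A (cfc ip A)"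
  unfolding cfc_def using functional_calculus_exists by (rule someI_ex)

lemma op_powr_eq: "op_powr ip A \<alpha> = cfc ip A (rpow \<alpha>)"
  by (simp add: op_powr_def rpow_def)

text \<open>Approximation by polynomials in a function \<open>g\<close> rather than in the identity serves \<open>commutes_if_commutes_op_powr\<close>,
  where \<open>g\<close> is a power.\<close>

lemma fc_poly_close:
  assumes T: "selfadjoint ip T" and \<Phi>: "is_functional_calculus ip T \<Phi>"
    and f: "continuous_on (spectrum ip T) f" and g: "continuous_on (spectrum ip T) g"
    and close: "0 \<le> \<epsilon>" "\<And>z. z \<in> spectrum ip T \<Longrightarrow> cmod (poly p (g z) - f z) \<le> \<epsilon>"
  shows "norm (\<Phi> f x - op_poly p (\<Phi> g) x) \<le> sqrt K * \<epsilon> * norm x"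
proof -
  have c: "continuous_on (spectrum ip T) (\<lambda>z. poly p (g z))" by (intro continuous_intros g)
  have "norm (\<Phi> (\<lambda>z. f z - poly p (g z)) x) \<le> sqrt K * \<epsilon> * norm x"
    by (rule fc_bound[OF T \<Phi> _ close(1)])
      (use close(2) in \<open>auto intro!: continuous_intros f c simp: norm_minus_commute\<close>)
  then show ?thesis by (simp add: fc_diff[OF T \<Phi> f c] fc_compose_poly[OF T \<Phi> g])
qed

context
  fixes A assumes A: "nonneg_op A"
begin

private lemma fA: "is_functional_calculus ip A (cfc ip A)"
  using cfc_functional_calculus nonneg_op_selfadjoint[OF A] .

private lemma sA: "selfadjoint ip A"
  by (rule nonneg_op_selfadjoint[OF A])

private lemma cont: "0 < \<alpha> \<Longrightarrow> continuous_on (spectrum ip A) (rpow \<alpha>)"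
  using A by (intro continuous_on_rpow) (auto simp: nonneg_op_def)

lemma selfadjoint_op_powr: "0 < \<alpha> \<Longrightarrow> selfadjoint ip (op_powr ip A \<alpha>)"
  unfolding op_powr_eq by (rule fc_selfadjoint[OF sA fA cont]) (simp_all add: rpow_def)

lemma op_powr_add:
  assumes "0 < \<alpha>" "0 < \<beta>"
  shows "op_powr ip A (\<alpha> + \<beta>) x = op_powr ip A \<alpha> (op_powr ip A \<beta> x)"
proof -
  have "rpow (\<alpha> + \<beta>) = (\<lambda>z. rpow \<alpha> z * rpow \<beta> z)" by (simp add: rpow_def powr_add fun_eq_iff)
  then show ?thesis
    by (simp add: op_powr_eq fc_mult[OF sA fA cont[OF assms(1)] cont[OF assms(2)]])
qed

lemma op_powr_one: "op_powr ip A 1 = A"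
proof -
  have "cfc ip A (rpow 1) = cfc ip A (\<lambda>z. z)"
  proof (rule fc_cong[OF sA fA])
    fix z assume z: "z \<in> spectrum ip A"
    then have "0 \<le> Re z" using A by (simp add: nonneg_op_def)
    then show "rpow 1 z = z" using spectrum_real[OF sA z] by (simp add: rpow_def complex_eq_iff)
  qed (rule cont, simp)
  then show ?thesis by (simp add: op_powr_eq fc_ident[OF sA fA])
qed

lemma op_powr_half: "0 < \<alpha> \<Longrightarrow> op_powr ip A (\<alpha>/2) (op_powr ip A (\<alpha>/2) x) = op_powr ip A \<alpha> x"
  using op_powr_add[of "\<alpha>/2" "\<alpha>/2" x] by simp

lemma nonneg_op_powr: "0 < \<alpha> \<Longrightarrow> nonneg_op (op_powr ip A \<alpha>)"
  using nonneg_op_square[OF selfadjoint_op_powr[of "\<alpha>/2"]] by (simp add: op_powr_half)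

text \<open>On the spectrum the identity is a uniform limit of polynomials in \<open>z\<^sup>\<alpha>\<close>, so \<open>A\<close> is a limit of polynomials in \<open>A\<^sup>\<alpha>\<close>.\<close>

lemma commutes_if_commutes_op_powr:
  assumes \<alpha>: "0 < \<alpha>" and X: "bounded_clinear X"
    and comm: "\<And>x. X (op_powr ip A \<alpha> x) = op_powr ip A \<alpha> (X x)"
  shows "X (A x) = A (X x)"
proof -
  obtain M where M: "M > 0" "\<And>x. norm (X x) \<le> M * norm x" using bclin_bound[OF X] by blast
  have bP: "bounded_clinear (op_powr ip A \<alpha>)" by (rule selfadjoint_bclin[OF selfadjoint_op_powr[OF \<alpha>]])
  have "X (A x) - A (X x) = 0"
  proof (rule eq_0_if_norm_le_eps)
    fix \<epsilon> :: real assume \<epsilon>: "\<epsilon> > 0"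
    have S: "compact (rpow \<alpha> ` spectrum ip A)"
      by (rule compact_continuous_image[OF cont[OF \<alpha>] compact_spectrum[OF sA]])
    have "\<exists>p. \<forall>w\<in>rpow \<alpha> ` spectrum ip A. cmod (poly p w - rpow (1/\<alpha>) w) \<le> \<epsilon>"
      by (rule complex_poly_approx[OF S _ continuous_on_rpow \<epsilon>]) (use \<alpha> in \<open>auto simp: rpow_def\<close>)
    then obtain p where p: "\<And>z. z \<in> spectrum ip A \<Longrightarrow>
        cmod (poly p (rpow \<alpha> z) - rpow (1/\<alpha>) (rpow \<alpha> z)) \<le> \<epsilon>" by auto
    have "rpow (1/\<alpha>) (rpow \<alpha> z) = z" if z: "z \<in> spectrum ip A" for z
    proof -
      have "0 \<le> Re z" using A z by (simp add: nonneg_op_def)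
      then show ?thesis
        using spectrum_real[OF sA z] \<alpha> by (simp add: rpow_def complex_eq_iff powr_powr)
    qed
    then have close: "cmod (poly p (rpow \<alpha> z) - z) \<le> \<epsilon>" if "z \<in> spectrum ip A" for z
      using p[OF that] that by simp
    define q where "q = op_poly p (op_powr ip A \<alpha>)"
    have "norm (cfc ip A (\<lambda>z. z) y - op_poly p (cfc ip A (rpow \<alpha>)) y) \<le> sqrt K * \<epsilon> * norm y" for y
      using \<epsilon> by (intro fc_poly_close[OF sA fA continuous_on_id cont[OF \<alpha>] _ close]) simp_all
    then have d: "norm (A y - q y) \<le> sqrt K * \<epsilon> * norm y" for y
      by (simp add: q_def op_powr_eq fc_ident[OF sA fA])
    have "X (q x) = q (X x)" unfolding q_def using bP bP X by (rule op_poly_intertwine) (rule comm)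
    then have eq: "X (A x) - A (X x) = X (A x - q x) - (A (X x) - q (X x))"
      by (simp add: bclin_diff[OF X])
    have "norm (X (A x - q x)) \<le> M * (sqrt K * \<epsilon> * norm x)"
      by (rule order_trans[OF M(2) mult_left_mono[OF d less_imp_le[OF M(1)]]])
    then have "norm (X (A x) - A (X x)) \<le> M * (sqrt K * \<epsilon> * norm x) + sqrt K * \<epsilon> * norm (X x)"
      unfolding eq by (rule order_trans[OF norm_triangle_ineq4 add_mono[OF _ d]])
    then show "norm (X (A x) - A (X x)) \<le> \<epsilon> * (M * (sqrt K * norm x) + sqrt K * norm (X x))"
      by (simp add: algebra_simps)
  qed
  then show ?thesis by simp
qed

text \<open>The kernel is unchanged when the exponent is halved, as \<open>\<parallel>A\<^sup>g\<^sup>/\<^sup>2 x\<parallel>\<^sup>2 = \<parallel>\<langle>x, A\<^sup>g x\<rangle>\<parallel>\<close>, and can only grow with the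
  exponent.\<close>

lemma op_powr_kernel:
  assumes \<alpha>: "0 < \<alpha>" "0 < \<beta>" and x: "op_powr ip A \<alpha> x = 0"
  shows "op_powr ip A \<beta> x = 0"
proof -
  have half: "op_powr ip A (\<alpha> / 2 ^ k) x = 0" for k
  proof (induction k)
    case (Suc k)
    define g where "g = \<alpha> / 2 ^ k"
    have g: "0 < g" "0 < g/2" using \<alpha> by (auto simp: g_def)
    have "ip (op_powr ip A (g/2) x) (op_powr ip A (g/2) x) = ip x (op_powr ip A g x)"
      by (simp add: ip_selfadjoint[OF selfadjoint_op_powr[OF g(2)]] op_powr_half[OF g(1)])
    also have "\<dots> = 0" using Suc by (simp add: g_def)
    finally show ?case by (simp add: g_def mult.commute)
  qed (simp add: x)
  obtain k :: nat where "\<alpha> / \<beta> < 2 ^ k" using real_arch_pow[of 2 "\<alpha> / \<beta>"] by auto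
  then have k: "0 < \<beta> - \<alpha> / 2 ^ k" using \<alpha> by (simp add: field_simps)
  have "op_powr ip A \<beta> x = op_powr ip A (\<beta> - \<alpha> / 2 ^ k) (op_powr ip A (\<alpha> / 2 ^ k) x)"
    using op_powr_add[OF k, of "\<alpha> / 2 ^ k" x] \<alpha> by simp
  then show ?thesis using half bclin_zero[OF selfadjoint_bclin[OF selfadjoint_op_powr[OF k]]] by simp
qed

text \<open>Regularization: with \<open>C = A\<^sup>\<alpha>\<close>, the vectors \<open>C\<^sup>2 (C + d)\<^sup>-\<^sup>1 x\<close> lie in the range of \<open>C\<^sup>2\<close> and differ from \<open>C x\<close> by
  \<open>d C (C + d)\<^sup>-\<^sup>1 x\<close>, which is small with \<open>d\<close>.\<close>

lemma op_powr_range_double: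
  assumes \<alpha>: "0 < \<alpha>" shows "op_powr ip A \<alpha> x \<in> closure (range (op_powr ip A (2 * \<alpha>)))"
proof -
  have "\<exists>y\<in>range (op_powr ip A (2 * \<alpha>)). dist y (op_powr ip A \<alpha> x) < e" if e: "0 < e" for e
  proof -
    \<comment> \<open>The summand 1 only avoids a division by 0.\<close>
    define d where "d = e / (sqrt K * norm x + 1)"
    have n: "0 < sqrt K * norm x + 1" using K_ge_1 by (simp add: add_nonneg_pos)
    have d: "0 < d" using e n by (simp add: d_def)
    define h where "h z = complex_of_real (1 / (Re z powr \<alpha> + d))" for z
    have ge: "0 < Re z powr \<alpha> + d" for z using d by (simp add: add_nonneg_pos)
    then have ne: "Re z powr \<alpha> + d \<noteq> 0" for z by (rule less_imp_neq[symmetric])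
    have ch: "continuous_on (spectrum ip A) h"
    proof -
      have "continuous_on (spectrum ip A) (\<lambda>z. Re z powr \<alpha>)"
        using continuous_on_Re[OF cont[OF \<alpha>]] by (simp add: rpow_def)
      then show ?thesis unfolding h_def
        by (intro continuous_on_of_real continuous_on_divide continuous_on_add continuous_on_const)
          (assumption, intro ballI ne)
    qed
    have c2: "continuous_on (spectrum ip A) (rpow (2 * \<alpha>))" using \<alpha> by (intro cont) simp
    have c2h: "continuous_on (spectrum ip A) (\<lambda>z. rpow (2 * \<alpha>) z * h z)"
      by (intro continuous_intros c2 ch)
    have "norm (cfc ip A (\<lambda>z. rpow \<alpha> z - rpow (2 * \<alpha>) z * h z) x) \<le> sqrt K * d * norm x"
    proof (rule fc_bound[OF sA fA])
      fix z
      define t where "t = Re z powr \<alpha>"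
      have t: "0 \<le> t" "Re z powr (2 * \<alpha>) = t * t" by (auto simp: t_def simp flip: powr_add)
      have bnd: "\<bar>d * q\<bar> \<le> d" if "0 \<le> q" "q \<le> 1" for q
        using d that by (simp add: abs_mult mult_left_le)
      have "rpow \<alpha> z - rpow (2 * \<alpha>) z * h z = complex_of_real (t - t * t * (1 / (t + d)))"
        by (simp add: rpow_def h_def t flip: t_def)
      moreover have "t - t * t * (1 / (t + d)) = d * (t / (t + d))"
        using t d by (simp add: field_simps)
      moreover have "\<bar>d * (t / (t + d))\<bar> \<le> d" by (rule bnd) (use t d in auto)
      ultimately show "cmod (rpow \<alpha> z - rpow (2 * \<alpha>) z * h z) \<le> d" by (simp only: norm_of_real)
    qed (use d in \<open>auto intro!: continuous_intros c2h cont[OF \<alpha>]\<close>)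
    also have "sqrt K * d * norm x < e"
    proof -
      have "sqrt K * norm x * d < (sqrt K * norm x + 1) * d" using d by simp
      also have "\<dots> = e" using n by (simp add: d_def)
      finally show ?thesis by (simp add: mult_ac)
    qed
    finally have "norm (op_powr ip A \<alpha> x - op_powr ip A (2 * \<alpha>) (cfc ip A h x)) < e"
      by (simp add: fc_diff[OF sA fA cont[OF \<alpha>] c2h] fc_mult[OF sA fA c2 ch] op_powr_eq)
    then show ?thesis by (auto simp: dist_norm norm_minus_commute)
  qed
  then show ?thesis by (simp add: closure_approachable)
qed

lemma op_powr_range_subset:
  assumes \<alpha>: "0 < \<alpha>" "0 < \<beta>" shows "range (op_powr ip A \<alpha>) \<subseteq> closure (range (op_powr ip A \<beta>))"
proof -
  have dbl: "range (op_powr ip A \<alpha>) \<subseteq> closure (range (op_powr ip A (2 ^ k * \<alpha>)))" for k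
  proof (induction k)
    case 0
    then show ?case by (simp add: closure_subset)
  next
    case (Suc k)
    have "range (op_powr ip A (2 ^ k * \<alpha>)) \<subseteq> closure (range (op_powr ip A (2 ^ Suc k * \<alpha>)))"
      using op_powr_range_double[of "2 ^ k * \<alpha>"] \<alpha> by (auto simp: mult_ac)
    then have "closure (range (op_powr ip A (2 ^ k * \<alpha>)))
        \<subseteq> closure (range (op_powr ip A (2 ^ Suc k * \<alpha>)))"
      by (rule closure_minimal) simp
    then show ?case using Suc by blast
  qed
  obtain k :: nat where "\<beta> / \<alpha> < 2 ^ k" using real_arch_pow[of 2 "\<beta> / \<alpha>"] by auto
  then have k: "0 < 2 ^ k * \<alpha> - \<beta>" using \<alpha> by (simp add: field_simps)
  have "op_powr ip A (2 ^ k * \<alpha>) x = op_powr ip A \<beta> (op_powr ip A (2 ^ k * \<alpha> - \<beta>) x)" for x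
    using op_powr_add[OF \<alpha>(2) k, of x] by simp
  then have "range (op_powr ip A (2 ^ k * \<alpha>)) \<subseteq> range (op_powr ip A \<beta>)" by auto
  then show ?thesis using dbl[of k] closure_mono by blast
qed

end

text \<open>The relation passes to polynomials and then to uniform limits. One polynomial has to approximate the power
  on both spectra.\<close>

lemma op_powr_intertwine:
  assumes A: "nonneg_op A" and B: "nonneg_op B" and X: "bounded_clinear X"
    and comm: "\<And>x. X (A x) = B (X x)" and \<alpha>: "0 < \<alpha>"
  shows "X (op_powr ip A \<alpha> x) = op_powr ip B \<alpha> (X x)"
proof -
  note sA = nonneg_op_selfadjoint[OF A] and sB = nonneg_op_selfadjoint[OF B]
  note fA = cfc_functional_calculus[OF sA] and fB = cfc_functional_calculus[OF sB]
  let ?S = "spectrum ip A \<union> spectrum ip B"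
  have re: "0 \<le> Re z" if "z \<in> ?S" for z using A B that by (auto simp: nonneg_op_def)
  have c: "continuous_on ?S (rpow \<alpha>)" using re \<alpha> by (rule continuous_on_rpow)
  have cA: "continuous_on (spectrum ip A) (rpow \<alpha>)" and cB: "continuous_on (spectrum ip B) (rpow \<alpha>)"
    using c continuous_on_subset by blast+
  obtain M where M: "M > 0" "\<And>x. norm (X x) \<le> M * norm x" using bclin_bound[OF X] by blast
  have "X (op_powr ip A \<alpha> x) - op_powr ip B \<alpha> (X x) = 0"
  proof (rule eq_0_if_norm_le_eps)
    fix \<epsilon> :: real assume \<epsilon>: "\<epsilon> > 0"
    have "compact ?S" using compact_spectrum[OF sA] compact_spectrum[OF sB] by (rule compact_Un)
    then obtain p where p: "\<And>z. z \<in> ?S \<Longrightarrow> cmod (poly p z - rpow \<alpha> z) \<le> \<epsilon>"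
      using complex_poly_approx[OF _ _ c \<epsilon>] spectrum_real[OF sA] spectrum_real[OF sB] by blast
    have "norm (cfc ip A (rpow \<alpha>) y - op_poly p (cfc ip A (\<lambda>z. z)) y) \<le> sqrt K * \<epsilon> * norm y" for y
      using \<epsilon> p by (intro fc_poly_close[OF sA fA cA continuous_on_id]) simp_all
    then have dA: "norm (op_powr ip A \<alpha> y - op_poly p A y) \<le> sqrt K * \<epsilon> * norm y" for y
      by (simp add: op_powr_eq fc_ident[OF sA fA])
    have "norm (cfc ip B (rpow \<alpha>) y - op_poly p (cfc ip B (\<lambda>z. z)) y) \<le> sqrt K * \<epsilon> * norm y" for y
      using \<epsilon> p by (intro fc_poly_close[OF sB fB cB continuous_on_id]) simp_all
    then have dB: "norm (op_powr ip B \<alpha> y - op_poly p B y) \<le> sqrt K * \<epsilon> * norm y" for y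
      by (simp add: op_powr_eq fc_ident[OF sB fB])
    have "X (op_poly p A x) = op_poly p B (X x)"
      using selfadjoint_bclin[OF sA] selfadjoint_bclin[OF sB] X
      by (rule op_poly_intertwine) (rule comm)
    then have eq: "X (op_powr ip A \<alpha> x) - op_powr ip B \<alpha> (X x)
        = X (op_powr ip A \<alpha> x - op_poly p A x) - (op_powr ip B \<alpha> (X x) - op_poly p B (X x))"
      by (simp add: bclin_diff[OF X])
    have "norm (X (op_powr ip A \<alpha> x - op_poly p A x)) \<le> M * (sqrt K * \<epsilon> * norm x)"
      by (rule order_trans[OF M(2) mult_left_mono[OF dA less_imp_le[OF M(1)]]])
    then have "norm (X (op_powr ip A \<alpha> x) - op_powr ip B \<alpha> (X x))
        \<le> M * (sqrt K * \<epsilon> * norm x) + sqrt K * \<epsilon> * norm (X x)"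
      unfolding eq by (rule order_trans[OF norm_triangle_ineq4 add_mono[OF _ dB]])
    then show "norm (X (op_powr ip A \<alpha> x) - op_powr ip B \<alpha> (X x))
        \<le> \<epsilon> * (M * (sqrt K * norm x) + sqrt K * norm (X x))"
      by (simp add: algebra_simps)
  qed
  then show ?thesis by simp
qed

section \<open>Uniqueness of the positive square root\<close>

text \<open>Let \<open>R\<close> be the root from the calculus, which commutes with \<open>C\<close>, and \<open>y = C x - R x\<close>. Then \<open>(C + R) y = C\<^sup>2 x - R\<^sup>2 x = 0\<close>, and
  the sum of the positive elements \<open>\<langle>y, C y\<rangle>\<close> and \<open>\<langle>y, R y\<rangle>\<close> is 0. By properness \<open>C y = R y = 0\<close>, and then \<open>y = 0\<close>.\<close>

lemma op_sqrt_unique: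
  assumes G: "adjointable ip G" and C: "\<And>x. C x = adj ip G (G x)"
    and D: "nonneg_op D" and CC: "\<And>x. C (C x) = D x"
  shows "op_powr ip D (1/2) = C"
proof
  fix x
  define R where "R = op_powr ip D (1/2)"
  define H where "H = op_powr ip D (1/4)"
  have R: "selfadjoint ip R" and H: "selfadjoint ip H"
    by (simp_all add: R_def H_def selfadjoint_op_powr[OF D])
  have HH: "H (H y) = R y" and RR: "R (R y) = D y" for y
    using op_powr_half[OF D, of "1/2" y] op_powr_half[OF D, of 1 y]
    by (simp_all add: R_def H_def op_powr_one[OF D])
  have ap: "adjoint_pair ip G (adj ip G)" using G adjointable_iff by blast
  have sC: "selfadjoint ip C"
    using adjoint_pair_comp[OF adjoint_pair_sym[OF ap] ap] C by (simp add: adjoint_pair_def)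
  note bC = selfadjoint_bclin[OF sC] and bR = selfadjoint_bclin[OF R]
  have "C (D y) = D (C y)" for y by (simp flip: CC)
  then have CR: "C (R y) = R (C y)" for y
    unfolding R_def by (intro op_powr_intertwine[OF D D bC]) auto
  define y where "y = C x - R x"
  have "C y + R y = 0"
    by (simp add: y_def bclin_diff[OF bC] bclin_diff[OF bR] CR CC RR)
  moreover have "ip (G y) (G y) = ip y (C y)" by (simp add: C ip_adj[OF G])
  moreover have "ip (H y) (H y) = ip y (R y)" by (simp add: ip_selfadjoint[OF H] HH)
  ultimately have sum: "ip (G y) (G y) + ip (H y) (H y) = 0" by (simp flip: ip_add_right)
  have "G y = 0" by (rule ip_sum_eq_0[OF sum])
  then have "C y = 0" by (simp add: C bclin_zero[OF adjointable_imp_bounded_clinear[OF adjointable_adj[OF G]]])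
  moreover have "H y = 0" using sum by (intro ip_sum_eq_0[of "H y" "G y"]) (simp add: add.commute)
  then have "R y = 0" using HH[of y] bclin_zero[OF selfadjoint_bclin[OF H]] by simp
  moreover have "ip (C x - R x) y = ip x (C y - R y)"
    by (simp add: ip_diff_left ip_diff_right ip_selfadjoint[OF sC] ip_selfadjoint[OF R])
  then have "ip y y = ip x (C y - R y)" by (simp add: y_def)
  ultimately have "y = 0" by simp
  then show "op_powr ip D (1/2) x = C x" by (simp add: y_def R_def)
qed

lemma op_abs_eqI:
  assumes T: "adjointable ip T" and G: "adjointable ip G" and C: "\<And>x. C x = adj ip G (G x)"
    and CC: "\<And>x. C (C x) = adj ip T (T x)"
  shows "op_abs ip T = C"
  using op_sqrt_unique[OF G C nonneg_op_adjoint_square[OF T] CC] by (simp add: op_abs_def comp_def)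

lemma nonneg_op_abs: "adjointable ip T \<Longrightarrow> nonneg_op (op_abs ip T)"
  using nonneg_op_powr[OF nonneg_op_adjoint_square] by (simp add: op_abs_def comp_def)

lemma op_abs_square: "adjointable ip T \<Longrightarrow> op_abs ip T (op_abs ip T x) = adj ip T (T x)"
  using op_powr_half[OF nonneg_op_adjoint_square, of T 1 x] op_powr_one[OF nonneg_op_adjoint_square, of T]
  by (simp add: op_abs_def comp_def)

section \<open>Projections and polar decompositions\<close>

lemma adjointable_act:
  assumes "adjointable ip T" shows "T (act x a) = act (T x) a"
proof (rule ip_eqI_right)
  fix z
  show "ip z (T (act x a)) = ip z (act (T x) a)"
    using ip_adj'[OF assms, symmetric] by (simp add: ip_act_right)
qed

text \<open>Take adjoints in \<open>E N E = N E\<close>.\<close>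

lemma selfadjoint_commute_if_invariant:
  assumes E: "selfadjoint ip E" and N: "selfadjoint ip N" and inv: "\<And>x. E (N (E x)) = N (E x)"
  shows "E (N x) = N (E x)"
proof -
  have "E (N (E x)) = E (N x)"
  proof (rule ip_eqI_right)
    fix z
    have "ip z (E (N (E x))) = ip (E (N (E z))) x"
      by (simp add: ip_selfadjoint[OF E] ip_selfadjoint[OF N])
    also have "\<dots> = ip (N (E z)) x" by (simp only: inv)
    also have "\<dots> = ip z (E (N x))"
      by (simp add: ip_selfadjoint[OF E] ip_selfadjoint[OF N])
    finally show "ip z (E (N (E x))) = ip z (E (N x))" .
  qed
  then show ?thesis by (simp add: inv)
qed

lemma projection_pythagoras:
  assumes E: "selfadjoint ip E" "\<And>x. E (E x) = E x"
  shows "ip x x = ip (E x) (E x) + ip (x - E x) (x - E x)"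
proof -
  have "ip (E x) x = ip (E x) (E x)" "ip x (E x) = ip (E x) (E x)"
    using ip_selfadjoint[OF E(1)] E(2) by metis+
  then show ?thesis by (simp add: ip_simps)
qed

text \<open>For a projection \<open>E\<close>, the range is automatically complemented and \<open>E\<close> is the projection onto it. The conditions on
  the initial projection of a polar decomposition therefore reduce to an equality of ranges;
  \<open>polar_decompositionD\<close> is the converse.\<close>

lemma polar_decompositionI:
  assumes S: "adjointable ip S" and W: "adjointable ip W"
    and idem: "\<And>x. adj ip W (W (adj ip W (W x))) = adj ip W (W x)"
    and eq: "S = W \<circ> op_abs ip S"
    and ran: "closure (range (adj ip S)) = range (\<lambda>x. adj ip W (W x))"
  shows "polar_decomposition act ip S W"
proof -
  define E where "E = (\<lambda>x. adj ip W (W x))"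
  have comp: "adj ip W \<circ> W = E" by (simp add: E_def fun_eq_iff)
  have ap: "adjoint_pair ip W (adj ip W)" using W adjointable_iff by blast
  have E: "selfadjoint ip E"
    unfolding E_def by (rule adjoint_pair_comp[OF adjoint_pair_sym[OF ap] ap])
  have EE: "E (E x) = E x" for x using idem by (simp add: E_def)
  note aE = adjoint_pairD[OF E] and bE = selfadjoint_bclin[OF E]
  have ran: "closure (range (adj ip S)) = range E" using ran by (simp add: E_def)
  have orth: "x - E x \<in> orth ip (range E)" for x
    using EE by (auto simp: orth_def ip_diff_left ip_selfadjoint[OF E])
  have zero: "y = 0" if "y \<in> range E" "y \<in> orth ip (range E)" for y
  proof -
    have "ip y y = 0" using that unfolding orth_def by blast
    then show ?thesis by simp
  qed
  have "closed (range E)" using ran closed_closure by metis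
  then have sub: "closed_submodule act (range E)"
    unfolding closed_submodule_def
    by (auto simp flip: bclin_add[OF bE] bclin_scaleC[OF bE] adjointable_act[OF aE])
      (metis bclin_zero[OF bE] rangeI)
  have compl: "orth_complemented act ip (range E)"
    unfolding orth_complemented_def
  proof (intro conjI allI sub)
    have "0 \<in> range E" using sub by (simp add: closed_submodule_def)
    then show "range E \<inter> orth ip (range E) = {0}" using zero by (auto simp: orth_def)
    show "\<exists>y\<in>range E. \<exists>z\<in>orth ip (range E). x = y + z" for x
      using orth[of x] by (intro bexI[of _ "E x"] bexI[of _ "x - E x"]) auto
  qed
  have "proj_onto ip (range E) x = E x" for x
    unfolding proj_onto_def
  proof (rule the_equality)
    fix y assume y: "y \<in> range E \<and> x - y \<in> orth ip (range E)"
    then have "y - E x \<in> range E" using EE by (auto simp flip: bclin_diff[OF bE])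
    moreover have "y - E x \<in> orth ip (range E)"
      using y orth[of x] by (auto simp: orth_def ip_diff_left)
    ultimately show "y = E x" using zero by fastforce
  qed (simp add: orth)
  then have proj: "E = proj_onto ip (range E)" by (simp add: fun_eq_iff)
  have "partial_isometry ip W"
    using W adj_eqI[OF E] aE EE by (simp add: partial_isometry_def projection_def comp fun_eq_iff)
  then show ?thesis
    unfolding polar_decomposition_def comp ran using eq compl proj by blast
qed

lemma polar_decompositionD:
  assumes "polar_decomposition act ip S W"
  shows "adjointable ip W" "S x = W (op_abs ip S x)"
    "adj ip W (W (adj ip W (W x))) = adj ip W (W x)"
    "closure (range (adj ip S)) = range (\<lambda>x. adj ip W (W x))"
proof -
  define M where "M = closure (range (adj ip S))"
  have pW: "partial_isometry ip W" and S: "S = W \<circ> op_abs ip S"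
    and oc: "orth_complemented act ip M" and E: "adj ip W \<circ> W = proj_onto ip M"
    using assms by (auto simp: polar_decomposition_def M_def)
  show "adjointable ip W" using pW by (simp add: partial_isometry_def)
  show "S x = W (op_abs ip S x)" using S by (metis comp_apply)
  have "(adj ip W \<circ> W) \<circ> (adj ip W \<circ> W) = adj ip W \<circ> W"
    using pW by (simp add: partial_isometry_def projection_def)
  then show "adj ip W (W (adj ip W (W x))) = adj ip W (W x)" by (metis comp_apply)
  have diff: "y - y' \<in> M" if "y \<in> M" "y' \<in> M" for y y'
  proof -
    have "y + (-1) *\<^sub>C y' \<in> M"
      using oc that unfolding orth_complemented_def closed_submodule_def by blast
    then show ?thesis by simp
  qed
  have proj: "proj_onto ip M x = y" if y: "y \<in> M" "x - y \<in> orth ip M" for x y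
    unfolding proj_onto_def
  proof (rule the_equality)
    fix y' assume y': "y' \<in> M \<and> x - y' \<in> orth ip M"
    have "y' - y \<in> M" using diff y y' by blast
    moreover have "y' - y \<in> orth ip M"
      using y(2) y' by (auto simp: orth_def ip_diff_left)
    ultimately have "y' - y = 0" using oc unfolding orth_complemented_def by blast
    then show "y' = y" by simp
  qed (use y in simp)
  have "range (proj_onto ip M) = M"
  proof
    show "range (proj_onto ip M) \<subseteq> M"
    proof clarify
      fix x
      obtain y z where "y \<in> M" "z \<in> orth ip M" "x = y + z"
        using oc unfolding orth_complemented_def by blast
      then show "proj_onto ip M x \<in> M" using proj[of y x] by simp
    qed
    show "M \<subseteq> range (proj_onto ip M)"
    proof
      fix y assume y: "y \<in> M"
      have "proj_onto ip M y = y" by (rule proj[OF y]) (simp add: orth_def)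
      then show "y \<in> range (proj_onto ip M)" by (metis rangeI)
    qed
  qed
  then show "closure (range (adj ip S)) = range (\<lambda>x. adj ip W (W x))"
    using E unfolding M_def comp_def by metis
qed

end

section \<open>Polar decomposition and binormality\<close>

locale polar_decomposed = hilbert_module_cs act ip K
  for act :: "'h::complex_banach \<Rightarrow> 'a::cstar_algebra \<Rightarrow> 'h" and ip :: "'h \<Rightarrow> 'h \<Rightarrow> 'a" and K +
  fixes T U :: "'h \<Rightarrow> 'h"
  assumes T: "adjointable ip T" and polar: "polar_decomposition act ip T U"
begin

definition Us :: "'h \<Rightarrow> 'h" where "Us = adj ip U"
definition P :: "real \<Rightarrow> 'h \<Rightarrow> 'h" where "P \<alpha> = op_powr ip (op_abs ip T) \<alpha>"
definition B :: "real \<Rightarrow> 'h \<Rightarrow> 'h" where "B \<alpha> = op_powr ip (op_abs ip (adj ip T)) \<alpha>"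
definition Q :: "'h \<Rightarrow> 'h" where "Q x = Us (U x)"
definition E :: "'h \<Rightarrow> 'h" where "E x = U (Us x)"

lemmas nonneg_abs = nonneg_op_abs[OF T]
lemmas nonneg_abs_adj = nonneg_op_abs[OF adjointable_adj[OF T]]

lemma U: "adjointable ip U"
  by (rule polar_decompositionD(1)[OF polar])

lemma U_pair: "adjoint_pair ip U Us"
  using U adjointable_iff by (simp add: Us_def)

lemmas Us_pair = adjoint_pair_sym[OF U_pair]

lemma bU: "bounded_clinear U" and bUs: "bounded_clinear Us"
  using adjoint_pairD[OF U_pair] adjoint_pairD[OF Us_pair] adjointable_imp_bounded_clinear by blast+

lemma selfadjoint_P: "0 < \<alpha> \<Longrightarrow> selfadjoint ip (P \<alpha>)"
  and selfadjoint_B: "0 < \<alpha> \<Longrightarrow> selfadjoint ip (B \<alpha>)"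
  unfolding P_def B_def by (rule selfadjoint_op_powr[OF nonneg_abs] selfadjoint_op_powr[OF nonneg_abs_adj]; assumption)+

lemma P_one: "P 1 = op_abs ip T" and B_one: "B 1 = op_abs ip (adj ip T)"
  by (simp_all add: P_def B_def op_powr_one nonneg_abs nonneg_abs_adj)

lemma bP: "0 < \<alpha> \<Longrightarrow> bounded_clinear (P \<alpha>)" and bB: "0 < \<alpha> \<Longrightarrow> bounded_clinear (B \<alpha>)"
  by (simp_all add: selfadjoint_P selfadjoint_B selfadjoint_bclin)

lemma P_half: "0 < \<alpha> \<Longrightarrow> P (\<alpha>/2) (P (\<alpha>/2) x) = P \<alpha> x"
  and B_half: "0 < \<alpha> \<Longrightarrow> B (\<alpha>/2) (B (\<alpha>/2) x) = B \<alpha> x"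
  by (simp_all add: P_def B_def op_powr_half nonneg_abs nonneg_abs_adj)

lemma Q_sa: "selfadjoint ip Q"
  unfolding Q_def[abs_def] by (rule adjoint_pair_comp[OF Us_pair U_pair])

lemma E_sa: "selfadjoint ip E"
  unfolding E_def[abs_def] by (rule adjoint_pair_comp[OF U_pair Us_pair])

lemmas bQ = selfadjoint_bclin[OF Q_sa]
lemmas bE = selfadjoint_bclin[OF E_sa]

lemma Q_idem: "Q (Q x) = Q x"
  using polar_decompositionD(3)[OF polar] by (simp add: Q_def Us_def)

lemma UQ: "U (Q x) = U x"
proof -
  have "ip (U (x - Q x)) (U (x - Q x)) = ip (x - Q x) (Q (x - Q x))"
    using U_pair by (simp add: adjoint_pair_def Q_def)
  also have "\<dots> = 0" by (simp add: bclin_diff[OF bQ] Q_idem)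
  finally have "U (x - Q x) = 0" by simp
  then show ?thesis by (simp add: bclin_diff[OF bU])
qed

lemma QUs: "Q (Us x) = Us x"
proof (rule ip_eqI_right)
  fix z
  have "ip z (Q (Us x)) = ip (U (Q z)) x"
    using U_pair by (simp add: adjoint_pair_def flip: ip_selfadjoint[OF Q_sa])
  also have "\<dots> = ip z (Us x)" using U_pair by (simp add: UQ adjoint_pair_def)
  finally show "ip z (Q (Us x)) = ip z (Us x)" .
qed

lemma EU: "E (U x) = U x" and UsE: "Us (E x) = Us x"
  using UQ QUs by (simp_all add: E_def Q_def)

lemma range_Q: "range Q = closure (range (adj ip T))"
  using polar_decompositionD(4)[OF polar] by (simp add: Q_def[abs_def] Us_def)

lemma T_eq: "T x = U (P 1 x)"
  unfolding P_one by (rule polar_decompositionD(2)[OF polar])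

lemma adj_T_eq: "adj ip T x = P 1 (Us x)"
proof -
  have "adjoint_pair ip T (\<lambda>x. P 1 (Us x))"
    using adjoint_pair_comp[OF U_pair selfadjoint_P[of 1]] by (simp flip: T_eq)
  then show ?thesis by (simp add: adj_eqI)
qed

lemma Q_adj_T: "Q (adj ip T x) = adj ip T x"
proof -
  have "adj ip T x \<in> closure (range (adj ip T))" by (rule subsetD[OF closure_subset rangeI])
  then obtain y where "adj ip T x = Q y" unfolding range_Q[symmetric] by blast
  then show ?thesis by (simp add: Q_idem)
qed

lemma P_sq: "P 1 (P 1 x) = adj ip T (T x)" and B_sq: "B 1 (B 1 x) = T (adj ip T x)"
  by (simp_all add: P_one B_one op_abs_square T adjointable_adj adj_adj)

text \<open>The kernel of \<open>P 1\<close> is that of \<open>T\<close>, which is the orthogonal complement of the range of \<open>Q\<close>; powers have the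
  same kernel.\<close>

lemma P_Q:
  assumes \<alpha>: "0 < \<alpha>" shows "P \<alpha> (Q x) = P \<alpha> x"
proof -
  define u where "u = x - Q x"
  have "ip (P 1 u) (P 1 u) = ip u (adj ip T (T u))"
    by (simp add: ip_selfadjoint[OF selfadjoint_P] P_sq)
  also have "\<dots> = ip (Q u) (adj ip T (T u))"
    using Q_adj_T[of "T u"] ip_selfadjoint[OF Q_sa] by metis
  also have "Q u = 0" by (simp add: u_def bclin_diff[OF bQ] Q_idem)
  finally have "op_powr ip (op_abs ip T) 1 u = 0" by (simp add: P_def)
  then have "P \<alpha> u = 0" unfolding P_def by (rule op_powr_kernel[OF nonneg_abs zero_less_one \<alpha>])
  then show ?thesis by (simp add: u_def bclin_diff[OF bP[OF \<alpha>]])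
qed

lemma Q_P: "0 < \<alpha> \<Longrightarrow> Q (P \<alpha> x) = P \<alpha> x"
  by (rule ip_eqI_right) (simp add: P_Q flip: ip_selfadjoint[OF Q_sa] ip_selfadjoint[OF selfadjoint_P])

text \<open>The square of \<open>U |T| U\<^sup>*\<close> is \<open>U |T| Q |T| U\<^sup>* = T T\<^sup>*\<close>, and it is of the form \<open>G\<^sup>* G\<close> with \<open>G = |T|\<^sup>1\<^sup>/\<^sup>2 U\<^sup>*\<close>.\<close>

lemma abs_adj_eq: "B 1 x = U (P 1 (Us x))"
proof -
  have half: "0 < (1/2::real)" by simp
  have G: "adjoint_pair ip (\<lambda>x. P (1/2) (Us x)) (\<lambda>x. U (P (1/2) x))"
    by (rule adjoint_pair_comp[OF selfadjoint_P[OF half] Us_pair])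
  have "op_abs ip (adj ip T) = (\<lambda>x. U (P 1 (Us x)))"
  proof (rule op_abs_eqI[OF adjointable_adj[OF T] adjoint_pairD[OF G]])
    show "U (P 1 (Us x)) = adj ip (\<lambda>x. P (1/2) (Us x)) (P (1/2) (Us x))" for x
      using P_half[of 1 "Us x"] by (simp add: adj_eqI[OF G])
    show "U (P 1 (Us (U (P 1 (Us x))))) = adj ip (adj ip T) (adj ip T x)" for x
      using Q_P[of 1] by (simp add: adj_adj[OF T] T_eq adj_T_eq flip: Q_def)
  qed
  then show ?thesis by (simp add: B_one)
qed

lemma U_P: assumes \<alpha>: "0 < \<alpha>" shows "U (P \<alpha> x) = B \<alpha> (U x)"
proof -
  have "U (op_abs ip T y) = op_abs ip (adj ip T) (U y)" for y
    using abs_adj_eq[of "U y"] P_Q[of 1 y] by (simp add: B_one P_one Q_def)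
  then show ?thesis unfolding P_def B_def
    by (rule op_powr_intertwine[where X=U, OF nonneg_abs nonneg_abs_adj bU _ \<alpha>])
qed

lemma Us_B: assumes \<alpha>: "0 < \<alpha>" shows "Us (B \<alpha> x) = P \<alpha> (Us x)"
proof -
  have "Us (op_abs ip (adj ip T) y) = op_abs ip T (Us y)" for y
    using abs_adj_eq[of y] Q_P[of 1 "Us y"] by (simp add: B_one P_one Q_def)
  then show ?thesis unfolding P_def B_def
    by (rule op_powr_intertwine[where X=Us, OF nonneg_abs_adj nonneg_abs bUs _ \<alpha>])
qed

lemma B_E: assumes \<alpha>: "0 < \<alpha>" shows "B \<alpha> (E x) = B \<alpha> x"
proof -
  have "B 1 (x - E x) = 0"
    by (simp add: abs_adj_eq bclin_diff[OF bUs] UsE bclin_zero[OF bP] bclin_zero[OF bU])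
  then have "B \<alpha> (x - E x) = 0"
    unfolding B_def by (rule op_powr_kernel[OF nonneg_abs_adj zero_less_one \<alpha>])
  then show ?thesis by (simp add: bclin_diff[OF bB[OF \<alpha>]])
qed

lemma E_B: "0 < \<alpha> \<Longrightarrow> E (B \<alpha> x) = B \<alpha> x"
  by (rule ip_eqI_right) (simp add: B_E flip: ip_selfadjoint[OF E_sa] ip_selfadjoint[OF selfadjoint_B])

lemma B_eq: "0 < \<alpha> \<Longrightarrow> B \<alpha> x = U (P \<alpha> (Us x))"
  using E_B[of \<alpha> x] by (simp add: E_def Us_B)

lemma range_Q_closure: assumes \<alpha>: "0 < \<alpha>" shows "Q x \<in> closure (range (P \<alpha>))"
proof -
  have "range (adj ip T) \<subseteq> range (P 1)" by (auto simp: adj_T_eq)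
  also have "range (P 1) \<subseteq> closure (range (P \<alpha>))"
    unfolding P_def by (rule op_powr_range_subset[OF nonneg_abs zero_less_one \<alpha>])
  finally have "range (adj ip T) \<subseteq> closure (range (P \<alpha>))" .
  then have "closure (range (adj ip T)) \<subseteq> closure (range (P \<alpha>))" by (rule closure_minimal) simp
  then show ?thesis using range_Q by blast
qed

lemma range_E_closure: assumes \<alpha>: "0 < \<alpha>" shows "E x \<in> closure (range (B \<alpha>))"
proof -
  have "U (Q (Us x)) \<in> closure (range (\<lambda>y. U (P \<alpha> y)))"
    by (rule bclin_closure_range[where X=U, OF bU range_Q_closure[OF \<alpha>]])
  moreover have "range (\<lambda>y. U (P \<alpha> y)) \<subseteq> range (B \<alpha>)" by (auto simp: U_P[OF \<alpha>])
  then have "closure (range (\<lambda>y. U (P \<alpha> y))) \<subseteq> closure (range (B \<alpha>))" by (rule closure_mono)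
  ultimately show ?thesis by (simp add: QUs E_def subset_iff)
qed

text \<open>The squares commute by assumption; one operator after the other is replaced by its root and then by a power.\<close>

lemma binormal_commute:
  assumes bn: "binormal ip T" and \<alpha>: "0 < \<alpha>" and \<beta>: "0 < \<beta>"
  shows "P \<alpha> (B \<beta> x) = B \<beta> (P \<alpha> x)"
proof -
  let ?M = "\<lambda>x. adj ip T (T x)" and ?N = "\<lambda>x. adj ip (adj ip T) (adj ip T x)"
  have M: "nonneg_op ?M" and N: "nonneg_op ?N"
    using nonneg_op_adjoint_square[OF T] nonneg_op_adjoint_square[OF adjointable_adj[OF T]] by auto
  have comm: "?N (?M y) = ?M (?N y)" for y
    using fun_cong[OF bn[unfolded binormal_def], of y] by (simp add: adj_adj[OF T])
  have absM: "op_abs ip T = op_powr ip ?M (1/2)" and absN: "op_abs ip (adj ip T) = op_powr ip ?N (1/2)"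
    by (simp_all add: op_abs_def comp_def)
  have half: "0 < (1/2::real)" by simp
  have bA: "bounded_clinear (op_abs ip T)"
    by (rule selfadjoint_bclin[OF nonneg_op_selfadjoint[OF nonneg_abs]])
  have 1: "?N (op_abs ip T y) = op_abs ip T (?N y)" for y
    unfolding absM
    by (rule op_powr_intertwine[where X="?N", OF M M selfadjoint_bclin[OF nonneg_op_selfadjoint[OF N]] comm half])
  have 2: "op_abs ip T (op_abs ip (adj ip T) y) = op_abs ip (adj ip T) (op_abs ip T y)" for y
    unfolding absN
    by (rule op_powr_intertwine[where X="op_abs ip T", OF N N bA 1[symmetric] half])
  have 3: "op_abs ip T (B \<beta> y) = B \<beta> (op_abs ip T y)" for y
    unfolding B_def
    by (rule op_powr_intertwine[where X="op_abs ip T", OF nonneg_abs_adj nonneg_abs_adj bA 2 \<beta>])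
  have "B \<beta> (P \<alpha> x) = P \<alpha> (B \<beta> x)"
    unfolding P_def
    by (rule op_powr_intertwine[where X="B \<beta>", OF nonneg_abs nonneg_abs bB[OF \<beta>] 3[symmetric] \<alpha>])
  then show ?thesis by simp
qed

lemma binormal_if_commute:
  assumes \<alpha>: "0 < \<alpha>" and \<beta>: "0 < \<beta>" and comm: "\<And>x. P \<alpha> (B \<beta> x) = B \<beta> (P \<alpha> x)"
  shows "binormal ip T"
proof -
  have 1: "B \<beta> (op_abs ip T x) = op_abs ip T (B \<beta> x)" for x
    by (rule commutes_if_commutes_op_powr[where X="B \<beta>", OF nonneg_abs \<alpha> bB[OF \<beta>]]) (simp add: comm flip: P_def)
  have 2: "op_abs ip T (op_abs ip (adj ip T) x) = op_abs ip (adj ip T) (op_abs ip T x)" for x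
    by (rule commutes_if_commutes_op_powr[where X="op_abs ip T", OF nonneg_abs_adj \<beta>
          selfadjoint_bclin[OF nonneg_op_selfadjoint[OF nonneg_abs]]]) (simp add: 1 flip: B_def)
  then have "P 1 (B 1 x) = B 1 (P 1 x)" for x by (simp add: P_one B_one)
  then have "P 1 (P 1 (B 1 (B 1 x))) = B 1 (B 1 (P 1 (P 1 x)))" for x by simp
  then show ?thesis by (simp add: binormal_def fun_eq_iff P_sq B_sq)
qed

abbreviation S :: "real \<Rightarrow> real \<Rightarrow> 'h \<Rightarrow> 'h" where
  "S \<alpha> \<beta> \<equiv> aluthge ip T U \<alpha> \<beta>"

lemma S_eq: "S \<alpha> \<beta> x = P \<alpha> (U (P \<beta> x))"
  by (simp add: aluthge_def P_def)

lemma S_pair: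
  assumes "0 < \<alpha>" "0 < \<beta>" shows "adjoint_pair ip (S \<alpha> \<beta>) (\<lambda>x. P \<beta> (Us (P \<alpha> x)))"
  using adjoint_pair_comp[OF selfadjoint_P[OF assms(1)] adjoint_pair_comp[OF U_pair selfadjoint_P[OF assms(2)]]]
  by (simp flip: S_eq)

lemma S_adjointable: "0 < \<alpha> \<Longrightarrow> 0 < \<beta> \<Longrightarrow> adjointable ip (S \<alpha> \<beta>)"
  by (rule adjoint_pairD[OF S_pair])

lemma S_adj: "0 < \<alpha> \<Longrightarrow> 0 < \<beta> \<Longrightarrow> adj ip (S \<alpha> \<beta>) = (\<lambda>x. P \<beta> (Us (P \<alpha> x)))"
  by (rule adj_eqI[OF S_pair])

definition Ut :: "'h \<Rightarrow> 'h" where "Ut = (\<lambda>x. Us (U (U x)))"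

lemma Ut_pair: "adjoint_pair ip Ut (\<lambda>x. Us (Us (U x)))"
  unfolding Ut_def by (rule adjoint_pair_comp[OF Us_pair adjoint_pair_comp[OF U_pair U_pair]])

lemma UU_pair: "adjoint_pair ip (U \<circ> U) (\<lambda>x. Us (Us x))"
  unfolding comp_def by (rule adjoint_pair_comp[OF U_pair U_pair])

text \<open>Both \<open>U\<^sup>* U\<^sup>2\<close> and \<open>U\<^sup>2\<close> have this initial operator; see \<open>adj_Ut_Ut\<close> and \<open>adj_UU_UU\<close>.\<close>

definition F :: "'h \<Rightarrow> 'h" where "F x = Us (Q (U x))"

lemma adj_Ut_Ut: "adj ip Ut (Ut x) = F x"
  unfolding adj_eqI[OF Ut_pair] using Q_idem by (simp add: F_def Ut_def Q_def)

lemma adj_UU_UU: "adj ip (U \<circ> U) ((U \<circ> U) x) = F x"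
  by (simp add: adj_eqI[OF UU_pair] F_def Q_def)

section \<open>Consequences of binormality\<close>

context
  assumes bn: "binormal ip T"
begin

lemmas PB = binormal_commute[OF bn]

text \<open>\<open>E\<close> projects onto the closure of the range of \<open>B 1\<close>, which \<open>P \<alpha>\<close> leaves invariant because it commutes with \<open>B 1\<close>.
  The next two lemmas follow the same pattern.\<close>

lemma E_P: assumes \<alpha>: "0 < \<alpha>" shows "E (P \<alpha> x) = P \<alpha> (E x)"
proof (rule selfadjoint_commute_if_invariant[OF E_sa selfadjoint_P[OF \<alpha>]])
  fix x
  have "P \<alpha> (E x) \<in> closure (range (\<lambda>y. P \<alpha> (B 1 y)))"
    by (rule bclin_closure_range[where X="P \<alpha>", OF bP[OF \<alpha>] range_E_closure]) simp
  then show "E (P \<alpha> (E x)) = P \<alpha> (E x)"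
    by (rule bclin_fixed_closure[OF bE, rotated]) (simp add: PB \<alpha> E_B)
qed

lemma Q_B: assumes \<alpha>: "0 < \<alpha>" shows "Q (B \<alpha> x) = B \<alpha> (Q x)"
proof (rule selfadjoint_commute_if_invariant[OF Q_sa selfadjoint_B[OF \<alpha>]])
  fix x
  have "B \<alpha> (Q x) \<in> closure (range (\<lambda>y. B \<alpha> (P 1 y)))"
    by (rule bclin_closure_range[where X="B \<alpha>", OF bB[OF \<alpha>] range_Q_closure]) simp
  then show "Q (B \<alpha> (Q x)) = B \<alpha> (Q x)"
    by (rule bclin_fixed_closure[OF bQ, rotated]) (simp add: PB[symmetric] \<alpha> Q_P)
qed

lemma Q_E: "Q (E x) = E (Q x)"
proof (rule selfadjoint_commute_if_invariant[OF Q_sa E_sa])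
  fix x
  have "E (Q x) \<in> closure (range (\<lambda>y. E (P 1 y)))"
    by (rule bclin_closure_range[where X=E, OF bE range_Q_closure]) simp
  then show "Q (E (Q x)) = E (Q x)"
    by (rule bclin_fixed_closure[OF bQ, rotated]) (simp add: E_P Q_P)
qed

lemma D_P:
  assumes "0 < \<alpha>" "0 < \<beta>" shows "Us (P \<alpha> (U (P \<beta> x))) = P \<beta> (Us (P \<alpha> (U x)))"
  using assms by (simp add: U_P PB Us_B)

text \<open>The candidate equals \<open>T\<^sub>\<alpha>\<^sub>/\<^sub>2\<^sub>,\<^sub>\<beta>\<^sub>/\<^sub>2\<^sup>* T\<^sub>\<alpha>\<^sub>/\<^sub>2\<^sub>,\<^sub>\<beta>\<^sub>/\<^sub>2\<close>, so it is positive. In its square the factor \<open>E\<close> between two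
  powers of \<open>|T|\<close> moves to the right by \<open>E_P\<close>, where \<open>U\<close> absorbs it.\<close>

lemma abs_S:
  assumes \<alpha>: "0 < \<alpha>" and \<beta>: "0 < \<beta>"
  shows "op_abs ip (S \<alpha> \<beta>) = (\<lambda>x. P \<beta> (Us (P \<alpha> (U x))))"
proof (rule op_abs_eqI[OF S_adjointable[OF \<alpha> \<beta>] S_adjointable[of "\<alpha>/2" "\<beta>/2"]])
  fix x
  have h: "0 < \<alpha>/2" "0 < \<beta>/2" using \<alpha> \<beta> by auto
  have "adj ip (S (\<alpha>/2) (\<beta>/2)) (S (\<alpha>/2) (\<beta>/2) x) = P (\<beta>/2) (Us (P \<alpha> (U (P (\<beta>/2) x))))"
    by (simp add: S_adj[OF h] S_eq P_half[OF \<alpha>])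
  also have "\<dots> = P \<beta> (Us (P \<alpha> (U x)))" by (simp add: D_P[OF \<alpha> h(2)] P_half[OF \<beta>])
  finally show "P \<beta> (Us (P \<alpha> (U x))) = adj ip (S (\<alpha>/2) (\<beta>/2)) (S (\<alpha>/2) (\<beta>/2) x)" by simp
  have "P \<beta> (Us (P \<alpha> (U (P \<beta> (Us (P \<alpha> (U x))))))) = P \<beta> (P \<beta> (Us (P \<alpha> (E (P \<alpha> (U x))))))"
    by (simp add: D_P[OF \<alpha> \<beta>] E_def)
  also have "\<dots> = P \<beta> (P \<beta> (Us (P \<alpha> (P \<alpha> (U x)))))" by (simp add: E_P[OF \<alpha>] EU)
  also have "\<dots> = P \<beta> (Us (P \<alpha> (P \<alpha> (U (P \<beta> x)))))"
    using \<alpha> \<beta> by (simp add: U_P PB Us_B)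
  finally show "P \<beta> (Us (P \<alpha> (U (P \<beta> (Us (P \<alpha> (U x))))))) = adj ip (S \<alpha> \<beta>) (S \<alpha> \<beta> x)"
    by (simp add: S_adj[OF \<alpha> \<beta>] S_eq)
qed (use \<alpha> \<beta> in auto)

lemma abs_adj_S:
  assumes \<alpha>: "0 < \<alpha>" and \<beta>: "0 < \<beta>"
  shows "op_abs ip (adj ip (S \<alpha> \<beta>)) = (\<lambda>x. P \<alpha> (B \<beta> x))"
proof -
  have h: "0 < \<alpha>/2" "0 < \<beta>/2" using \<alpha> \<beta> by auto
  have G: "adjoint_pair ip (\<lambda>x. B (\<beta>/2) (P (\<alpha>/2) x)) (\<lambda>x. P (\<alpha>/2) (B (\<beta>/2) x))"
    by (rule adjoint_pair_comp[OF selfadjoint_B[OF h(2)] selfadjoint_P[OF h(1)]])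
  show ?thesis
  proof (rule op_abs_eqI[OF adjointable_adj[OF S_adjointable[OF \<alpha> \<beta>]] adjoint_pairD[OF G]])
    fix x
    show "P \<alpha> (B \<beta> x) = adj ip (\<lambda>x. B (\<beta>/2) (P (\<alpha>/2) x)) (B (\<beta>/2) (P (\<alpha>/2) x))"
      by (simp add: adj_eqI[OF G] B_half[OF \<beta>] P_half[OF \<alpha>] PB[OF h(1) \<beta>, symmetric])
    have "S \<alpha> \<beta> (adj ip (S \<alpha> \<beta>) x) = P \<alpha> (B \<beta> (B \<beta> (P \<alpha> x)))"
      by (simp add: S_adj[OF \<alpha> \<beta>] S_eq U_P[OF \<beta>] B_E[OF \<beta>] flip: E_def)
    then show "P \<alpha> (B \<beta> (P \<alpha> (B \<beta> x))) = adj ip (adj ip (S \<alpha> \<beta>)) (adj ip (S \<alpha> \<beta>) x)"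
      by (simp add: adj_adj[OF S_adjointable[OF \<alpha> \<beta>]] PB[OF \<alpha> \<beta>])
  qed
qed

lemma S_eq_Ut_abs:
  assumes \<alpha>: "0 < \<alpha>" and \<beta>: "0 < \<beta>" shows "S \<alpha> \<beta> = Ut \<circ> op_abs ip (S \<alpha> \<beta>)"
proof
  fix x
  have "Ut (op_abs ip (S \<alpha> \<beta>) x) = Ut (Us (P \<alpha> (U (P \<beta> x))))"
    by (simp add: abs_S[OF \<alpha> \<beta>] D_P[OF \<alpha> \<beta>])
  also have "\<dots> = Q (E (P \<alpha> (U (P \<beta> x))))" by (simp add: Ut_def Q_def E_def)
  also have "\<dots> = S \<alpha> \<beta> x" by (simp add: E_P[OF \<alpha>] EU Q_P[OF \<alpha>] S_eq)
  finally show "S \<alpha> \<beta> x = (Ut \<circ> op_abs ip (S \<alpha> \<beta>)) x" by simp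
qed

lemma F_idem: "F (F x) = F x"
  using Q_E[of "Q (U x)"] Q_idem by (simp add: F_def Q_E E_def[symmetric] UsE)

text \<open>The adjoint of \<open>T\<^sub>\<alpha>\<^sub>,\<^sub>\<beta>\<close> is \<open>P\<^sup>\<beta> U\<^sup>* P\<^sup>\<alpha> = U\<^sup>* P\<^sup>\<alpha> B\<^sup>\<beta>\<close>. For density, \<open>F x = U\<^sup>* Q U x\<close> is a limit of vectors
  \<open>U\<^sup>* P\<^sup>\<alpha> y\<close>; here \<open>y\<close> may be replaced by \<open>E y\<close>, which in turn is a limit of vectors \<open>B\<^sup>\<beta> z\<close>.\<close>

lemma range_F:
  assumes \<alpha>: "0 < \<alpha>" and \<beta>: "0 < \<beta>" shows "closure (range (adj ip (S \<alpha> \<beta>))) = range F"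
proof
  have bF: "bounded_clinear F"
    unfolding F_def[abs_def] by (intro bounded_clinear_compose[OF bUs] bounded_clinear_compose[OF bQ] bU)
  have F_adj: "F (adj ip (S \<alpha> \<beta>) x) = adj ip (S \<alpha> \<beta>) x" for x
  proof -
    have "F (P \<beta> (Us (P \<alpha> x))) = Us (Q (B \<beta> (P \<alpha> x)))"
      by (simp add: F_def B_eq[OF \<beta>])
    also have "\<dots> = Us (B \<beta> (P \<alpha> x))" by (simp add: Q_B[OF \<beta>] Q_P[OF \<alpha>])
    also have "\<dots> = P \<beta> (Us (P \<alpha> x))" by (rule Us_B[OF \<beta>])
    finally show ?thesis by (simp add: S_adj[OF \<alpha> \<beta>])
  qed
  show "closure (range (adj ip (S \<alpha> \<beta>))) \<subseteq> range F"
  proof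
    fix y assume "y \<in> closure (range (adj ip (S \<alpha> \<beta>)))"
    with F_adj have "F y = y" by (rule bclin_fixed_closure[OF bF])
    then show "y \<in> range F" by (intro range_eqI[of y F y]) simp
  qed
  show "range F \<subseteq> closure (range (adj ip (S \<alpha> \<beta>)))"
  proof clarify
    fix x
    have 1: "Us (P \<alpha> y) \<in> closure (range (adj ip (S \<alpha> \<beta>)))" for y
    proof -
      have 1: "Us (P \<alpha> (E y)) = Us (P \<alpha> y)"
        by (simp add: UsE flip: E_P[OF \<alpha>])
      have 2: "(\<lambda>z. Us (P \<alpha> (B \<beta> z))) = adj ip (S \<alpha> \<beta>)"
        by (simp add: S_adj[OF \<alpha> \<beta>] PB[OF \<alpha> \<beta>] Us_B[OF \<beta>])
      have "Us (P \<alpha> (E y)) \<in> closure (range (\<lambda>z. Us (P \<alpha> (B \<beta> z))))"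
        by (intro bclin_closure_range[where X=Us, OF bUs] bclin_closure_range[where X="P \<alpha>", OF bP[OF \<alpha>]]
            range_E_closure[OF \<beta>])
      then show ?thesis unfolding 1 2 .
    qed
    have "F x \<in> closure (range (\<lambda>y. Us (P \<alpha> y)))"
      unfolding F_def by (rule bclin_closure_range[where X=Us, OF bUs range_Q_closure[OF \<alpha>]])
    moreover have "closure (range (\<lambda>y. Us (P \<alpha> y))) \<subseteq> closure (range (adj ip (S \<alpha> \<beta>)))"
      using 1 by (intro closure_minimal) auto
    ultimately show "F x \<in> closure (range (adj ip (S \<alpha> \<beta>)))" by blast
  qed
qed

lemma polar_S:
  assumes \<alpha>: "0 < \<alpha>" and \<beta>: "0 < \<beta>" shows "polar_decomposition act ip (S \<alpha> \<beta>) Ut"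
  by (rule polar_decompositionI[OF S_adjointable[OF \<alpha> \<beta>] adjoint_pairD[OF Ut_pair] _ S_eq_Ut_abs[OF \<alpha> \<beta>]])
    (simp_all add: adj_Ut_Ut F_idem range_F[OF \<alpha> \<beta>])

end

section \<open>The square of \<open>T\<close>\<close>

lemma adj_TT: "adj ip (T \<circ> T) = (\<lambda>x. adj ip (S 1 1) (Us x))"
  by (simp add: adj_comp[OF T T] adj_T_eq S_adj fun_eq_iff)

text \<open>Since \<open>U |T| U |T|\<close> and \<open>|T| U |T|\<close> differ by the factor \<open>U\<close>, which is isometric on the range of \<open>|T|\<close>, the two
  operators have the same inner squares.\<close>

lemma abs_TT: "op_abs ip (T \<circ> T) = op_abs ip (S 1 1)"
proof -
  have "adj ip (T \<circ> T) \<circ> (T \<circ> T) = adj ip (S 1 1) \<circ> S 1 1"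
    using Q_P[of 1] by (simp add: adj_TT S_adj S_eq T_eq fun_eq_iff flip: Q_def)
  then show ?thesis by (simp add: op_abs_def)
qed

lemma polar_TT:
  assumes bn: "binormal ip T" shows "polar_decomposition act ip (T \<circ> T) (U \<circ> U)"
proof (rule polar_decompositionI[OF adjointable_comp[OF T T] adjoint_pairD[OF UU_pair]])
  show "T \<circ> T = (U \<circ> U) \<circ> op_abs ip (T \<circ> T)"
  proof
    fix x
    have "U (U (op_abs ip (T \<circ> T) x)) = U (E (P 1 (U (P 1 x))))"
      by (simp add: abs_TT abs_S[OF bn] D_P[OF bn, symmetric] E_def)
    also have "\<dots> = T (T x)" by (simp add: E_P[OF bn] EU T_eq)
    finally show "(T \<circ> T) x = ((U \<circ> U) \<circ> op_abs ip (T \<circ> T)) x" by simp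
  qed
  have "adj ip (S 1 1) x = adj ip (T \<circ> T) (U x)" for x
    by (simp add: adj_TT S_adj P_Q flip: Q_def)
  then have "range (adj ip (T \<circ> T)) = range (adj ip (S 1 1))"
    by (auto simp: adj_TT)
  then show "closure (range (adj ip (T \<circ> T))) = range (\<lambda>x. adj ip (U \<circ> U) ((U \<circ> U) x))"
    using range_F[OF bn, of 1 1] by (simp only: adj_UU_UU)
  show "adj ip (U \<circ> U) ((U \<circ> U) (adj ip (U \<circ> U) ((U \<circ> U) x))) = adj ip (U \<circ> U) ((U \<circ> U) x)" for x
    by (simp only: adj_UU_UU F_idem[OF bn])
qed

lemma S_eq_Ut_abs_if_polar_TT:
  assumes "polar_decomposition act ip (T \<circ> T) (U \<circ> U)" shows "S 1 1 = Ut \<circ> op_abs ip (S 1 1)"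
proof
  fix x
  have "S 1 1 x = Us (T (T x))" using Q_P[of 1] by (simp add: S_eq T_eq flip: Q_def)
  also have "T (T x) = U (U (op_abs ip (S 1 1) x))"
    using polar_decompositionD(2)[OF assms, of x] by (simp add: abs_TT)
  finally show "S 1 1 x = (Ut \<circ> op_abs ip (S 1 1)) x" by (simp add: Ut_def)
qed

section \<open>Binormality from the factorization\<close>

text \<open>The operator \<open>U\<^sup>* U\<^sup>2\<close> is built from the contractions \<open>Q\<close> and \<open>U\<close>. Being isometric on the range of \<open>N\<close>, it loses
  nothing at either of them: the two defects are inner squares with sum 0, so each vanishes by properness.\<close>

lemma binormal_if_S_eq_Ut_abs:
  assumes \<alpha>: "0 < \<alpha>" and \<beta>: "0 < \<beta>" and eq: "S \<alpha> \<beta> = Ut \<circ> op_abs ip (S \<alpha> \<beta>)"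
  shows "binormal ip T"
proof -
  define N where "N = op_abs ip (S \<alpha> \<beta>)"
  have N: "selfadjoint ip N"
    unfolding N_def by (rule nonneg_op_selfadjoint[OF nonneg_op_abs[OF S_adjointable[OF \<alpha> \<beta>]]])
  have SV: "S \<alpha> \<beta> x = Q (U (N x))" for x
    using fun_cong[OF eq, of x] by (simp add: N_def Ut_def Q_def)
  have fixed: "Q (N x) = N x \<and> Q (U (N x)) = U (N x)" for x
  proof -
    define n where "n = N x"
    define w where "w = U n"
    have "ip n n = ip x (N (N x))" unfolding n_def by (rule ip_selfadjoint[OF N])
    also have "\<dots> = ip x (adj ip (S \<alpha> \<beta>) (S \<alpha> \<beta> x))"
      by (simp add: N_def op_abs_square[OF S_adjointable[OF \<alpha> \<beta>]])
    also have "\<dots> = ip (S \<alpha> \<beta> x) (S \<alpha> \<beta> x)" by (rule ip_adj[OF S_adjointable[OF \<alpha> \<beta>], symmetric])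
    finally have nn: "ip n n = ip (Q w) (Q w)" by (simp add: SV n_def w_def)
    have "ip w w = ip n (Q n)"
      using U_pair by (simp add: w_def adjoint_pair_def Q_def)
    also have "\<dots> = ip (Q n) (Q n)" using ip_selfadjoint[OF Q_sa, of n "Q n"] by (simp add: Q_idem)
    finally have ww: "ip w w = ip (Q n) (Q n)" .
    have sum: "ip (n - Q n) (n - Q n) + ip (w - Q w) (w - Q w) = 0"
      using projection_pythagoras[OF Q_sa Q_idem, of n] projection_pythagoras[OF Q_sa Q_idem, of w] nn ww
      by simp
    then have "n - Q n = 0" by (rule ip_sum_eq_0)
    moreover have "w - Q w = 0" using sum by (intro ip_sum_eq_0) (subst add.commute)
    ultimately show ?thesis by (simp add: n_def w_def)
  qed
  have SU: "S \<alpha> \<beta> x = U (N x)" for x using SV fixed by simp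
  have DN: "Us (P \<alpha> (U (P \<beta> x))) = N x" for x
    using SU[of x] fixed[of x] by (simp add: S_eq Q_def)
  have "adjoint_pair ip (\<lambda>x. Us (P \<alpha> (U (P \<beta> x)))) (\<lambda>x. P \<beta> (Us (P \<alpha> (U x))))"
    by (rule adjoint_pair_comp[OF Us_pair adjoint_pair_comp[OF selfadjoint_P[OF \<alpha>]
          adjoint_pair_comp[OF U_pair selfadjoint_P[OF \<beta>]]]])
  then have ND: "N x = P \<beta> (Us (P \<alpha> (U x)))" for x
    using adj_eqI[OF N] adj_eqI unfolding DN by metis
  have PBE: "P \<alpha> (B \<beta> x) = B \<beta> (P \<alpha> (E x))" for x
  proof -
    have "P \<alpha> (B \<beta> x) = S \<alpha> \<beta> (Us x)" by (simp add: S_eq B_eq[OF \<beta>])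
    also have "\<dots> = U (P \<beta> (Us (P \<alpha> (U (Us x)))))" by (simp add: SU ND)
    also have "\<dots> = B \<beta> (P \<alpha> (E x))" by (simp add: B_eq[OF \<beta>] E_def)
    finally show ?thesis .
  qed
  have EPB: "E (P \<alpha> (B \<beta> x)) = P \<alpha> (B \<beta> x)" for x
    unfolding PBE by (rule E_B[OF \<beta>])
  have "P \<alpha> (B \<beta> x) = B \<beta> (P \<alpha> x)" for x
  proof (rule ip_eqI_right)
    fix z
    have "ip z (B \<beta> (P \<alpha> x)) = ip (P \<alpha> (B \<beta> z)) x"
      by (simp add: ip_selfadjoint[OF selfadjoint_P[OF \<alpha>]] ip_selfadjoint[OF selfadjoint_B[OF \<beta>]])
    also have "\<dots> = ip (B \<beta> (P \<alpha> (E z))) x" by (simp only: PBE)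
    also have "\<dots> = ip z (E (P \<alpha> (B \<beta> x)))"
      by (simp add: ip_selfadjoint[OF selfadjoint_P[OF \<alpha>]] ip_selfadjoint[OF selfadjoint_B[OF \<beta>]]
          ip_selfadjoint[OF E_sa])
    finally show "ip z (P \<alpha> (B \<beta> x)) = ip z (B \<beta> (P \<alpha> x))" by (simp add: EPB)
  qed
  then show ?thesis by (rule binormal_if_commute[OF \<alpha> \<beta>])
qed

end

theorem theorem4p14:
  fixes act :: "'h::complex_banach \<Rightarrow> 'a::cstar_algebra \<Rightarrow> 'h"
    and ip :: "'h \<Rightarrow> 'h \<Rightarrow> 'a"
    and T U V :: "'h \<Rightarrow> 'h"
  assumes "hilbert_module act ip"
    and "adjointable ip T"
    and "polar_decomposition act ip T U"
    and V_def: "V = adj ip U \<circ> (U \<circ> U)"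
  shows "(polar_decomposition act ip (T \<circ> T) (U \<circ> U) \<longleftrightarrow> binormal ip T) \<and>
    (binormal ip T \<longleftrightarrow>
      (\<forall>\<alpha>>0. \<forall>\<beta>>0. polar_decomposition act ip (aluthge ip T U \<alpha> \<beta>) V)) \<and>
    (binormal ip T \<longleftrightarrow>
      (\<forall>\<alpha>>0. \<forall>\<beta>>0. aluthge ip T U \<alpha> \<beta> = V \<circ> op_abs ip (aluthge ip T U \<alpha> \<beta>))) \<and>
    (binormal ip T \<longleftrightarrow>
      (\<exists>\<alpha>>0. \<exists>\<beta>>0. aluthge ip T U \<alpha> \<beta> = V \<circ> op_abs ip (aluthge ip T U \<alpha> \<beta>))) \<and>
    (binormal ip T \<longrightarrow>
      (\<forall>\<alpha>>0. \<forall>\<beta>>0.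
        op_abs ip (aluthge ip T U \<alpha> \<beta>)
          = (adj ip U \<circ> op_powr ip (op_abs ip T) \<alpha> \<circ> U) \<circ> op_powr ip (op_abs ip T) \<beta> \<and>
        op_abs ip (aluthge ip T U \<alpha> \<beta>)
          = op_powr ip (op_abs ip T) \<beta> \<circ> (adj ip U \<circ> op_powr ip (op_abs ip T) \<alpha> \<circ> U) \<and>
        op_abs ip (adj ip (aluthge ip T U \<alpha> \<beta>))
          = op_powr ip (op_abs ip T) \<alpha> \<circ> op_powr ip (op_abs ip (adj ip T)) \<beta> \<and>
        op_abs ip (adj ip (aluthge ip T U \<alpha> \<beta>))
          = op_powr ip (op_abs ip (adj ip T)) \<beta> \<circ> op_powr ip (op_abs ip T) \<alpha>))"
proof -
  interpret hilbert_module act ip by (rule assms(1))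
  interpret polar_decomposed act ip 4 T U
    by unfold_locales (use weak_cauchy_schwarz assms in auto)
  have V: "V = Ut" by (simp add: V_def Ut_def Us_def fun_eq_iff)
  have one: "(0::real) < 1" by simp
  have formulas:
    "op_abs ip (S \<alpha> \<beta>) = (adj ip U \<circ> op_powr ip (op_abs ip T) \<alpha> \<circ> U) \<circ> op_powr ip (op_abs ip T) \<beta>"
    "op_abs ip (S \<alpha> \<beta>) = op_powr ip (op_abs ip T) \<beta> \<circ> (adj ip U \<circ> op_powr ip (op_abs ip T) \<alpha> \<circ> U)"
    "op_abs ip (adj ip (S \<alpha> \<beta>)) = op_powr ip (op_abs ip T) \<alpha> \<circ> op_powr ip (op_abs ip (adj ip T)) \<beta>"
    "op_abs ip (adj ip (S \<alpha> \<beta>)) = op_powr ip (op_abs ip (adj ip T)) \<beta> \<circ> op_powr ip (op_abs ip T) \<alpha>"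
    if bn: "binormal ip T" and \<alpha>: "0 < \<alpha>" and \<beta>: "0 < \<beta>" for \<alpha> \<beta>
  proof -
    have 1: "op_abs ip (S \<alpha> \<beta>) = P \<beta> \<circ> (Us \<circ> P \<alpha> \<circ> U)"
      using abs_S[OF bn \<alpha> \<beta>] by (simp add: comp_def)
    moreover have "P \<beta> \<circ> (Us \<circ> P \<alpha> \<circ> U) = (Us \<circ> P \<alpha> \<circ> U) \<circ> P \<beta>"
      using D_P[OF bn \<alpha> \<beta>] by (simp add: fun_eq_iff)
    ultimately show "op_abs ip (S \<alpha> \<beta>)
        = (adj ip U \<circ> op_powr ip (op_abs ip T) \<alpha> \<circ> U) \<circ> op_powr ip (op_abs ip T) \<beta>"
      by (simp add: P_def Us_def)
    show "op_abs ip (S \<alpha> \<beta>)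
        = op_powr ip (op_abs ip T) \<beta> \<circ> (adj ip U \<circ> op_powr ip (op_abs ip T) \<alpha> \<circ> U)"
      using 1 by (simp add: P_def Us_def)
    have 2: "op_abs ip (adj ip (S \<alpha> \<beta>)) = P \<alpha> \<circ> B \<beta>"
      using abs_adj_S[OF bn \<alpha> \<beta>] by (simp add: comp_def)
    then show "op_abs ip (adj ip (S \<alpha> \<beta>))
        = op_powr ip (op_abs ip T) \<alpha> \<circ> op_powr ip (op_abs ip (adj ip T)) \<beta>"
      by (simp add: P_def B_def)
    have "P \<alpha> \<circ> B \<beta> = B \<beta> \<circ> P \<alpha>" using PB[OF bn \<alpha> \<beta>] by (simp add: fun_eq_iff)
    then show "op_abs ip (adj ip (S \<alpha> \<beta>))
        = op_powr ip (op_abs ip (adj ip T)) \<beta> \<circ> op_powr ip (op_abs ip T) \<alpha>"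
      using 2 by (simp add: P_def B_def)
  qed
  have iv: "S \<alpha> \<beta> = Ut \<circ> op_abs ip (S \<alpha> \<beta>)"
    if "polar_decomposition act ip (S \<alpha> \<beta>) Ut" for \<alpha> \<beta>
    using that by (simp add: polar_decomposition_def)
  have to_binormal: "binormal ip T" if "0 < \<alpha>" "0 < \<beta>" "S \<alpha> \<beta> = Ut \<circ> op_abs ip (S \<alpha> \<beta>)" for \<alpha> \<beta>
    using that by (rule binormal_if_S_eq_Ut_abs)
  show ?thesis
    unfolding V
  proof (intro conjI iffI allI impI)
    assume "polar_decomposition act ip (T \<circ> T) (U \<circ> U)"
    then show "binormal ip T" by (rule to_binormal[OF one one S_eq_Ut_abs_if_polar_TT])
  next
    assume "\<forall>\<alpha>>0. \<forall>\<beta>>0. polar_decomposition act ip (S \<alpha> \<beta>) Ut"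
    then show "binormal ip T" using one by (intro to_binormal[OF one one iv]) blast
  next
    assume "\<forall>\<alpha>>0. \<forall>\<beta>>0. S \<alpha> \<beta> = Ut \<circ> op_abs ip (S \<alpha> \<beta>)"
    then show "binormal ip T" using one by (intro to_binormal[OF one one]) blast
  next
    assume "\<exists>\<alpha>>0. \<exists>\<beta>>0. S \<alpha> \<beta> = Ut \<circ> op_abs ip (S \<alpha> \<beta>)"
    then show "binormal ip T" using to_binormal by blast
  next
    assume "binormal ip T"
    then show "\<exists>\<alpha>>0. \<exists>\<beta>>0. S \<alpha> \<beta> = Ut \<circ> op_abs ip (S \<alpha> \<beta>)"
      using S_eq_Ut_abs one by blast
  qed (rule polar_TT polar_S S_eq_Ut_abs formulas; assumption)+
qed

end
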